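(* Let $k$ be a field of characteristic zero, let $Q$ be a finite connected quiver, and let $A=kQ/\langle Z\rangle$ be a finite-dimensional monomial algebra. Then $$\dim_k HH_1(A) = s + \sum_{C \in \mathcal E} w_C - e,$$ where $\mathcal E$ is the set of efficient circuits, $e=|\mathcal E|$, $s$ is the number of non trivial strong circuits, and $w_C=|W\cap C|$.
   Context: Quiver: vertices $Q_0$, arrows $Q_1$, source and terminal maps $s,t:Q_1\to Q_0$. A path of length $l\ge 1$ is a sequence $a_l\cdots a_1$ of arrows with $t(a_i)=s(a_{i+1})$; its source is $s(a_1)$, its terminal vertex is $t(a_l)$. Vertices are the (trivial) paths of length $0$. A cycle is a path whose source and terminal vertex coincide. The product in $kQ$ is concatenation. $Z$ is a set of paths of length at least two, minimal for the subpath order (no strict subpath of an element of $Z$ is in $Z$), and $A=kQ/\langle Z\rangle$. $B$ is the set of paths (including vertices) containing no path of $Z$ as a subpath; it is identified with a $k$-basis of $A$. A zero path (zero cycle) is a path (cycle) containing a path of $Z$. $HH_1(A)=H_1(A,A)$ is the first Hochschild homology group $\mathrm{Tor}_1(A,A)$ over $A$-$A$-bimodules. For sets of paths $X,Y$: $X\odot Y=\{(\alpha,\beta)\in X\times Y: t(\beta)=s(\alpha),\ t(\alpha)=s(\beta)\}$. A circuit is an equivalence class of cycles under the equivalence relation generated by rotation $a_n\cdots a_1\sim a_1a_n\cdots a_2$ ($a_i$ arrows); it is trivial if it corresponds to a vertex. For a circuit $C$, $(X\odot Y)_C=\{(\alpha,\beta)\in X\odot Y:\alpha\beta\in C\}$.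 A circuit $C$ is useful if $(Q_1\odot B)_C\ne\emptyset$; strong if every cycle of $C$ belongs to $B$; efficient if it is useful, not strong, and $(Z\odot B)_C\neq\emptyset$. $W$ is the set of cycles $\gamma$ of $Q$ of the form $\gamma=\xi\alpha$ with $\xi\in Z$ such that no other subpath of $\gamma$ (no other occurrence) belongs to $Z$; $w_C=|W\cap C|$. *)

theory Defs
  imports
    "Graph_Theory.Graph_Theory"
    "Jordan_Normal_Form.VS_Connect"
    "HOL-Algebra.QuotRing"
    "HOL-Library.Poly_Mapping"
begin

section \<open>Vector spaces and algebras over a field\<close>

text \<open>
  The ground field is a type \<open>'k\<close> of class \<open>field\<close>, seen as the record \<open>class_ring\<close>. Vector
  spaces, and associative not necessarily commutative algebras, over it are records of type
  \<open>('k, 'v) module\<close>; when such a record is only used as a vector space, its fields \<open>mult\<close> and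
  \<open>one\<close> carry no information.
\<close>

definition free_space :: "'x set \<Rightarrow> ('k::field, 'x \<Rightarrow>\<^sub>0 'k) module" where
  "free_space X =
     \<lparr>carrier = {f. Poly_Mapping.keys f \<subseteq> X}, mult = undefined, one = undefined, zero = 0, add = (+),
      smult = (\<lambda>c. Poly_Mapping.map ((*) c))\<rparr>"

definition lin_ext :: "('x \<Rightarrow> ('y \<Rightarrow>\<^sub>0 'k)) \<Rightarrow> ('x \<Rightarrow>\<^sub>0 'k) \<Rightarrow> ('y \<Rightarrow>\<^sub>0 'k::field)" where
  "lin_ext g f =
     (\<Sum>x\<in>Poly_Mapping.keys f. Poly_Mapping.map ((*) (Poly_Mapping.lookup f x)) (g x))"

abbreviation lin_span :: "('k::field, 'v) module \<Rightarrow> 'v set \<Rightarrow> 'v set" where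
  "lin_span V S \<equiv> LinearCombinations.module.span class_ring V S"

text \<open>
  Elements of a quotient are cosets. For a two-sided ideal \<open>U\<close> of an algebra \<open>V\<close>, this is the
  quotient algebra.
\<close>

definition quot_module :: "('k, 'v) module \<Rightarrow> 'v set \<Rightarrow> ('k, 'v set) module" where
  "quot_module V U =
     ring.extend (V Quot U) (module.fields (\<lambda>c X. \<Union>x\<in>X. U +>\<^bsub>V\<^esub> (c \<odot>\<^bsub>V\<^esub> x)))"

text \<open>The map into \<open>V/U\<close> induced on cosets by a map \<open>f\<close> with values in \<open>V\<close>.\<close>

definition quot_map :: "('k, 'v) module \<Rightarrow> 'v set \<Rightarrow> ('w \<Rightarrow> 'v) \<Rightarrow> 'w set \<Rightarrow> 'v set" where
  "quot_map V U f X = (\<Union>x\<in>X. U +>\<^bsub>V\<^esub> f x)"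


section \<open>Bimodules and Hochschild homology\<close>

record ('k, 'm, 'a) bimodule = "('k, 'm) module" +
  lact :: "'a \<Rightarrow> 'm \<Rightarrow> 'm"
  ract :: "'m \<Rightarrow> 'a \<Rightarrow> 'm"

definition regular_bimodule :: "('k, 'a) module \<Rightarrow> ('k, 'a, 'a) bimodule" where
  "regular_bimodule A = module.extend A (bimodule.fields (mult A) (mult A))"

text \<open>
  The tensor product \<open>M \<otimes> N\<close> over the enveloping algebra of \<open>A\<close>: besides bilinearity, the
  relations are \<open>ma \<otimes> n = m \<otimes> an\<close> and \<open>am \<otimes> n = m \<otimes> na\<close>.
\<close>

definition tensor_relations ::
  "('k::field, 'a) module \<Rightarrow> ('k, 'm, 'a) bimodule \<Rightarrow> ('k, 'n, 'a) bimodule \<Rightarrow>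
     ('m \<times> 'n \<Rightarrow>\<^sub>0 'k) set"
where
  "tensor_relations A M N =
     {Poly_Mapping.single (m \<oplus>\<^bsub>M\<^esub> m', n) 1 - Poly_Mapping.single (m, n) 1
        - Poly_Mapping.single (m', n) 1
      | m m' n. m \<in> carrier M \<and> m' \<in> carrier M \<and> n \<in> carrier N}
   \<union> {Poly_Mapping.single (m, n \<oplus>\<^bsub>N\<^esub> n') 1 - Poly_Mapping.single (m, n) 1
        - Poly_Mapping.single (m, n') 1
      | m n n'. m \<in> carrier M \<and> n \<in> carrier N \<and> n' \<in> carrier N}
   \<union> {Poly_Mapping.single (c \<odot>\<^bsub>M\<^esub> m, n) 1 - Poly_Mapping.single (m, n) c
      | c m n. m \<in> carrier M \<and> n \<in> carrier N}
   \<union> {Poly_Mapping.single (m, c \<odot>\<^bsub>N\<^esub> n) 1 - Poly_Mapping.single (m, n) c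
      | c m n. m \<in> carrier M \<and> n \<in> carrier N}
   \<union> {Poly_Mapping.single (ract M m a, n) 1 - Poly_Mapping.single (m, lact N a n) 1
      | a m n. a \<in> carrier A \<and> m \<in> carrier M \<and> n \<in> carrier N}
   \<union> {Poly_Mapping.single (lact M a m, n) 1 - Poly_Mapping.single (m, ract N n a) 1
      | a m n. a \<in> carrier A \<and> m \<in> carrier M \<and> n \<in> carrier N}"

definition tensor_null ::
  "('k::field, 'a) module \<Rightarrow> ('k, 'm, 'a) bimodule \<Rightarrow> ('k, 'n, 'a) bimodule \<Rightarrow>
     ('m \<times> 'n \<Rightarrow>\<^sub>0 'k) set"
where
  "tensor_null A M N =
     lin_span (free_space (carrier M \<times> carrier N)) (tensor_relations A M N)"

definition bimodule_tensor ::
  "('k::field, 'a) module \<Rightarrow> ('k, 'm, 'a) bimodule \<Rightarrow> ('k, 'n, 'a) bimodule \<Rightarrow>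
     ('k, ('m \<times> 'n \<Rightarrow>\<^sub>0 'k) set) module"
where
  "bimodule_tensor A M N =
     quot_module (free_space (carrier M \<times> carrier N)) (tensor_null A M N)"

text \<open>The map \<open>id \<otimes> f\<close> from \<open>M \<otimes> N'\<close> to \<open>M \<otimes> N\<close>, for \<open>f\<close> from \<open>N'\<close> to \<open>N\<close>.\<close>

definition tensor_map ::
  "('k::field, 'a) module \<Rightarrow> ('k, 'm, 'a) bimodule \<Rightarrow> ('k, 'n, 'a) bimodule \<Rightarrow>
     ('n' \<Rightarrow> 'n) \<Rightarrow> ('m \<times> 'n' \<Rightarrow>\<^sub>0 'k) set \<Rightarrow> ('m \<times> 'n \<Rightarrow>\<^sub>0 'k) set"
where
  "tensor_map A M N f =
     quot_map (free_space (carrier M \<times> carrier N)) (tensor_null A M N)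
       (lin_ext (\<lambda>(m, n). Poly_Mapping.single (m, f n) 1))"

text \<open>
  The tensor powers of \<open>A\<close> over the ground field: the pure tensor of \<open>a\<^sub>1, \<dots>, a\<^sub>r\<close> is the class of
  the generator \<open>[a\<^sub>1, \<dots>, a\<^sub>r]\<close>.
\<close>

definition power_space :: "('k::field, 'a) module \<Rightarrow> nat \<Rightarrow> ('k, 'a list \<Rightarrow>\<^sub>0 'k) module" where
  "power_space A r = free_space {xs. length xs = r \<and> set xs \<subseteq> carrier A}"

definition power_null :: "('k::field, 'a) module \<Rightarrow> nat \<Rightarrow> ('a list \<Rightarrow>\<^sub>0 'k) set" where
  "power_null A r = lin_span (power_space A r)
    ({Poly_Mapping.single (us @ (x \<oplus>\<^bsub>A\<^esub> y) # vs) 1 - Poly_Mapping.single (us @ x # vs) 1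
        - Poly_Mapping.single (us @ y # vs) 1
      | us x y vs. length us + 1 + length vs = r \<and> set us \<union> {x, y} \<union> set vs \<subseteq> carrier A}
   \<union> {Poly_Mapping.single (us @ (c \<odot>\<^bsub>A\<^esub> x) # vs) 1 - Poly_Mapping.single (us @ x # vs) c
      | us c x vs. length us + 1 + length vs = r \<and> set us \<union> {x} \<union> set vs \<subseteq> carrier A})"

text \<open>
  The bar resolution of \<open>A\<close>: in degree \<open>n\<close> it is the \<open>(n + 2)\<close>-nd tensor power of \<open>A\<close>, with \<open>A\<close>
  acting on the outer factors. Over a field it is a resolution of \<open>A\<close> by free bimodules.
\<close>

definition bar :: "('k::field, 'a) module \<Rightarrow> nat \<Rightarrow> ('k, ('a list \<Rightarrow>\<^sub>0 'k) set, 'a) bimodule" where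
  "bar A n =
     module.extend (quot_module (power_space A (n + 2)) (power_null A (n + 2)))
       (bimodule.fields
         (\<lambda>a. quot_map (power_space A (n + 2)) (power_null A (n + 2))
           (lin_ext (\<lambda>xs. Poly_Mapping.single ((a \<otimes>\<^bsub>A\<^esub> hd xs) # tl xs) 1)))
         (\<lambda>X a. quot_map (power_space A (n + 2)) (power_null A (n + 2))
           (lin_ext (\<lambda>xs. Poly_Mapping.single (butlast xs @ [last xs \<otimes>\<^bsub>A\<^esub> a]) 1)) X))"

text \<open>The differential from degree \<open>n\<close> to degree \<open>n - 1\<close>, for \<open>n \<ge> 1\<close>.\<close>

definition bar_diff ::
  "('k::field, 'a) module \<Rightarrow> nat \<Rightarrow> ('a list \<Rightarrow>\<^sub>0 'k) set \<Rightarrow> ('a list \<Rightarrow>\<^sub>0 'k) set"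
where
  "bar_diff A n =
     quot_map (power_space A (n + 1)) (power_null A (n + 1))
       (lin_ext (\<lambda>xs. \<Sum>i\<le>n.
          Poly_Mapping.single (take i xs @ (xs ! i \<otimes>\<^bsub>A\<^esub> xs ! Suc i) # drop (i + 2) xs) ((- 1) ^ i)))"

text \<open>
  The \<open>n\<close>-th Hochschild homology group of \<open>A\<close> is the \<open>n\<close>-th Tor of the bimodules \<open>A\<close> and \<open>A\<close>: the
  homology in degree \<open>n\<close> of the complex obtained by tensoring \<open>A\<close>, over the enveloping algebra,
  with the bar resolution.
\<close>

definition HH_chain ::
  "('k::field, 'a) module \<Rightarrow> nat \<Rightarrow> ('k, ('a \<times> ('a list \<Rightarrow>\<^sub>0 'k) set \<Rightarrow>\<^sub>0 'k) set) module"
where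
  "HH_chain A n = bimodule_tensor A (regular_bimodule A) (bar A n)"

definition HH_diff ::
  "('k::field, 'a) module \<Rightarrow> nat \<Rightarrow>
     ('a \<times> ('a list \<Rightarrow>\<^sub>0 'k) set \<Rightarrow>\<^sub>0 'k) set \<Rightarrow> ('a \<times> ('a list \<Rightarrow>\<^sub>0 'k) set \<Rightarrow>\<^sub>0 'k) set"
where
  "HH_diff A n = tensor_map A (regular_bimodule A) (bar A (n - 1)) (bar_diff A n)"

definition HH ::
  "nat \<Rightarrow> ('k::field, 'a) module \<Rightarrow>
     ('k, ('a \<times> ('a list \<Rightarrow>\<^sub>0 'k) set \<Rightarrow>\<^sub>0 'k) set set) module"
where
  "HH n A =
     quot_module
       (HH_chain A n\<lparr>carrier :=
          {x \<in> carrier (HH_chain A n). n > 0 \<longrightarrow> HH_diff A n x = \<zero>\<^bsub>HH_chain A (n - 1)\<^esub>}\<rparr>)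
       (HH_diff A (n + 1) ` carrier (HH_chain A (n + 1)))"


section \<open>Quivers and paths\<close>

text \<open>
  Quivers are the directed multigraphs of \<open>Graph_Theory\<close>, \<open>tail\<close> and \<open>head\<close> being the source and
  terminal maps. A path is its source together with the list of its arrows in the order in which
  they are run through: the path written \<open>a\<^sub>l \<cdots> a\<^sub>1\<close> is \<open>(s(a\<^sub>1), [a\<^sub>1, \<dots>, a\<^sub>l])\<close>, and the vertex \<open>v\<close> is
  \<open>(v, [])\<close>.
\<close>

type_synonym ('v, 'e) qpath = "'v \<times> 'e list"

definition qpaths :: "('v, 'e) pre_digraph \<Rightarrow> ('v, 'e) qpath set" where
  "qpaths Q = {(u, p). \<exists>v. pre_digraph.awalk Q u p v}"

abbreviation psrc :: "('v, 'e) qpath \<Rightarrow> 'v" where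
  "psrc \<gamma> \<equiv> fst \<gamma>"

definition ptgt :: "('v, 'e) pre_digraph \<Rightarrow> ('v, 'e) qpath \<Rightarrow> 'v" where
  "ptgt Q \<gamma> = last (pre_digraph.awalk_verts Q (fst \<gamma>) (snd \<gamma>))"

abbreviation plength :: "('v, 'e) qpath \<Rightarrow> nat" where
  "plength \<gamma> \<equiv> length (snd \<gamma>)"

text \<open>
  The concatenation written \<open>\<alpha>\<beta>\<close>, in which \<open>\<beta>\<close> comes first; it is meaningful if the terminal
  vertex of \<open>\<beta>\<close> is the source of \<open>\<alpha>\<close>.
\<close>

definition pcomp :: "('v, 'e) qpath \<Rightarrow> ('v, 'e) qpath \<Rightarrow> ('v, 'e) qpath" where
  "pcomp \<alpha> \<beta> = (psrc \<beta>, snd \<beta> @ snd \<alpha>)"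

text \<open>The subpath of \<open>\<gamma>\<close> that starts after \<open>i\<close> arrows and has the length of \<open>\<xi>\<close> is \<open>\<xi>\<close>.\<close>

definition occurs_at ::
  "('v, 'e) pre_digraph \<Rightarrow> ('v, 'e) qpath \<Rightarrow> ('v, 'e) qpath \<Rightarrow> nat \<Rightarrow> bool"
where
  "occurs_at Q \<xi> \<gamma> i \<longleftrightarrow>
     i + plength \<xi> \<le> plength \<gamma> \<and>
     take (plength \<xi>) (drop i (snd \<gamma>)) = snd \<xi> \<and>
     pre_digraph.awalk_verts Q (fst \<gamma>) (snd \<gamma>) ! i = psrc \<xi>"

definition is_subpath :: "('v, 'e) pre_digraph \<Rightarrow> ('v, 'e) qpath \<Rightarrow> ('v, 'e) qpath \<Rightarrow> bool" where
  "is_subpath Q \<xi> \<gamma> \<longleftrightarrow> (\<exists>i. occurs_at Q \<xi> \<gamma> i)"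

definition arrow_paths :: "('v, 'e) pre_digraph \<Rightarrow> ('v, 'e) qpath set" where
  "arrow_paths Q = {(tail Q a, [a]) | a. a \<in> arcs Q}"

definition cycles :: "('v, 'e) pre_digraph \<Rightarrow> ('v, 'e) qpath set" where
  "cycles Q = {\<gamma> \<in> qpaths Q. psrc \<gamma> = ptgt Q \<gamma>}"


section \<open>Monomial algebras\<close>

definition path_algebra :: "('v, 'e) pre_digraph \<Rightarrow> ('k::field, ('v, 'e) qpath \<Rightarrow>\<^sub>0 'k) module" where
  "path_algebra Q =
     \<lparr>carrier = {f. Poly_Mapping.keys f \<subseteq> qpaths Q},
      mult = (\<lambda>f g. \<Sum>\<alpha>\<in>Poly_Mapping.keys f. \<Sum>\<beta>\<in>Poly_Mapping.keys g.
        if ptgt Q \<beta> = psrc \<alpha>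
        then Poly_Mapping.single (pcomp \<alpha> \<beta>) (Poly_Mapping.lookup f \<alpha> * Poly_Mapping.lookup g \<beta>)
        else 0),
      one = (\<Sum>v\<in>verts Q. Poly_Mapping.single (v, []) 1),
      zero = 0, add = (+), smult = (\<lambda>c. Poly_Mapping.map ((*) c))\<rparr>"

definition monomial_relations :: "('v, 'e) pre_digraph \<Rightarrow> ('v, 'e) qpath set \<Rightarrow> bool" where
  "monomial_relations Q Z \<longleftrightarrow>
     Z \<subseteq> qpaths Q \<and> (\<forall>\<zeta>\<in>Z. plength \<zeta> \<ge> 2) \<and>
     (\<forall>\<zeta>\<in>Z. \<forall>\<xi>\<in>Z. is_subpath Q \<xi> \<zeta> \<longrightarrow> \<xi> = \<zeta>)"

definition monomial_algebra ::
  "('v, 'e) pre_digraph \<Rightarrow> ('v, 'e) qpath set \<Rightarrow> ('k::field, (('v, 'e) qpath \<Rightarrow>\<^sub>0 'k) set) module"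
where
  "monomial_algebra Q Z =
     quot_module (path_algebra Q)
       (genideal (path_algebra Q) ((\<lambda>\<zeta>. Poly_Mapping.single \<zeta> 1) ` Z))"

text \<open>The set \<open>B\<close> of nonzero paths.\<close>

definition nonzero_paths ::
  "('v, 'e) pre_digraph \<Rightarrow> ('v, 'e) qpath set \<Rightarrow> ('v, 'e) qpath set"
where
  "nonzero_paths Q Z = {\<gamma> \<in> qpaths Q. \<not> (\<exists>\<zeta>\<in>Z. is_subpath Q \<zeta> \<gamma>)}"


section \<open>Circuits\<close>

definition rotation :: "('v, 'e) pre_digraph \<Rightarrow> ('v, 'e) qpath rel" where
  "rotation Q = {((u, a # p), (head Q a, p @ [a])) | u a p. (u, a # p) \<in> cycles Q}"

definition circuits :: "('v, 'e) pre_digraph \<Rightarrow> ('v, 'e) qpath set set" where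
  "circuits Q = cycles Q // (rotation Q \<union> (rotation Q)\<inverse>)\<^sup>*"

definition trivial_circuit :: "('v, 'e) pre_digraph \<Rightarrow> ('v, 'e) qpath set \<Rightarrow> bool" where
  "trivial_circuit Q C \<longleftrightarrow> (\<exists>v\<in>verts Q. C = {(v, [])})"

definition odot ::
  "('v, 'e) pre_digraph \<Rightarrow> ('v, 'e) qpath set \<Rightarrow> ('v, 'e) qpath set \<Rightarrow>
     (('v, 'e) qpath \<times> ('v, 'e) qpath) set"
where
  "odot Q X Y = {(\<alpha>, \<beta>) \<in> X \<times> Y. ptgt Q \<beta> = psrc \<alpha> \<and> ptgt Q \<alpha> = psrc \<beta>}"

definition odot_at ::
  "('v, 'e) pre_digraph \<Rightarrow> ('v, 'e) qpath set \<Rightarrow> ('v, 'e) qpath set \<Rightarrow> ('v, 'e) qpath set \<Rightarrow>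
     (('v, 'e) qpath \<times> ('v, 'e) qpath) set"
where
  "odot_at Q X Y C = {(\<alpha>, \<beta>) \<in> odot Q X Y. pcomp \<alpha> \<beta> \<in> C}"

definition useful ::
  "('v, 'e) pre_digraph \<Rightarrow> ('v, 'e) qpath set \<Rightarrow> ('v, 'e) qpath set \<Rightarrow> bool"
where
  "useful Q Z C \<longleftrightarrow> odot_at Q (arrow_paths Q) (nonzero_paths Q Z) C \<noteq> {}"

definition strong ::
  "('v, 'e) pre_digraph \<Rightarrow> ('v, 'e) qpath set \<Rightarrow> ('v, 'e) qpath set \<Rightarrow> bool"
where
  "strong Q Z C \<longleftrightarrow> C \<subseteq> nonzero_paths Q Z"

definition efficient ::
  "('v, 'e) pre_digraph \<Rightarrow> ('v, 'e) qpath set \<Rightarrow> ('v, 'e) qpath set \<Rightarrow> bool"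
where
  "efficient Q Z C \<longleftrightarrow>
     useful Q Z C \<and> \<not> strong Q Z C \<and> odot_at Q Z (nonzero_paths Q Z) C \<noteq> {}"

definition efficient_circuits ::
  "('v, 'e) pre_digraph \<Rightarrow> ('v, 'e) qpath set \<Rightarrow> ('v, 'e) qpath set set"
where
  "efficient_circuits Q Z = {C \<in> circuits Q. efficient Q Z C}"

definition nontrivial_strong_circuits ::
  "('v, 'e) pre_digraph \<Rightarrow> ('v, 'e) qpath set \<Rightarrow> ('v, 'e) qpath set set"
where
  "nontrivial_strong_circuits Q Z =
     {C \<in> circuits Q. strong Q Z C \<and> \<not> trivial_circuit Q C}"

text \<open>
  The set \<open>W\<close>. The factor \<open>\<alpha>\<close> is a path of any length, possibly a vertex. In \<open>\<xi>\<alpha>\<close>, the path \<open>\<xi>\<close>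
  starts after the arrows of \<open>\<alpha>\<close>, and no other occurrence of an element of \<open>Z\<close>, not even of \<open>\<xi>\<close>
  itself, is allowed.
\<close>

definition W_cycles ::
  "('v, 'e) pre_digraph \<Rightarrow> ('v, 'e) qpath set \<Rightarrow> ('v, 'e) qpath set"
where
  "W_cycles Q Z =
     {\<gamma> \<in> cycles Q. \<exists>\<xi>\<in>Z. \<exists>\<alpha>\<in>qpaths Q.
        ptgt Q \<alpha> = psrc \<xi> \<and> \<gamma> = pcomp \<xi> \<alpha> \<and>
        (\<forall>\<zeta>\<in>Z. \<forall>i. occurs_at Q \<zeta> \<gamma> i \<longrightarrow> \<zeta> = \<xi> \<and> i = plength \<alpha>)}"

end

theory Submission
  imports Defs
begin

text \<open>
  Computed with the bar resolution, \<open>HH\<^sub>1(A)\<close> is the kernel of \<open>a \<otimes> x \<mapsto> ax - xa\<close> on \<open>A \<otimes> A\<close>, modulo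
  \<open>ax \<otimes> y - a \<otimes> xy + ya \<otimes> x\<close>: the tensor \<open>a \<otimes> x\<close> behaves like \<open>a dx\<close> up to commutators. By the Leibniz
  rule, all classes are combinations of terms \<open>\<beta> dc\<close>, with \<open>c\<close> an arrow and \<open>\<beta>\<close> a nonzero path such
  that \<open>\<gamma> = c\<beta>\<close> is a cycle. A combination with coefficients \<open>\<kappa>(\<gamma>)\<close> is in the kernel if and only if
  \<open>\<kappa>\<close> takes the same value on each nonzero cycle and on its rotation. Hence \<open>\<kappa>\<close> is constant on the
  maximal runs of rotations through nonzero cycles. A non trivial strong circuit is a single run; in
  the other circuits every run stops at exactly one zero cycle, and these zero cycles form the set
  \<open>W\<close>. The relations come from \<open>\<alpha> d\<xi> = 0\<close> with \<open>\<xi> \<in> Z\<close>: by the Leibniz rule \<open>\<alpha> d\<xi>\<close> is a positive multiple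
  of the sum of all \<open>\<beta> dc\<close> in the circuit of \<open>\<xi>\<alpha>\<close>, because a nonzero \<open>\<beta>\<close> cannot contain \<open>\<xi>\<close>. In
  characteristic zero this makes one relation for every efficient circuit.
\<close>

section \<open>Finitely supported functions as vectors\<close>

text \<open>A tensor \<alpha> dx need not close up to a cycle. Inserting vertices into Leibniz's
  rule reduces such tensors to the terms \<open>eta \<alpha>\<close>, where \<alpha> is a nonzero
  path that is not a cycle; the boundary of \<open>eta \<alpha>\<close> is \<alpha> itself, so these
  terms do not contribute to one-cycles. Leibniz's rule alone shows that the classes span. Their
  independence needs a linear map on chains that recovers the coefficients \<kappa>, and the
  obstacle is that the natural one does not kill all boundaries: the map \<open>F\<close>, which
  spreads dx over the arrows of x, can break Leibniz's rule when a product of two nonzero paths is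
  zero. Its defect is then the sum over a full turn of a circuit, so it is well defined modulo
  \<open>osums\<close>, and the same sums are the relations produced by \<alpha> d\<xi> = 0. The
  multiple in that relation comes from circuits that are proper powers: their rotations repeat
  within a full turn, each as often as the exponent says. This exponent is the number that has to be
  inverted.\<close>

abbreviation sgl :: "'x \<Rightarrow> 'k \<Rightarrow> ('x \<Rightarrow>\<^sub>0 'k::zero)" where "sgl \<equiv> Poly_Mapping.single"
abbreviation coef :: "('x \<Rightarrow>\<^sub>0 'k::zero) \<Rightarrow> 'x \<Rightarrow> 'k" where "coef \<equiv> Poly_Mapping.lookup"
abbreviation supp :: "('x \<Rightarrow>\<^sub>0 'k::zero) \<Rightarrow> 'x set" where "supp \<equiv> Poly_Mapping.keys"

abbreviation sc :: "'k::field \<Rightarrow> ('x \<Rightarrow>\<^sub>0 'k) \<Rightarrow> ('x \<Rightarrow>\<^sub>0 'k)" where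
  "sc c \<equiv> Poly_Mapping.map ((*) c)"

lemma lookup_sc [simp]: "coef (sc c f) x = c * coef f x"
  by (simp add: Poly_Mapping.map.rep_eq when_def)

lemma sc_single [simp]: "sc c (sgl x d) = sgl x (c * d)"
  by (rule map_single) simp

interpretation fv: vector_space "sc :: 'k::field \<Rightarrow> ('x \<Rightarrow>\<^sub>0 'k) \<Rightarrow> _"
  by unfold_locales (auto intro!: poly_mapping_eqI simp: lookup_add algebra_simps)

lemma keys_sc: "supp (sc c f) \<subseteq> supp f"
  by (auto simp: in_keys_iff)

lemma keys_plus: "\<lbrakk>supp f \<subseteq> X; supp g \<subseteq> X\<rbrakk> \<Longrightarrow> supp (f + g) \<subseteq> X"
  using Poly_Mapping.keys_add[of f g] by auto

lemma keys_sc_sub: "supp f \<subseteq> X \<Longrightarrow> supp (sc c f) \<subseteq> X"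
  using keys_sc[of c f] by auto

lemma subspace_keys: "fv.subspace {f :: 'x \<Rightarrow>\<^sub>0 'k::field. supp f \<subseteq> X}"
proof (rule fv.subspaceI)
  fix f g :: "'x \<Rightarrow>\<^sub>0 'k" and c :: 'k
  assume f: "f \<in> {f. supp f \<subseteq> X}"
  then show "sc c f \<in> {f. supp f \<subseteq> X}" using keys_sc[of c f] by auto
  assume "g \<in> {f. supp f \<subseteq> X}"
  with f show "f + g \<in> {f. supp f \<subseteq> X}" using Poly_Mapping.keys_add[of f g] by auto
qed simp

lemma pm_expand: "f = (\<Sum>x\<in>supp f. sgl x (coef f x))"
  by (rule poly_mapping_eqI) (auto simp: lookup_sum lookup_single when_def in_keys_iff)

text \<open>The recurrent way to extend a linear statement from generators: the vectors that satisfy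
  it form a subspace, and this subspace contains the generators.\<close>

lemma in_subspace_keys:
  assumes "fv.subspace U" "\<And>x. x \<in> supp f \<Longrightarrow> sgl x 1 \<in> U"
  shows "f \<in> U"
proof -
  have "sgl x (coef f x) \<in> U" if "x \<in> supp f" for x
    using fv.subspace_scale[OF assms(1) assms(2)[OF that], of "coef f x"] by simp
  then show ?thesis
    by (subst pm_expand) (rule fv.subspace_sum[OF assms(1)])
qed

lemma lin_ext_eq:
  assumes "finite S" "supp f \<subseteq> S"
  shows "lin_ext g f = (\<Sum>x\<in>S. sc (coef f x) (g x))"
  unfolding lin_ext_def
  by (rule sum.mono_neutral_left) (use assms in \<open>auto simp: in_keys_iff intro!: poly_mapping_eqI\<close>)

lemma lin_ext_zero [simp]: "lin_ext g 0 = 0"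
  by (simp add: lin_ext_def)

lemma lin_ext_single [simp]: "lin_ext g (sgl x c) = sc c (g x)"
  by (subst lin_ext_eq[of "{x}"]) auto

lemma lin_ext_add: "lin_ext g (f + f') = lin_ext g f + lin_ext g f'"
proof -
  let ?S = "supp f \<union> supp f'"
  have "supp (f + f') \<subseteq> ?S" by (rule Poly_Mapping.keys_add)
  then show ?thesis
    by (subst (1 2 3) lin_ext_eq[of ?S])
      (auto simp: lookup_add fv.scale_left_distrib sum.distrib)
qed

lemma lin_ext_sc: "lin_ext g (sc c f) = sc c (lin_ext g f)"
  by (subst (1 2) lin_ext_eq[of "supp f"]) (auto simp: keys_sc fv.scale_sum_right)

lemma lin_ext_diff: "lin_ext g (f - f') = lin_ext g f - lin_ext g f'"
  by (metis lin_ext_add add_diff_cancel diff_add_cancel)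

lemma lin_ext_sum: "lin_ext g (sum F S) = (\<Sum>s\<in>S. lin_ext g (F s))"
  by (induction S rule: infinite_finite_induct) (auto simp: lin_ext_add)

lemma lin_ext_cong:
  "(\<And>x. x \<in> supp f \<Longrightarrow> g x = h x) \<Longrightarrow> lin_ext g f = lin_ext h f"
  by (simp add: lin_ext_def)

lemma lin_ext_comp: "lin_ext g (lin_ext h f) = lin_ext (\<lambda>x. lin_ext g (h x)) f"
  unfolding lin_ext_def[of h] lin_ext_def[of "\<lambda>x. lin_ext g (h x)"]
  by (simp add: lin_ext_sum lin_ext_sc)

lemma lin_ext_fun_add: "lin_ext (\<lambda>x. g x + h x) f = lin_ext g f + lin_ext h f"
  by (simp add: lin_ext_def fv.scale_right_distrib sum.distrib)

lemma lin_ext_fun_sc: "lin_ext (\<lambda>x. sc c (g x)) f = sc c (lin_ext g f)"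
  by (simp add: lin_ext_def fv.scale_sum_right mult.commute)

lemma lin_ext_fun_zero [simp]: "lin_ext (\<lambda>x. 0) f = 0"
  by (simp add: lin_ext_def)

lemma lin_ext_ident: "lin_ext (\<lambda>x. sgl x 1) f = f"
  by (simp add: lin_ext_def) (rule pm_expand[symmetric])

lemma lin_ext_in:
  assumes "fv.subspace U" "\<And>x. x \<in> supp f \<Longrightarrow> g x \<in> U"
  shows "lin_ext g f \<in> U"
  unfolding lin_ext_def
  by (intro fv.subspace_sum[OF assms(1)] fv.subspace_scale[OF assms(1)] assms(2))

lemma lin_ext_keys:
  assumes "\<And>x. x \<in> supp f \<Longrightarrow> supp (g x) \<subseteq> X"
  shows "supp (lin_ext g f) \<subseteq> X"
  using lin_ext_in[OF subspace_keys, of f g X] assms by simp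

lemma subspace_lin_ext_vimage:
  assumes "fv.subspace U" shows "fv.subspace {f. lin_ext g f \<in> U}"
  using assms by (auto simp: fv.subspace_def lin_ext_add lin_ext_sc)

lemma subspace_lin_ext_image:
  assumes "fv.subspace U" shows "fv.subspace (lin_ext g ` U)"
  using assms unfolding fv.subspace_def
  by (auto simp: image_iff simp flip: lin_ext_add lin_ext_sc) (metis lin_ext_zero)

lemma lin_ext_span_subset:
  assumes "fv.subspace U" "\<And>r. r \<in> R \<Longrightarrow> lin_ext g r \<in> U" "f \<in> fv.span R"
  shows "lin_ext g f \<in> U"
  using fv.span_induct[OF assms(3), of "\<lambda>f. lin_ext g f \<in> U"]
    subspace_lin_ext_vimage[OF assms(1), of g] assms(2)
  by (simp add: Collect_conv_if)

section \<open>Vector spaces as records\<close>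

text \<open>The vector space axioms, existence of negatives included, pass along a surjection that
  respects the operations. The quotients below obtain their structure this way.\<close>

lemma vectorspace_image:
  fixes V :: "('k::field, 'v) module" and W :: "('k, 'w) module"
  assumes V: "vectorspace class_ring V"
    and im: "carrier W = h ` carrier V"
    and add: "\<And>x y. \<lbrakk>x \<in> carrier V; y \<in> carrier V\<rbrakk> \<Longrightarrow> h (x \<oplus>\<^bsub>V\<^esub> y) = h x \<oplus>\<^bsub>W\<^esub> h y"
    and smult: "\<And>c x. x \<in> carrier V \<Longrightarrow> h (c \<odot>\<^bsub>V\<^esub> x) = c \<odot>\<^bsub>W\<^esub> h x"
    and zero: "h \<zero>\<^bsub>V\<^esub> = \<zero>\<^bsub>W\<^esub>"
  shows "vectorspace class_ring W"
proof -
  interpret V: vectorspace class_ring V by fact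
  have "abelian_group W"
  proof (rule abelian_groupI)
    fix x assume "x \<in> carrier W"
    then obtain v where v: "v \<in> carrier V" "x = h v" using im by auto
    show "\<exists>y\<in>carrier W. y \<oplus>\<^bsub>W\<^esub> x = \<zero>\<^bsub>W\<^esub>"
      by (rule bexI[of _ "h (\<ominus>\<^bsub>V\<^esub> v)"])
        (use v in \<open>auto simp: add[symmetric] zero[symmetric] V.M.l_neg im\<close>)
  qed (auto simp: im add[symmetric] zero[symmetric] V.M.a_ac)
  then have "module class_ring W"
    by (intro moduleI)
      (auto simp: im smult[symmetric] add[symmetric] V.smult_l_distr[simplified class_ring_simps]
        V.smult_r_distr[simplified class_ring_simps] V.smult_assoc1[simplified class_ring_simps]
        V.smult_one[simplified class_ring_simps] class_cring.cring_axioms)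
  then show ?thesis
    by (simp add: vectorspace_def class_field)
qed

lemma vectorspace_type_level:
  fixes V :: "('k::field, 'x \<Rightarrow>\<^sub>0 'k) module"
  assumes "fv.subspace (carrier V)" and V: "add V = (+)" "zero V = 0" "smult V = (\<lambda>c. sc c)"
  shows "vectorspace class_ring V"
proof -
  note cl = fv.subspace_0[OF assms(1)] fv.subspace_add[OF assms(1)]
    fv.subspace_scale[OF assms(1)] fv.subspace_neg[OF assms(1)]
  have "abelian_group V"
  proof (rule abelian_groupI)
    fix x assume "x \<in> carrier V"
    then show "\<exists>y\<in>carrier V. y \<oplus>\<^bsub>V\<^esub> x = \<zero>\<^bsub>V\<^esub>"
      unfolding V by (intro bexI[of _ "- x"] cl) auto
  qed (unfold V, rule cl | simp add: cl ac_simps)+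
  then have "module class_ring V"
    unfolding V
    by (intro moduleI class_cring.cring_axioms)
      (unfold V, simp_all add: cl fv.scale_left_distrib fv.scale_right_distrib)
  then show ?thesis
    by (simp add: vectorspace_def class_field)
qed

lemma free_space_simps [simp]:
  "carrier (free_space X) = {f. supp f \<subseteq> X}"
  "add (free_space X) = (+)" "zero (free_space X) = 0" "smult (free_space X) = (\<lambda>c. sc c)"
  by (auto simp: free_space_def)

lemma vectorspace_free_space: "vectorspace class_ring (free_space X)"
  by (rule vectorspace_type_level) (auto simp: subspace_keys)

lemma a_minus_type_level:
  assumes "vectorspace class_ring V" "add V = (+)" "zero V = 0"
    "x \<in> carrier V" "y \<in> carrier V"
  shows "x \<ominus>\<^bsub>V\<^esub> y = x - (y :: 'x \<Rightarrow>\<^sub>0 'k::field)"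
proof -
  interpret V: vectorspace class_ring V by fact
  have "\<ominus>\<^bsub>V\<^esub> y + y = 0" using V.M.l_neg[OF assms(5)] by (simp add: assms)
  then have "\<ominus>\<^bsub>V\<^esub> y = - y" by (metis add_eq_0_iff2)
  then show ?thesis by (simp add: a_minus_def assms)
qed

text \<open>Bridge between two kinds of linear algebra: the definitions speak of spans in records,
  the computations use the vector space of all finitely supported functions on a type. Each span is
  contained in the other as a subspace containing the generators.\<close>

lemma lin_span_type_level:
  fixes V :: "('k::field, 'x \<Rightarrow>\<^sub>0 'k) module"
  assumes V: "fv.subspace (carrier V)" "add V = (+)" "zero V = 0" "smult V = (\<lambda>c. sc c)"
    and S: "S \<subseteq> carrier V"
  shows "lin_span V S = fv.span S"
proof
  interpret V: vectorspace class_ring V by (rule vectorspace_type_level[OF V])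
  have fs: "finsum V f A = sum f A" if "finite A" "f ` A \<subseteq> carrier V" for f and A :: "('x \<Rightarrow>\<^sub>0 'k) set"
    using that
  proof (induction A)
    case (insert v A)
    have "finsum V f (insert v A) = f v \<oplus>\<^bsub>V\<^esub> finsum V f A"
      by (rule V.M.finsum_insert) (use insert in auto)
    with insert show ?case by (simp add: V)
  qed (simp add: V)
  show "lin_span V S \<subseteq> fv.span S"
  proof
    fix x assume "x \<in> lin_span V S"
    then obtain a A where A: "finite A" "A \<subseteq> S" "x = V.lincomb a A"
      by (auto simp: V.span_def)
    have "sc (a v) v \<in> carrier V" if "v \<in> A" for v
      by (rule fv.subspace_scale[OF V(1)]) (use that A(2) S in blast)
    then have "(\<lambda>v. sc (a v) v) ` A \<subseteq> carrier V" by blast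
    then have x: "x = (\<Sum>v\<in>A. sc (a v) v)"
      using fs[OF A(1)] unfolding A(3) V.lincomb_def V(4) by blast
    show "x \<in> fv.span S" unfolding x
      by (rule fv.span_sum, rule fv.span_scale, rule fv.span_base) (use A(2) in blast)
  qed
  have sm: "submodule class_ring (V.span S) V"
    by (rule V.span_is_submodule[OF S])
  have "fv.subspace (V.span S)"
  proof (rule fv.subspaceI)
    show "0 \<in> V.span S" using submodule.zero_closed[OF sm] unfolding V(3) .
    show "x + y \<in> V.span S" if "x \<in> V.span S" "y \<in> V.span S" for x y
      using submodule.m_closed[OF sm that] unfolding V(2) .
    show "sc c x \<in> V.span S" if "x \<in> V.span S" for c x
      using submodule.smult_closed[OF sm _ that, of c] unfolding V(4) by simp
  qed
  then show "fv.span S \<subseteq> lin_span V S"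
    by (rule fv.span_minimal[OF V.in_own_span[OF S]])
qed

section \<open>Quotients\<close>

locale quotient_space = vectorspace class_ring V for V :: "('k::field, 'v) module" +
  fixes U :: "'v set"
  assumes U_sub: "U \<subseteq> carrier V" and U_zero: "\<zero>\<^bsub>V\<^esub> \<in> U"
    and U_add: "\<And>x y. \<lbrakk>x \<in> U; y \<in> U\<rbrakk> \<Longrightarrow> x \<oplus>\<^bsub>V\<^esub> y \<in> U"
    and U_smult: "\<And>c x. x \<in> U \<Longrightarrow> c \<odot>\<^bsub>V\<^esub> x \<in> U"
begin

lemma U_neg: "x \<in> U \<Longrightarrow> \<ominus>\<^bsub>V\<^esub> x \<in> U"
proof -
  assume x: "x \<in> U"
  then have "x \<in> carrier V" using U_sub by auto
  then have "\<ominus>\<^bsub>V\<^esub> x = (- 1) \<odot>\<^bsub>V\<^esub> x"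
    using smult_minus_1[of x] by (simp add: class_ring_simps)
  with U_smult[OF x] show ?thesis by simp
qed

lemma is_abelian_subgroup: "abelian_subgroup U V"
proof (rule abelian_subgroupI3)
  show "additive_subgroup U V"
    by (rule additive_subgroup.intro, rule group.subgroupI)
      (use U_sub U_zero U_add U_neg M.a_group in \<open>auto simp: a_inv_def\<close>)
  show "abelian_group V" by (rule M.abelian_group_axioms)
qed

sublocale US: abelian_subgroup U V by (rule is_abelian_subgroup)

lemma coset_eq_iff:
  assumes "x \<in> carrier V" "y \<in> carrier V"
  shows "U +>\<^bsub>V\<^esub> x = U +>\<^bsub>V\<^esub> y \<longleftrightarrow> x \<ominus>\<^bsub>V\<^esub> y \<in> U"
proof -
  have "x \<ominus>\<^bsub>V\<^esub> y \<in> U \<longleftrightarrow> x \<in> U +>\<^bsub>V\<^esub> y"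
    using US.a_rcos_module[OF assms(2,1)] by (simp add: M.minus_eq)
  also have "\<dots> \<longleftrightarrow> U +>\<^bsub>V\<^esub> x = U +>\<^bsub>V\<^esub> y"
    using M.a_repr_independence[OF _ assms(2) US.a_subgroup] US.a_rcos_self[OF assms(1)] by metis
  finally show ?thesis by simp
qed

lemma coset_zero: "U +>\<^bsub>V\<^esub> \<zero>\<^bsub>V\<^esub> = U"
  by (rule M.a_coset_add_zero) (rule U_sub)

lemma coset_eq_self_iff: "x \<in> carrier V \<Longrightarrow> U +>\<^bsub>V\<^esub> x = U \<longleftrightarrow> x \<in> U"
  using US.a_rcos_const[of x] US.a_rcos_self[of x] by auto

lemma carrier_quot: "carrier (quot_module V U) = (\<lambda>x. U +>\<^bsub>V\<^esub> x) ` carrier V"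
  by (auto simp: quot_module_def ring.defs module.defs FactRing_def A_RCOSETS_def RCOSETS_def
      a_r_coset_def)

lemma zero_quot: "\<zero>\<^bsub>quot_module V U\<^esub> = U"
  by (simp add: quot_module_def ring.defs module.defs FactRing_def)

lemma add_quot:
  assumes "x \<in> carrier V" "y \<in> carrier V"
  shows "(U +>\<^bsub>V\<^esub> x) \<oplus>\<^bsub>quot_module V U\<^esub> (U +>\<^bsub>V\<^esub> y) = U +>\<^bsub>V\<^esub> (x \<oplus>\<^bsub>V\<^esub> y)"
  using US.a_rcos_sum[OF assms] by (simp add: quot_module_def ring.defs module.defs FactRing_def)

text \<open>Operations on quotients are defined as unions over all representatives. Such a union has
  the expected value if its members agree on the coset, because a coset is never empty.\<close>

lemma UN_coset:
  assumes x: "x \<in> carrier V"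
    and f: "\<And>y. \<lbrakk>y \<in> carrier V; y \<ominus>\<^bsub>V\<^esub> x \<in> U\<rbrakk> \<Longrightarrow> f y = f x"
  shows "(\<Union>z\<in>U +>\<^bsub>V\<^esub> x. f z) = f x"
proof -
  have "f z = f x" if "z \<in> U +>\<^bsub>V\<^esub> x" for z
  proof (rule f)
    show z: "z \<in> carrier V" using that US.a_elemrcos_carrier x by blast
    then show "z \<ominus>\<^bsub>V\<^esub> x \<in> U"
      using US.a_rcos_module[OF x z] that by (simp add: M.minus_eq)
  qed
  then have "(\<Union>z\<in>U +>\<^bsub>V\<^esub> x. f z) = (\<Union>z\<in>U +>\<^bsub>V\<^esub> x. f x)"
    by (intro SUP_cong refl)
  with US.a_rcos_self[OF x] show ?thesis by (metis UN_constant empty_iff)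
qed

lemma smult_quot:
  assumes x: "x \<in> carrier V"
  shows "c \<odot>\<^bsub>quot_module V U\<^esub> (U +>\<^bsub>V\<^esub> x) = U +>\<^bsub>V\<^esub> (c \<odot>\<^bsub>V\<^esub> x)"
proof -
  have "(\<Union>z\<in>U +>\<^bsub>V\<^esub> x. U +>\<^bsub>V\<^esub> (c \<odot>\<^bsub>V\<^esub> z)) = U +>\<^bsub>V\<^esub> (c \<odot>\<^bsub>V\<^esub> x)"
  proof (rule UN_coset[OF x])
    fix y assume y: "y \<in> carrier V" "y \<ominus>\<^bsub>V\<^esub> x \<in> U"
    have "c \<odot>\<^bsub>V\<^esub> y \<ominus>\<^bsub>V\<^esub> c \<odot>\<^bsub>V\<^esub> x = c \<odot>\<^bsub>V\<^esub> (y \<ominus>\<^bsub>V\<^esub> x)"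
      using x y smult_r_distr[of c y "\<ominus>\<^bsub>V\<^esub> x"] smult_r_minus[of c x]
      by (simp add: M.minus_eq class_ring_simps)
    then show "U +>\<^bsub>V\<^esub> (c \<odot>\<^bsub>V\<^esub> y) = U +>\<^bsub>V\<^esub> (c \<odot>\<^bsub>V\<^esub> x)"
      using coset_eq_iff[of "c \<odot>\<^bsub>V\<^esub> y" "c \<odot>\<^bsub>V\<^esub> x"] U_smult[OF y(2)] x y
      by (simp add: class_ring_simps)
  qed
  then show ?thesis by (simp add: quot_module_def ring.defs module.defs)
qed

lemma vectorspace_quot: "vectorspace class_ring (quot_module V U)"
  by (rule vectorspace_image[OF vectorspace_axioms carrier_quot])
    (simp_all only: add_quot smult_quot zero_quot coset_zero)

end


text \<open>Both the tensor powers and the chain spaces have this shape. Taking the subspace inside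
  the whole type makes equality of cosets a matter of ordinary subtraction.\<close>

locale free_quot =
  fixes X :: "'x set" and U :: "('x \<Rightarrow>\<^sub>0 'k::field) set"
  assumes U_subspace: "fv.subspace U" and U_keys: "\<And>f. f \<in> U \<Longrightarrow> supp f \<subseteq> X"
begin

sublocale quotient_space "free_space X" U
  unfolding quotient_space_def
  by (rule conjI[OF vectorspace_free_space], unfold_locales)
    (use U_keys fv.subspace_0[OF U_subspace] fv.subspace_add[OF U_subspace]
      fv.subspace_scale[OF U_subspace] in auto)

abbreviation cst :: "('x \<Rightarrow>\<^sub>0 'k) \<Rightarrow> ('x \<Rightarrow>\<^sub>0 'k) set" where
  "cst f \<equiv> U +>\<^bsub>free_space X\<^esub> f"

abbreviation Qm :: "('k, ('x \<Rightarrow>\<^sub>0 'k) set) module" where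
  "Qm \<equiv> quot_module (free_space X) U"

lemma cst_eq:
  assumes "supp f \<subseteq> X" "supp g \<subseteq> X"
  shows "cst f = cst g \<longleftrightarrow> f - g \<in> U"
proof -
  have "f \<ominus>\<^bsub>free_space X\<^esub> g = f - g"
    by (rule a_minus_type_level[OF vectorspace_free_space]) (use assms in auto)
  then show ?thesis using coset_eq_iff[of f g] assms by simp
qed

lemma carrier_Qm: "carrier Qm = cst ` {f. supp f \<subseteq> X}"
  by (simp add: carrier_quot)

lemma cst_in: "supp f \<subseteq> X \<Longrightarrow> cst f \<in> carrier Qm"
  by (auto simp: carrier_Qm)

lemma cst_cases:
  assumes "x \<in> carrier Qm" obtains f where "supp f \<subseteq> X" "x = cst f"
  using assms by (auto simp: carrier_Qm)

lemma cst_add: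
  "\<lbrakk>supp f \<subseteq> X; supp g \<subseteq> X\<rbrakk> \<Longrightarrow> cst f \<oplus>\<^bsub>Qm\<^esub> cst g = cst (f + g)"
  using add_quot[of f g] by simp

lemma cst_smult: "supp f \<subseteq> X \<Longrightarrow> c \<odot>\<^bsub>Qm\<^esub> cst f = cst (sc c f)"
  using smult_quot[of f c] by simp

lemma cst_zero: "\<zero>\<^bsub>Qm\<^esub> = cst 0"
  using coset_zero by (simp add: zero_quot)

lemma cst_eq_zero_iff: "supp f \<subseteq> X \<Longrightarrow> cst f = \<zero>\<^bsub>Qm\<^esub> \<longleftrightarrow> f \<in> U"
  using cst_eq[of f 0] by (simp add: cst_zero)

lemma UN_cst:
  assumes "supp f \<subseteq> X"
    and "\<And>g. \<lbrakk>supp g \<subseteq> X; g - f \<in> U\<rbrakk> \<Longrightarrow> h g = h f"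
  shows "(\<Union>g\<in>cst f. h g) = h f"
proof (rule UN_coset)
  fix g assume "g \<in> carrier (free_space X)" and g: "g \<ominus>\<^bsub>free_space X\<^esub> f \<in> U"
  then have k: "supp g \<subseteq> X" by simp
  have "g \<ominus>\<^bsub>free_space X\<^esub> f = g - f"
    by (rule a_minus_type_level[OF vectorspace_free_space]) (use assms k in auto)
  with g k show "h g = h f" using assms(2) by simp
qed (use assms(1) in simp)

text \<open>Makes a choice of representatives harmless for every map that vanishes on
  \<open>U\<close>.\<close>

lemma some_cst:
  assumes "supp f \<subseteq> X"
  shows "(SOME g. g \<in> cst f) - f \<in> U"
proof -
  have f: "f \<in> cst f" using US.a_rcos_self[of f] assms by simp
  then have s: "(SOME g. g \<in> cst f) \<in> cst f" by (rule someI[of "\<lambda>g. g \<in> cst f"])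
  then show ?thesis by (auto simp: a_r_coset_def r_coset_def)
qed

end

text \<open>Reduces the induced maps of the definitions to maps of free spaces that carry null
  vectors to null vectors.\<close>

lemma quot_map_cst:
  assumes "free_quot X U" "free_quot Y U'" "supp f \<subseteq> X"
    and g: "\<And>x. x \<in> X \<Longrightarrow> supp (g x) \<subseteq> Y"
    and gU: "\<And>u. u \<in> U \<Longrightarrow> lin_ext g u \<in> U'"
  shows "quot_map (free_space Y) U' (lin_ext g) (U +>\<^bsub>free_space X\<^esub> f) =
    U' +>\<^bsub>free_space Y\<^esub> (lin_ext g f)"
proof -
  interpret X: free_quot X U by fact
  interpret Y: free_quot Y U' by fact
  show ?thesis
    unfolding quot_map_def
  proof (rule X.UN_cst[OF assms(3)])
    fix h assume h: "supp h \<subseteq> X" "h - f \<in> U"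
    have k: "supp (lin_ext g h) \<subseteq> Y" "supp (lin_ext g f) \<subseteq> Y"
      using h(1) assms(3) g by (auto intro!: lin_ext_keys)
    then show "Y.cst (lin_ext g h) = Y.cst (lin_ext g f)"
      using Y.cst_eq[OF k] gU[OF h(2)] by (simp add: lin_ext_diff)
  qed
qed

section \<open>The bar resolution\<close>

locale k_algebra = vectorspace class_ring A for A :: "('k::field, 'a) module" (structure) +
  assumes alg_closed: "\<lbrakk>x \<in> carrier A; y \<in> carrier A\<rbrakk> \<Longrightarrow> x \<otimes> y \<in> carrier A"
    and alg_one: "\<one> \<in> carrier A"
    and alg_assoc: "\<lbrakk>x \<in> carrier A; y \<in> carrier A; z \<in> carrier A\<rbrakk> \<Longrightarrow>
      (x \<otimes> y) \<otimes> z = x \<otimes> (y \<otimes> z)"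
    and alg_l_one: "x \<in> carrier A \<Longrightarrow> \<one> \<otimes> x = x"
    and alg_r_one: "x \<in> carrier A \<Longrightarrow> x \<otimes> \<one> = x"
    and alg_l_distr: "\<lbrakk>x \<in> carrier A; y \<in> carrier A; z \<in> carrier A\<rbrakk> \<Longrightarrow>
      (x \<oplus>\<^bsub>A\<^esub> y) \<otimes> z = x \<otimes> z \<oplus>\<^bsub>A\<^esub> y \<otimes> z"
    and alg_r_distr: "\<lbrakk>x \<in> carrier A; y \<in> carrier A; z \<in> carrier A\<rbrakk> \<Longrightarrow>
      z \<otimes> (x \<oplus>\<^bsub>A\<^esub> y) = z \<otimes> x \<oplus>\<^bsub>A\<^esub> z \<otimes> y"
    and alg_smult_l: "\<lbrakk>x \<in> carrier A; y \<in> carrier A\<rbrakk> \<Longrightarrow>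
      (c \<odot> x) \<otimes> y = c \<odot> (x \<otimes> y)"
    and alg_smult_r: "\<lbrakk>x \<in> carrier A; y \<in> carrier A\<rbrakk> \<Longrightarrow>
      x \<otimes> (c \<odot> y) = c \<odot> (x \<otimes> y)"
begin

lemma smult_in: "x \<in> carrier A \<Longrightarrow> c \<odot> x \<in> carrier A"
  by (rule smult_closed) simp_all

lemmas alg_simps = alg_closed alg_one alg_assoc alg_l_one alg_r_one alg_l_distr alg_r_distr
  alg_smult_l alg_smult_r smult_in

section \<open>Tensor powers and multilinear maps out of them\<close>

definition Ls :: "nat \<Rightarrow> 'a list set" where
  "Ls r = {xs. length xs = r \<and> set xs \<subseteq> carrier A}"

definition power_rels :: "nat \<Rightarrow> ('a list \<Rightarrow>\<^sub>0 'k) set" where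
  "power_rels r =
     {sgl (us @ (x \<oplus>\<^bsub>A\<^esub> y) # vs) 1 - sgl (us @ x # vs) 1
        - sgl (us @ y # vs) 1
      | us x y vs. length us + 1 + length vs = r \<and> set us \<union> {x, y} \<union> set vs \<subseteq> carrier A}
   \<union> {sgl (us @ (c \<odot> x) # vs) 1 - sgl (us @ x # vs) c
      | us c x vs. length us + 1 + length vs = r \<and> set us \<union> {x} \<union> set vs \<subseteq> carrier A}"

lemma power_space_eq: "power_space A r = free_space (Ls r)"
  by (simp add: power_space_def Ls_def)

lemma keys_diff3:
  "supp (sgl a c - sgl b d - sgl b' d')
    \<subseteq> {a, b, b'}"
  "supp (sgl a c - sgl b d) \<subseteq> {a, b}"
  by (auto simp: in_keys_iff lookup_minus lookup_single when_def split: if_splits)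

lemma power_rels_sub: "power_rels r \<subseteq> {f. supp f \<subseteq> Ls r}"
proof -
  have "supp (sgl (us @ (x \<oplus>\<^bsub>A\<^esub> y) # vs) (1::'k)
      - sgl (us @ x # vs) 1 - sgl (us @ y # vs) 1) \<subseteq> Ls r"
    if "length us + 1 + length vs = r \<and> set us \<union> {x, y} \<union> set vs \<subseteq> carrier A" for us x y vs
    by (rule subset_trans[OF keys_diff3(1)]) (use that in \<open>auto simp: Ls_def\<close>)
  moreover have "supp (sgl (us @ (c \<odot> x) # vs) (1::'k)
      - sgl (us @ x # vs) c) \<subseteq> Ls r"
    if "length us + 1 + length vs = r \<and> set us \<union> {x} \<union> set vs \<subseteq> carrier A" for us c x vs
    by (rule subset_trans[OF keys_diff3(2)]) (use that in \<open>auto simp: Ls_def smult_in\<close>)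
  ultimately show ?thesis
    unfolding power_rels_def by blast
qed

lemma power_null_eq: "power_null A r = fv.span (power_rels r)"
  unfolding power_null_def power_space_eq power_rels_def[symmetric]
  by (rule lin_span_type_level) (use power_rels_sub in \<open>auto simp: subspace_keys\<close>)

lemma free_quot_power: "free_quot (Ls r) (power_null A r)"
proof
  show "fv.subspace (power_null A r)" by (simp add: power_null_eq)
  show "supp f \<subseteq> Ls r" if "f \<in> power_null A r" for f
    using fv.span_minimal[OF power_rels_sub subspace_keys] that by (auto simp: power_null_eq)
qed

sublocale pw: free_quot "Ls r" "power_null A r" for r by (rule free_quot_power)

text \<open>Universal property of the tensor power. With \<open>U = {0}\<close> it yields maps into
  a free space, with \<open>U\<close> a null space maps into another quotient.\<close>

lemma lin_ext_power_null:
  assumes U: "fv.subspace U"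
    and add: "\<And>us x y vs. \<lbrakk>length us + 1 + length vs = r; set us \<subseteq> carrier A; x \<in> carrier A;
        y \<in> carrier A; set vs \<subseteq> carrier A\<rbrakk> \<Longrightarrow>
        g (us @ (x \<oplus>\<^bsub>A\<^esub> y) # vs) - g (us @ x # vs) - g (us @ y # vs) \<in> U"
    and smult: "\<And>us x c vs. \<lbrakk>length us + 1 + length vs = r; set us \<subseteq> carrier A; x \<in> carrier A;
        set vs \<subseteq> carrier A\<rbrakk> \<Longrightarrow> g (us @ (c \<odot> x) # vs) - sc c (g (us @ x # vs)) \<in> U"
    and f: "f \<in> power_null A r"
  shows "lin_ext g f \<in> U"
proof (rule lin_ext_span_subset[OF U _ f[unfolded power_null_eq]])
  fix u assume "u \<in> power_rels r"
  then show "lin_ext g u \<in> U"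
    unfolding power_rels_def
    by (auto simp: lin_ext_diff add[simplified] smult[simplified])
qed

lemma power_null_add:
  assumes "length us + 1 + length ws = r" "set us \<subseteq> carrier A" "x \<in> carrier A" "y \<in> carrier A"
    "set ws \<subseteq> carrier A"
  shows "sgl (us @ (x \<oplus>\<^bsub>A\<^esub> y) # ws) 1 - sgl (us @ x # ws) 1
    - sgl (us @ y # ws) 1 \<in> power_null A r"
  unfolding power_null_eq by (rule fv.span_base) (use assms in \<open>auto simp: power_rels_def\<close>)

lemma power_null_smult:
  assumes "length us + 1 + length ws = r" "set us \<subseteq> carrier A" "x \<in> carrier A"
    "set ws \<subseteq> carrier A"
  shows "sgl (us @ (c \<odot> x) # ws) 1 - sgl (us @ x # ws) c
    \<in> power_null A r"
  unfolding power_null_eq by (rule fv.span_base) (use assms in \<open>auto simp: power_rels_def\<close>)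

end


lemma lin_ext_fun_sum: "lin_ext (\<lambda>x. \<Sum>i\<in>I. g i x) f = (\<Sum>i\<in>I. lin_ext (g i) f)"
  by (induction I rule: infinite_finite_induct) (auto simp: lin_ext_fun_add)

context k_algebra
begin

text \<open>Maps of tensor powers given on pure tensors by a \<open>slot_linear\<close> operation on lists respect
  multilinearity: a varying entry ends up, after a linear map, in a single entry of the result.\<close>

definition slot_at :: "('a list \<Rightarrow> 'a list) \<Rightarrow> nat \<Rightarrow> 'a list \<Rightarrow> 'a list \<Rightarrow> bool" where
  "slot_at G r' us ws \<longleftrightarrow>
    (\<exists>us' ws' l. (\<forall>x. G (us @ x # ws) = us' @ l x # ws') \<and> length us' + 1 + length ws' = r' \<and>
        set us' \<subseteq> carrier A \<and> set ws' \<subseteq> carrier A \<and> (\<forall>x\<in>carrier A. l x \<in> carrier A) \<and>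
        (\<forall>x\<in>carrier A. \<forall>y\<in>carrier A. l (x \<oplus>\<^bsub>A\<^esub> y) = l x \<oplus>\<^bsub>A\<^esub> l y) \<and>
        (\<forall>c. \<forall>x\<in>carrier A. l (c \<odot> x) = c \<odot> l x))"

definition slot_linear :: "('a list \<Rightarrow> 'a list) \<Rightarrow> nat \<Rightarrow> nat \<Rightarrow> bool" where
  "slot_linear G r r' \<longleftrightarrow>
    (\<forall>us ws. length us + 1 + length ws = r \<and> set us \<subseteq> carrier A \<and> set ws \<subseteq> carrier A \<longrightarrow> slot_at G r' us ws)"

lemma slot_linearI:
  "(\<And>us ws. \<lbrakk>length us + 1 + length ws = r; set us \<subseteq> carrier A; set ws \<subseteq> carrier A\<rbrakk> \<Longrightarrow> slot_at G r' us ws)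
    \<Longrightarrow> slot_linear G r r'"
  unfolding slot_linear_def by blast

lemma slot_linear_Ls:
  assumes "slot_linear G r r'" "xs \<in> Ls r" "0 < r"
  shows "G xs \<in> Ls r'"
proof -
  obtain x ws where xs: "xs = [] @ x # ws" using assms(2,3) by (cases xs) (auto simp: Ls_def)
  then have *: "length [] + 1 + length ws = r" "set [] \<subseteq> carrier A" "set ws \<subseteq> carrier A"
    and x: "x \<in> carrier A"
    using assms(2) by (auto simp: Ls_def)
  then obtain us' ws' l where "\<forall>x. G ([] @ x # ws) = us' @ l x # ws'"
    "length us' + 1 + length ws' = r'" "set us' \<subseteq> carrier A" "set ws' \<subseteq> carrier A"
    "\<forall>x\<in>carrier A. l x \<in> carrier A"
    using assms(1) unfolding slot_linear_def slot_at_def by blast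
  then show ?thesis using x unfolding xs by (auto simp: Ls_def)
qed

text \<open>The coefficient \<open>c\<close> makes room for the signs of the bar
  differential.\<close>

lemma slot_linear_null:
  assumes G: "slot_linear G r r'" and f: "f \<in> power_null A r"
  shows "lin_ext (\<lambda>xs. sgl (G xs) c) f \<in> power_null A r'"
proof (rule lin_ext_power_null[OF pw.U_subspace _ _ f])
  fix us :: "'a list" and x y ws
  assume *: "length us + 1 + length ws = r" "set us \<subseteq> carrier A" "x \<in> carrier A"
    "set ws \<subseteq> carrier A"
  then obtain us' ws' l where l: "\<forall>x. G (us @ x # ws) = us' @ l x # ws'"
    "length us' + 1 + length ws' = r'" "set us' \<subseteq> carrier A" "set ws' \<subseteq> carrier A"
    "\<forall>x\<in>carrier A. l x \<in> carrier A"
    "\<forall>x\<in>carrier A. \<forall>y\<in>carrier A. l (x \<oplus>\<^bsub>A\<^esub> y) = l x \<oplus>\<^bsub>A\<^esub> l y"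
    "\<forall>c. \<forall>x\<in>carrier A. l (c \<odot> x) = c \<odot> l x"
    using G unfolding slot_linear_def slot_at_def by blast
  show "sgl (G (us @ (d \<odot> x) # ws)) c - sc d (sgl (G (us @ x # ws)) c)
      \<in> power_null A r'" for d
    using fv.subspace_scale[OF pw.U_subspace power_null_smult[of us' ws' r' "l x" d], of c] l *
    by (simp add: fv.scale_right_diff_distrib mult.commute)
  assume y: "y \<in> carrier A"
  show "sgl (G (us @ (x \<oplus>\<^bsub>A\<^esub> y) # ws)) c - sgl (G (us @ x # ws)) c
      - sgl (G (us @ y # ws)) c \<in> power_null A r'"
    using fv.subspace_scale[OF pw.U_subspace power_null_add[of us' ws' r' "l x" "l y"], of c] l * y
    by (simp add: fv.scale_right_diff_distrib)
qed

definition lact_list :: "'a \<Rightarrow> 'a list \<Rightarrow> 'a list" where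
  "lact_list a xs = (a \<otimes> hd xs) # tl xs"

definition ract_list :: "'a \<Rightarrow> 'a list \<Rightarrow> 'a list" where
  "ract_list a xs = butlast xs @ [last xs \<otimes> a]"

definition merge :: "nat \<Rightarrow> 'a list \<Rightarrow> 'a list" where
  "merge i xs = take i xs @ (xs ! i \<otimes> xs ! Suc i) # drop (i + 2) xs"

lemma slot_linear_lact: "a \<in> carrier A \<Longrightarrow> slot_linear (lact_list a) r r"
proof (rule slot_linearI)
  fix us ws :: "'a list"
  assume "a \<in> carrier A" "length us + 1 + length ws = r" "set us \<subseteq> carrier A" "set ws \<subseteq> carrier A"
  then show "slot_at (lact_list a) r us ws"
  proof (cases us)
    case Nil
    show ?thesis
      by (unfold slot_at_def, rule exI[of _ "[]"], rule exI[of _ ws], rule exI[of _ "\<lambda>x. a \<otimes> x"])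
        (use Nil \<open>a \<in> carrier A\<close> \<open>length us + 1 + length ws = r\<close> \<open>set ws \<subseteq> carrier A\<close>
          in \<open>simp add: lact_list_def alg_simps\<close>)
  next
    case (Cons u us')
    show ?thesis
      by (unfold slot_at_def, rule exI[of _ "(a \<otimes> u) # us'"], rule exI[of _ ws], rule exI[of _ "\<lambda>x. x"])
        (use Cons \<open>a \<in> carrier A\<close> \<open>length us + 1 + length ws = r\<close> \<open>set ws \<subseteq> carrier A\<close>
          \<open>set us \<subseteq> carrier A\<close> in \<open>simp add: lact_list_def alg_simps\<close>)
  qed
qed

lemma slot_linear_ract: "a \<in> carrier A \<Longrightarrow> slot_linear (ract_list a) r r"
proof (rule slot_linearI)
  fix us ws :: "'a list"
  assume "a \<in> carrier A" "length us + 1 + length ws = r" "set us \<subseteq> carrier A" "set ws \<subseteq> carrier A"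
  then show "slot_at (ract_list a) r us ws"
  proof (cases ws rule: rev_cases)
    case Nil
    show ?thesis
      by (unfold slot_at_def, rule exI[of _ us], rule exI[of _ "[]"], rule exI[of _ "\<lambda>x. x \<otimes> a"])
        (use Nil \<open>a \<in> carrier A\<close> \<open>length us + 1 + length ws = r\<close> \<open>set us \<subseteq> carrier A\<close>
          in \<open>simp add: ract_list_def alg_simps\<close>)
  next
    case (snoc ws' w)
    show ?thesis
      by (unfold slot_at_def, rule exI[of _ us], rule exI[of _ "ws' @ [w \<otimes> a]"], rule exI[of _ "\<lambda>x. x"])
        (use snoc \<open>a \<in> carrier A\<close> \<open>length us + 1 + length ws = r\<close> \<open>set ws \<subseteq> carrier A\<close>
          \<open>set us \<subseteq> carrier A\<close> in \<open>simp add: ract_list_def alg_simps butlast_append\<close>)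
  qed
qed

lemma merge_in:
  assumes "set xs \<subseteq> carrier A" "Suc i < length xs"
  shows "set (merge i xs) \<subseteq> carrier A" "length (merge i xs) + 1 = length xs"
  using assms set_take_subset[of i xs] set_drop_subset[of "i + 2" xs]
    nth_mem[of i xs] nth_mem[of "Suc i" xs]
  by (auto simp: merge_def intro!: alg_closed)

lemma slot_linear_merge: "Suc i < r \<Longrightarrow> slot_linear (merge i) r (r - 1)"
proof (rule slot_linearI)
  fix us ws :: "'a list"
  assume *: "Suc i < r" "length us + 1 + length ws = r" "set us \<subseteq> carrier A" "set ws \<subseteq> carrier A"
  \<comment> \<open>In turn: the merged pair lies to the left of the varying entry, has it as right
    factor, has it as left factor, or lies to the right of it.\<close>
  consider "Suc i < length us" | "Suc i = length us" | "i = length us" | "length us < i" by linarith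
  then show "slot_at (merge i) (r - 1) us ws"
  proof cases
    case 1
    show ?thesis
      by (unfold slot_at_def, rule exI[of _ "merge i us"], rule exI[of _ ws], rule exI[of _ "\<lambda>x. x"])
        (use 1 * merge_in[of us i] in \<open>auto simp: merge_def nth_append\<close>)
  next
    case 2
    then obtain us' u where us: "us = us' @ [u]" "length us' = i" by (cases us rule: rev_cases) auto
    show ?thesis
      by (unfold slot_at_def, rule exI[of _ us'], rule exI[of _ ws], rule exI[of _ "\<lambda>x. u \<otimes> x"])
        (use us * in \<open>auto simp: merge_def nth_append alg_simps\<close>)
  next
    case 3
    then obtain w ws' where ws: "ws = w # ws'" using * by (cases ws) auto
    show ?thesis
      by (unfold slot_at_def, rule exI[of _ us], rule exI[of _ ws'], rule exI[of _ "\<lambda>x. x \<otimes> w"])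
        (use ws * 3 in \<open>auto simp: merge_def nth_append alg_simps\<close>)
  next
    case 4
    then obtain j where j: "i = length us + Suc j" by (metis add_Suc_right less_imp_Suc_add)
    show ?thesis
      by (unfold slot_at_def, rule exI[of _ us], rule exI[of _ "merge j ws"], rule exI[of _ "\<lambda>x. x"])
        (use j * merge_in[of ws j] in \<open>auto simp: merge_def nth_append eval_nat_numeral\<close>)
  qed
qed

definition bar_list :: "nat \<Rightarrow> 'a list \<Rightarrow> ('a list \<Rightarrow>\<^sub>0 'k)" where
  "bar_list n xs = (\<Sum>i\<le>n. sgl (merge i xs) ((- 1) ^ i))"

lemma bar_list_null:
  assumes "f \<in> power_null A (n + 2)"
  shows "lin_ext (bar_list n) f \<in> power_null A (n + 1)"
proof -
  have "lin_ext (bar_list n) f =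
      (\<Sum>i\<le>n. lin_ext (\<lambda>xs. sgl (merge i xs) ((- 1) ^ i)) f)"
    unfolding bar_list_def[abs_def] by (rule lin_ext_fun_sum)
  also have "\<dots> \<in> power_null A (n + 1)"
    using slot_linear_null[OF slot_linear_merge assms]
    by (intro fv.subspace_sum[OF pw.U_subspace]) simp
  finally show ?thesis .
qed

lemma bar_list_keys: "xs \<in> Ls (n + 2) \<Longrightarrow> supp (bar_list n xs) \<subseteq> Ls (n + 1)"
proof -
  assume xs: "xs \<in> Ls (n + 2)"
  have "sgl (merge i xs) ((- 1) ^ i) \<in> {f :: 'a list \<Rightarrow>\<^sub>0 'k. supp f \<subseteq> Ls (n + 1)}"
    if "i \<in> {..n}" for i
    using slot_linear_Ls[OF slot_linear_merge xs, of i] that by simp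
  then have "bar_list n xs \<in> {f. supp f \<subseteq> Ls (n + 1)}"
    unfolding bar_list_def by (rule fv.subspace_sum[OF subspace_keys])
  then show ?thesis by simp
qed

lemma bar_simps:
  "carrier (bar A n) = carrier (pw.Qm (n + 2))" "add (bar A n) = add (pw.Qm (n + 2))"
  "zero (bar A n) = zero (pw.Qm (n + 2))" "smult (bar A n) = smult (pw.Qm (n + 2))"
  by (simp_all add: bar_def power_space_eq module.defs bimodule.defs)

abbreviation bcst :: "nat \<Rightarrow> ('a list \<Rightarrow>\<^sub>0 'k) \<Rightarrow> ('a list \<Rightarrow>\<^sub>0 'k) set" where
  "bcst n \<equiv> pw.cst (n + 2)"

lemma lact_bcst:
  assumes "a \<in> carrier A" "supp f \<subseteq> Ls (n + 2)"
  shows "lact (bar A n) a (bcst n f) = bcst n (lin_ext (\<lambda>xs. sgl (lact_list a xs) 1) f)"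
proof -
  have "lact (bar A n) a (bcst n f) = quot_map (free_space (Ls (n + 2))) (power_null A (n + 2))
      (lin_ext (\<lambda>xs. sgl (lact_list a xs) 1)) (bcst n f)"
    by (simp add: bar_def power_space_eq module.defs bimodule.defs lact_list_def)
  also have "\<dots> = bcst n (lin_ext (\<lambda>xs. sgl (lact_list a xs) 1) f)"
    by (rule quot_map_cst[OF free_quot_power free_quot_power assms(2)])
      (use slot_linear_Ls[OF slot_linear_lact[OF assms(1)]]
        slot_linear_null[OF slot_linear_lact[OF assms(1)]] in auto)
  finally show ?thesis .
qed

lemma ract_bcst:
  assumes "a \<in> carrier A" "supp f \<subseteq> Ls (n + 2)"
  shows "ract (bar A n) (bcst n f) a = bcst n (lin_ext (\<lambda>xs. sgl (ract_list a xs) 1) f)"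
proof -
  have "ract (bar A n) (bcst n f) a = quot_map (free_space (Ls (n + 2))) (power_null A (n + 2))
      (lin_ext (\<lambda>xs. sgl (ract_list a xs) 1)) (bcst n f)"
    by (simp add: bar_def power_space_eq module.defs bimodule.defs ract_list_def)
  also have "\<dots> = bcst n (lin_ext (\<lambda>xs. sgl (ract_list a xs) 1) f)"
    by (rule quot_map_cst[OF free_quot_power free_quot_power assms(2)])
      (use slot_linear_Ls[OF slot_linear_ract[OF assms(1)]]
        slot_linear_null[OF slot_linear_ract[OF assms(1)]] in auto)
  finally show ?thesis .
qed

lemma bar_diff_bcst:
  assumes "supp f \<subseteq> Ls (Suc n + 2)"
  shows "bar_diff A (Suc n) (bcst (Suc n) f) = bcst n (lin_ext (bar_list (Suc n)) f)"
proof -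
  have "bar_diff A (Suc n) (bcst (Suc n) f) = quot_map (free_space (Ls (n + 2))) (power_null A (n + 2))
      (lin_ext (bar_list (Suc n))) (bcst (Suc n) f)"
    by (simp add: bar_diff_def power_space_eq bar_list_def[abs_def] merge_def)
  also have "\<dots> = bcst n (lin_ext (bar_list (Suc n)) f)"
    by (rule quot_map_cst[OF free_quot_power free_quot_power assms])
      (use bar_list_keys[of _ "Suc n"] bar_list_null[of _ "Suc n"] in auto)
  finally show ?thesis .
qed

text \<open>The left action touches the first entry only, so it meets no merge but the one at
  position 0, and there associativity settles the matter.\<close>

lemma bar_list_lact:
  assumes "a \<in> carrier A" "xs \<in> Ls (Suc n + 2)"
  shows "bar_list (Suc n) (lact_list a xs) =
    lin_ext (\<lambda>xs. sgl (lact_list a xs) 1) (bar_list (Suc n) xs)"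
proof -
  obtain x y ys where xs: "xs = x # y # ys" using assms(2)
    by (auto simp: Ls_def length_Suc_conv)
  have "merge i (lact_list a xs) = lact_list a (merge i xs)" for i
    using assms by (cases i) (auto simp: xs Ls_def merge_def lact_list_def alg_simps)
  then show ?thesis by (simp add: bar_list_def lin_ext_sum del: sum.atMost_Suc)
qed

lemma bar_list_ract:
  assumes "a \<in> carrier A" "xs \<in> Ls (Suc n + 2)"
  shows "bar_list (Suc n) (ract_list a xs) =
    lin_ext (\<lambda>xs. sgl (ract_list a xs) 1) (bar_list (Suc n) xs)"
proof -
  obtain ys' y where "xs = ys' @ [y]" "length ys' = n + 2" using assms(2)
    by (cases xs rule: rev_cases) (auto simp: Ls_def)
  moreover obtain ys x where "ys' = ys @ [x]" "length ys = n + 1"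
    using calculation by (cases ys' rule: rev_cases) auto
  ultimately have xs: "xs = ys @ [x, y]" and n: "length ys = n + 1" by auto
  \<comment> \<open>Only the merge at the last position \<open>Suc n\<close> meets the entry
    multiplied by \<open>a\<close>; this is why the list has been taken apart from its end.\<close>
  have "merge i (ract_list a xs) = ract_list a (merge i xs)" if "i \<le> Suc n" for i
  proof (cases "i = Suc n")
    case True
    then show ?thesis
      using assms n by (auto simp: xs Ls_def merge_def ract_list_def nth_append alg_simps butlast_append)
  next
    case False
    with that have "i = n \<or> i < n" by auto
    then show ?thesis
      using assms n
      by (auto simp: xs Ls_def merge_def ract_list_def nth_append butlast_append Suc_diff_le)
  qed
  then show ?thesis by (simp add: bar_list_def lin_ext_sum del: sum.atMost_Suc)
qed


lemma keys_bar_list: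
  "supp f \<subseteq> Ls (Suc n + 2) \<Longrightarrow> supp (lin_ext (bar_list (Suc n)) f) \<subseteq> Ls (n + 2)"
  using bar_list_keys[of _ "Suc n"] by (intro lin_ext_keys) auto

lemma keys_lact_list:
  "\<lbrakk>a \<in> carrier A; supp f \<subseteq> Ls (n + 2)\<rbrakk> \<Longrightarrow>
    supp (lin_ext (\<lambda>xs. sgl (lact_list a xs) (1::'k)) f) \<subseteq> Ls (n + 2)"
  using slot_linear_Ls[OF slot_linear_lact] by (intro lin_ext_keys) auto

lemma keys_ract_list:
  "\<lbrakk>a \<in> carrier A; supp f \<subseteq> Ls (n + 2)\<rbrakk> \<Longrightarrow>
    supp (lin_ext (\<lambda>xs. sgl (ract_list a xs) (1::'k)) f) \<subseteq> Ls (n + 2)"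
  using slot_linear_Ls[OF slot_linear_ract] by (intro lin_ext_keys) auto

lemma bar_cases:
  assumes "X \<in> carrier (bar A n)"
  obtains f where "supp f \<subseteq> Ls (n + 2)" "X = bcst n f"
  using assms pw.cst_cases unfolding bar_simps by metis

lemma bcst_in: "supp f \<subseteq> Ls (n + 2) \<Longrightarrow> bcst n f \<in> carrier (bar A n)"
  unfolding bar_simps by (rule pw.cst_in)

lemma bcst_add:
  "\<lbrakk>supp f \<subseteq> Ls (n + 2); supp g \<subseteq> Ls (n + 2)\<rbrakk> \<Longrightarrow>
    bcst n f \<oplus>\<^bsub>bar A n\<^esub> bcst n g = bcst n (f + g)"
  unfolding bar_simps by (rule pw.cst_add)

lemma bcst_smult:
  "supp f \<subseteq> Ls (n + 2) \<Longrightarrow> c \<odot>\<^bsub>bar A n\<^esub> bcst n f = bcst n (sc c f)"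
  unfolding bar_simps by (rule pw.cst_smult)

lemma bar_ops_in:
  assumes "X \<in> carrier (bar A n)"
  shows "Y \<in> carrier (bar A n) \<Longrightarrow> X \<oplus>\<^bsub>bar A n\<^esub> Y \<in> carrier (bar A n)"
    and "c \<odot>\<^bsub>bar A n\<^esub> X \<in> carrier (bar A n)"
    and "a \<in> carrier A \<Longrightarrow> lact (bar A n) a X \<in> carrier (bar A n)"
    and "a \<in> carrier A \<Longrightarrow> ract (bar A n) X a \<in> carrier (bar A n)"
proof -
  obtain f where f: "supp f \<subseteq> Ls (n + 2)" "X = bcst n f" using bar_cases[OF assms] .
  show "X \<oplus>\<^bsub>bar A n\<^esub> Y \<in> carrier (bar A n)" if Y: "Y \<in> carrier (bar A n)"
  proof -
    obtain g where g: "supp g \<subseteq> Ls (n + 2)" "Y = bcst n g" using bar_cases[OF Y] .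
    show ?thesis unfolding f(2) g(2) bcst_add[OF f(1) g(1)] by (rule bcst_in[OF keys_plus[OF f(1) g(1)]])
  qed
  show "c \<odot>\<^bsub>bar A n\<^esub> X \<in> carrier (bar A n)"
    unfolding f(2) bcst_smult[OF f(1)] by (rule bcst_in[OF keys_sc_sub[OF f(1)]])
  show "lact (bar A n) a X \<in> carrier (bar A n)" if a: "a \<in> carrier A"
    unfolding f(2) lact_bcst[OF a f(1)] by (rule bcst_in[OF keys_lact_list[OF a f(1)]])
  show "ract (bar A n) X a \<in> carrier (bar A n)" if a: "a \<in> carrier A"
    unfolding f(2) ract_bcst[OF a f(1)] by (rule bcst_in[OF keys_ract_list[OF a f(1)]])
qed

lemma bar_diff_hom:
  assumes "X \<in> carrier (bar A (Suc n))"
  shows "bar_diff A (Suc n) X \<in> carrier (bar A n)"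
    and "Y \<in> carrier (bar A (Suc n)) \<Longrightarrow> bar_diff A (Suc n) (X \<oplus>\<^bsub>bar A (Suc n)\<^esub> Y) =
      bar_diff A (Suc n) X \<oplus>\<^bsub>bar A n\<^esub> bar_diff A (Suc n) Y"
    and "bar_diff A (Suc n) (c \<odot>\<^bsub>bar A (Suc n)\<^esub> X) = c \<odot>\<^bsub>bar A n\<^esub> bar_diff A (Suc n) X"
    and "a \<in> carrier A \<Longrightarrow> bar_diff A (Suc n) (lact (bar A (Suc n)) a X) =
      lact (bar A n) a (bar_diff A (Suc n) X)"
    and "a \<in> carrier A \<Longrightarrow> bar_diff A (Suc n) (ract (bar A (Suc n)) X a) =
      ract (bar A n) (bar_diff A (Suc n) X) a"
proof -
  obtain f where f: "supp f \<subseteq> Ls (Suc n + 2)" "X = bcst (Suc n) f"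
    using bar_cases[OF assms] .
  note k = keys_bar_list[OF f(1)]
  show "bar_diff A (Suc n) X \<in> carrier (bar A n)"
    unfolding f(2) bar_diff_bcst[OF f(1)] by (rule bcst_in[OF k])
  show "bar_diff A (Suc n) (X \<oplus>\<^bsub>bar A (Suc n)\<^esub> Y) =
      bar_diff A (Suc n) X \<oplus>\<^bsub>bar A n\<^esub> bar_diff A (Suc n) Y" if Y: "Y \<in> carrier (bar A (Suc n))"
  proof -
    obtain g where g: "supp g \<subseteq> Ls (Suc n + 2)" "Y = bcst (Suc n) g"
      using bar_cases[OF Y] .
    show ?thesis
      unfolding f(2) g(2) bcst_add[OF f(1) g(1)] bar_diff_bcst[OF f(1)] bar_diff_bcst[OF g(1)]
        bar_diff_bcst[OF keys_plus[OF f(1) g(1)]] bcst_add[OF k keys_bar_list[OF g(1)]] lin_ext_add ..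
  qed
  show "bar_diff A (Suc n) (c \<odot>\<^bsub>bar A (Suc n)\<^esub> X) = c \<odot>\<^bsub>bar A n\<^esub> bar_diff A (Suc n) X"
    unfolding f(2) bcst_smult[OF f(1)] bar_diff_bcst[OF f(1)] bar_diff_bcst[OF keys_sc_sub[OF f(1)]]
      bcst_smult[OF k] lin_ext_sc ..
  show "bar_diff A (Suc n) (lact (bar A (Suc n)) a X) = lact (bar A n) a (bar_diff A (Suc n) X)"
    if a: "a \<in> carrier A"
    unfolding f(2) lact_bcst[OF a f(1)] bar_diff_bcst[OF f(1)] bar_diff_bcst[OF keys_lact_list[OF a f(1)]]
      lact_bcst[OF a k] lin_ext_comp
    by (rule arg_cong[where f = "bcst n"], rule lin_ext_cong) (use f(1) bar_list_lact[OF a] in auto)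
  show "bar_diff A (Suc n) (ract (bar A (Suc n)) X a) = ract (bar A n) (bar_diff A (Suc n) X) a"
    if a: "a \<in> carrier A"
    unfolding f(2) ract_bcst[OF a f(1)] bar_diff_bcst[OF f(1)] bar_diff_bcst[OF keys_ract_list[OF a f(1)]]
      ract_bcst[OF a k] lin_ext_comp
    by (rule arg_cong[where f = "bcst n"], rule lin_ext_cong) (use f(1) bar_list_ract[OF a] in auto)
qed

section \<open>The Hochschild chain complex\<close>

abbreviation Fs :: "nat \<Rightarrow> ('a \<times> ('a list \<Rightarrow>\<^sub>0 'k) set) set" where
  "Fs n \<equiv> carrier A \<times> carrier (bar A n)"

abbreviation Nn :: "nat \<Rightarrow> ('a \<times> ('a list \<Rightarrow>\<^sub>0 'k) set \<Rightarrow>\<^sub>0 'k) set" where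
  "Nn n \<equiv> tensor_null A (regular_bimodule A) (bar A n)"

lemma regular_simps:
  "carrier (regular_bimodule A) = carrier A" "add (regular_bimodule A) = add A"
  "smult (regular_bimodule A) = smult A" "lact (regular_bimodule A) = mult A"
  "ract (regular_bimodule A) = mult A"
  by (simp_all add: regular_bimodule_def module.defs bimodule.defs)

lemma tensor_relations_sub:
  "tensor_relations A (regular_bimodule A) (bar A n) \<subseteq> {f. supp f \<subseteq> Fs n}"
proof -
  have 3: "sgl p (c::'k) - sgl q d - sgl r e
      \<in> {f. supp f \<subseteq> Fs n}" if "p \<in> Fs n" "q \<in> Fs n" "r \<in> Fs n" for p q r c d e
    by (intro CollectI, rule subset_trans[OF keys_diff3(1)]) (use that in auto)
  have 2: "sgl p (c::'k) - sgl q d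
      \<in> {f. supp f \<subseteq> Fs n}" if "p \<in> Fs n" "q \<in> Fs n" for p q c d
    by (intro CollectI, rule subset_trans[OF keys_diff3(2)]) (use that in auto)
  show ?thesis
    unfolding tensor_relations_def regular_simps
    by (intro Un_least subsetI; elim CollectE exE conjE; hypsubst)
      (rule 3 2; simp add: alg_simps bar_ops_in)+
qed

lemma Nn_eq: "Nn n = fv.span (tensor_relations A (regular_bimodule A) (bar A n))"
  unfolding tensor_null_def regular_simps
  by (rule lin_span_type_level) (use tensor_relations_sub in \<open>auto simp: subspace_keys\<close>)

lemma free_quot_tensor: "free_quot (Fs n) (Nn n)"
proof
  show "fv.subspace (Nn n)" by (simp add: Nn_eq)
  show "supp f \<subseteq> Fs n" if "f \<in> Nn n" for f
    using fv.span_minimal[OF tensor_relations_sub subspace_keys] that by (auto simp: Nn_eq)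
qed

sublocale tn: free_quot "Fs n" "Nn n" for n by (rule free_quot_tensor)

lemma Nn_rules:
  assumes "a \<in> carrier A" "X \<in> carrier (bar A n)"
  shows "b \<in> carrier A \<Longrightarrow> sgl (a \<oplus>\<^bsub>A\<^esub> b, X) 1 - sgl (a, X) 1
      - sgl (b, X) 1 \<in> Nn n"
    and "Y \<in> carrier (bar A n) \<Longrightarrow> sgl (a, X \<oplus>\<^bsub>bar A n\<^esub> Y) 1
      - sgl (a, X) 1 - sgl (a, Y) 1 \<in> Nn n"
    and "sgl (c \<odot> a, X) 1 - sgl (a, X) c \<in> Nn n"
    and "sgl (a, c \<odot>\<^bsub>bar A n\<^esub> X) 1 - sgl (a, X) c \<in> Nn n"
    and "b \<in> carrier A \<Longrightarrow> sgl (a \<otimes> b, X) 1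
      - sgl (a, lact (bar A n) b X) 1 \<in> Nn n"
    and "b \<in> carrier A \<Longrightarrow> sgl (b \<otimes> a, X) 1
      - sgl (a, ract (bar A n) X b) 1 \<in> Nn n"
  unfolding Nn_eq using assms
  by (intro fv.span_base; unfold tensor_relations_def regular_simps; blast)+

text \<open>Universal property of the tensor product over the enveloping algebra, with one
  hypothesis for each kind of defining relation.\<close>

lemma lin_ext_Nn:
  assumes U: "fv.subspace U" and f: "f \<in> Nn n"
    and "\<And>a b X. \<lbrakk>a \<in> carrier A; b \<in> carrier A; X \<in> carrier (bar A n)\<rbrakk> \<Longrightarrow>
      g (a \<oplus>\<^bsub>A\<^esub> b, X) - g (a, X) - g (b, X) \<in> U"
    and "\<And>a X Y. \<lbrakk>a \<in> carrier A; X \<in> carrier (bar A n); Y \<in> carrier (bar A n)\<rbrakk> \<Longrightarrow>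
      g (a, X \<oplus>\<^bsub>bar A n\<^esub> Y) - g (a, X) - g (a, Y) \<in> U"
    and "\<And>c a X. \<lbrakk>a \<in> carrier A; X \<in> carrier (bar A n)\<rbrakk> \<Longrightarrow> g (c \<odot> a, X) - sc c (g (a, X)) \<in> U"
    and "\<And>c a X. \<lbrakk>a \<in> carrier A; X \<in> carrier (bar A n)\<rbrakk> \<Longrightarrow>
      g (a, c \<odot>\<^bsub>bar A n\<^esub> X) - sc c (g (a, X)) \<in> U"
    and "\<And>a b X. \<lbrakk>a \<in> carrier A; b \<in> carrier A; X \<in> carrier (bar A n)\<rbrakk> \<Longrightarrow>
      g (a \<otimes> b, X) - g (a, lact (bar A n) b X) \<in> U"
    and "\<And>a b X. \<lbrakk>a \<in> carrier A; b \<in> carrier A; X \<in> carrier (bar A n)\<rbrakk> \<Longrightarrow>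
      g (b \<otimes> a, X) - g (a, ract (bar A n) X b) \<in> U"
  shows "lin_ext g f \<in> U"
proof (rule lin_ext_span_subset[OF U _ f[unfolded Nn_eq]])
  fix u assume "u \<in> tensor_relations A (regular_bimodule A) (bar A n)"
  then show "lin_ext g u \<in> U"
    unfolding tensor_relations_def regular_simps
    by (elim UnE CollectE exE conjE; hypsubst) (simp add: lin_ext_diff assms(3-))+
qed

text \<open>The Hochschild differential on representatives. It allows congruences modulo
  \<open>Nn\<close> in place of equations between cosets whose generators are cosets
  themselves.\<close>

definition Dn :: "nat \<Rightarrow> ('a \<times> ('a list \<Rightarrow>\<^sub>0 'k) set \<Rightarrow>\<^sub>0 'k) \<Rightarrow> ('a \<times> ('a list \<Rightarrow>\<^sub>0 'k) set \<Rightarrow>\<^sub>0 'k)" where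
  "Dn n = lin_ext (\<lambda>(a, X). sgl (a, bar_diff A n X) 1)"

lemma Dn_null: "f \<in> Nn (Suc n) \<Longrightarrow> Dn (Suc n) f \<in> Nn n"
  unfolding Dn_def
  by (erule lin_ext_Nn[OF tn.U_subspace])
    (simp_all add: bar_diff_hom Nn_rules)

lemma Dn_keys: "supp f \<subseteq> Fs (Suc n) \<Longrightarrow> supp (Dn (Suc n) f) \<subseteq> Fs n"
  unfolding Dn_def using bar_diff_hom(1) by (intro lin_ext_keys) auto

lemma HH_chain_eq: "HH_chain A n = tn.Qm n"
  by (simp add: HH_chain_def bimodule_tensor_def regular_simps)

lemma HH_diff_cst:
  assumes "supp f \<subseteq> Fs (Suc n)"
  shows "HH_diff A (Suc n) (tn.cst (Suc n) f) = tn.cst n (Dn (Suc n) f)"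
proof -
  have "HH_diff A (Suc n) (tn.cst (Suc n) f) = quot_map (free_space (Fs n)) (Nn n)
      (lin_ext (\<lambda>(a, X). sgl (a, bar_diff A (Suc n) X) 1)) (tn.cst (Suc n) f)"
    by (simp add: HH_diff_def tensor_map_def regular_simps)
  also have "\<dots> = tn.cst n (Dn (Suc n) f)"
    unfolding Dn_def
    by (rule quot_map_cst[OF free_quot_tensor free_quot_tensor assms])
      (use bar_diff_hom(1) Dn_null[of _ n] in \<open>auto simp: Dn_def\<close>)
  finally show ?thesis .
qed

end


text \<open>A small calculus of congruences: Leibniz's rule and the formulas for the differential
  hold only up to \<open>Nn\<close> or boundaries.\<close>

lemma
  fixes U :: "('x \<Rightarrow>\<^sub>0 'k::field) set"
  assumes "fv.subspace U"
  shows mod_trans: "\<lbrakk>a - b \<in> U; b - c \<in> U\<rbrakk> \<Longrightarrow> a - c \<in> U"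
    and mod_sym: "a - b \<in> U \<Longrightarrow> b - a \<in> U"
    and mod_add: "\<lbrakk>a - a' \<in> U; b - b' \<in> U\<rbrakk> \<Longrightarrow> (a + b) - (a' + b') \<in> U"
    and mod_diff: "\<lbrakk>a - a' \<in> U; b - b' \<in> U\<rbrakk> \<Longrightarrow> (a - b) - (a' - b') \<in> U"
    and mod_sc: "a - b \<in> U \<Longrightarrow> sc k a - sc k b \<in> U"
    and mod_refl: "a - a \<in> U"
    and mod_in: "\<lbrakk>a - b \<in> U; b \<in> U\<rbrakk> \<Longrightarrow> a \<in> U"
  using fv.subspace_add[OF assms, of "a - b" "b - c"] fv.subspace_neg[OF assms, of "a - b"]
    fv.subspace_add[OF assms, of "a - a'" "b - b'"] fv.subspace_diff[OF assms, of "a - a'" "b - b'"]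
    fv.subspace_scale[OF assms, of "a - b" k] fv.subspace_0[OF assms]
    fv.subspace_add[OF assms, of "a - b" b]
  by (simp_all add: fv.scale_right_diff_distrib algebra_simps)

context k_algebra
begin

section \<open>Normal form of Hochschild chains in low degrees\<close>

abbreviation pcl :: "nat \<Rightarrow> 'a list \<Rightarrow> ('a list \<Rightarrow>\<^sub>0 'k) set" where
  "pcl n xs \<equiv> bcst n (sgl xs 1)"

lemma single_keys: "x \<in> X \<Longrightarrow> supp (sgl x c) \<subseteq> X"
  by simp

lemma pcl_in: "xs \<in> Ls (n + 2) \<Longrightarrow> pcl n xs \<in> carrier (bar A n)"
  by (rule bcst_in) simp

lemma Nn_add_right:
  assumes "a \<in> carrier A" "supp f \<subseteq> Ls (n + 2)" "supp g \<subseteq> Ls (n + 2)"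
  shows "sgl (a, bcst n (f + g)) 1 - sgl (a, bcst n f) 1
    - sgl (a, bcst n g) 1 \<in> Nn n"
  using Nn_rules(2)[OF assms(1) bcst_in[OF assms(2)] bcst_in[OF assms(3)]]
  unfolding bcst_add[OF assms(2,3)] .

lemma Nn_sc_right:
  assumes "a \<in> carrier A" "supp f \<subseteq> Ls (n + 2)"
  shows "sgl (a, bcst n (sc c f)) 1 - sgl (a, bcst n f) c \<in> Nn n"
  using Nn_rules(4)[OF assms(1) bcst_in[OF assms(2)], of c]
  unfolding bcst_smult[OF assms(2)] .

lemma Nn_lin_right:
  assumes a: "a \<in> carrier A" and f: "supp f \<subseteq> Ls (n + 2)"
  shows "sgl (a, bcst n f) 1 - lin_ext (\<lambda>xs. sgl (a, pcl n xs) 1) f \<in> Nn n"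
proof -
  let ?g = "\<lambda>xs. sgl (a, pcl n xs) (1::'k)"
  let ?S = "{f. supp f \<subseteq> Ls (n + 2) \<and> sgl (a, bcst n f) 1 - lin_ext ?g f \<in> Nn n}"
  have "fv.subspace ?S"
  proof (rule fv.subspaceI)
    show "0 \<in> ?S" using Nn_sc_right[OF a, of 0 n 0] by simp
  next
    fix f h assume f: "f \<in> ?S" and h: "h \<in> ?S"
    have "sgl (a, bcst n (f + h)) 1 - lin_ext ?g (f + h) =
      (sgl (a, bcst n (f + h)) 1 - sgl (a, bcst n f) 1
        - sgl (a, bcst n h) 1)
      + (sgl (a, bcst n f) 1 - lin_ext ?g f)
      + (sgl (a, bcst n h) 1 - lin_ext ?g h)"
      by (simp add: lin_ext_add)
    also have "\<dots> \<in> Nn n"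
      using f h by (intro fv.subspace_add[OF tn.U_subspace] Nn_add_right[OF a]) auto
    finally show "f + h \<in> ?S" using f h keys_plus[of f _ h] by simp
  next
    fix c f assume f: "f \<in> ?S"
    have "sgl (a, bcst n (sc c f)) 1 - lin_ext ?g (sc c f) =
      (sgl (a, bcst n (sc c f)) 1 - sgl (a, bcst n f) c)
      + sc c (sgl (a, bcst n f) 1 - lin_ext ?g f)"
      by (simp add: lin_ext_sc fv.scale_right_diff_distrib)
    also have "\<dots> \<in> Nn n"
      using f by (intro fv.subspace_add[OF tn.U_subspace] fv.subspace_scale[OF tn.U_subspace]
        Nn_sc_right[OF a]) auto
    finally show "sc c f \<in> ?S" using f keys_sc_sub[of f] by simp
  qed
  moreover have "sgl xs 1 \<in> ?S" if "xs \<in> supp f" for xs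
    using that f fv.subspace_0[OF tn.U_subspace[of n]] by auto
  ultimately have "f \<in> ?S" by (rule in_subspace_keys)
  then show ?thesis by simp
qed

lemma in_subspace_pure:
  assumes U: "fv.subspace U" "Nn n \<subseteq> U" and f: "supp f \<subseteq> Fs n"
    and pure: "\<And>a xs. \<lbrakk>a \<in> carrier A; xs \<in> Ls (n + 2)\<rbrakk> \<Longrightarrow> sgl (a, pcl n xs) 1 \<in> U"
  shows "f \<in> U"
proof (rule in_subspace_keys[OF U(1)])
  fix x assume "x \<in> supp f"
  then obtain a X where x: "x = (a, X)" "a \<in> carrier A" "X \<in> carrier (bar A n)" using f by auto
  then obtain h where h: "supp h \<subseteq> Ls (n + 2)" "X = bcst n h" using bar_cases by blast
  have "sgl (a, X) 1 - lin_ext (\<lambda>xs. sgl (a, pcl n xs) 1) h \<in> U"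
    using Nn_lin_right[OF x(2) h(1)] U(2) h(2) by auto
  moreover have "lin_ext (\<lambda>xs. sgl (a, pcl n xs) 1) h \<in> U"
    by (rule lin_ext_in[OF U(1)]) (use h(1) pure x(2) in auto)
  ultimately show "sgl x 1 \<in> U"
    using fv.subspace_add[OF U(1)] x(1) by fastforce
qed

text \<open>The bimodule relations carry the outer factors of the bar resolution round to the
  coefficient, \<open>x\<close> to its right and \<open>z\<close> to its left. This is the usual
  identification of the n-chains with the tensor product of n + 1 copies of the algebra.\<close>

lemma pure_normalize:
  assumes "a \<in> carrier A" "x \<in> carrier A" "z \<in> carrier A" "set ys \<subseteq> carrier A" "length ys = n"
  shows "sgl (a, pcl n (x # ys @ [z])) 1
    - sgl ((z \<otimes> a) \<otimes> x, pcl n (\<one> # ys @ [\<one>])) 1 \<in> Nn n"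
proof -
  have L: "\<one> # ys @ [z] \<in> Ls (n + 2)" "\<one> # ys @ [\<one>] \<in> Ls (n + 2)"
    using assms alg_one by (auto simp: Ls_def)
  have 1: "lact (bar A n) x (pcl n (\<one> # ys @ [z])) = pcl n (x # ys @ [z])"
    by (subst lact_bcst) (use assms L in \<open>auto simp: lact_list_def alg_simps\<close>)
  have 2: "ract (bar A n) (pcl n (\<one> # ys @ [\<one>])) z = pcl n (\<one> # ys @ [z])"
    by (subst ract_bcst) (use assms L in \<open>auto simp: ract_list_def alg_simps butlast_append\<close>)
  have "sgl (a \<otimes> x, pcl n (\<one> # ys @ [z])) 1
      - sgl (a, pcl n (x # ys @ [z])) 1 \<in> Nn n"
    using Nn_rules(5)[OF assms(1) pcl_in[OF L(1)] assms(2)] unfolding 1 .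
  moreover have "sgl (z \<otimes> (a \<otimes> x), pcl n (\<one> # ys @ [\<one>])) 1
      - sgl (a \<otimes> x, pcl n (\<one> # ys @ [z])) 1 \<in> Nn n"
    using Nn_rules(6)[OF alg_closed[OF assms(1,2)] pcl_in[OF L(2)] assms(3)] unfolding 2 .
  ultimately show ?thesis
    using fv.subspace_neg[OF tn.U_subspace fv.subspace_add[OF tn.U_subspace]] assms
    by (fastforce simp: alg_simps)
qed

text \<open>The standard Hochschild chain with coefficient \<open>a\<close>. In degree one,
  \<open>tau 1 a [x]\<close> is the tensor written a dx in the overview.\<close>

definition tau :: "nat \<Rightarrow> 'a \<Rightarrow> 'a list \<Rightarrow> ('a \<times> ('a list \<Rightarrow>\<^sub>0 'k) set \<Rightarrow>\<^sub>0 'k)" where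
  "tau n a ys = sgl (a, pcl n (\<one> # ys @ [\<one>])) 1"

lemma unital_Ls: "\<lbrakk>set ys \<subseteq> carrier A; length ys = n\<rbrakk> \<Longrightarrow> \<one> # ys @ [\<one>] \<in> Ls (n + 2)"
  by (auto simp: Ls_def alg_one)

lemmas unital_in = pcl_in[OF unital_Ls]

lemma tau_keys:
  "\<lbrakk>a \<in> carrier A; set ys \<subseteq> carrier A; length ys = n\<rbrakk> \<Longrightarrow> supp (tau n a ys) \<subseteq> Fs n"
  unfolding tau_def using pcl_in[OF unital_Ls] by (intro single_keys) blast

lemma in_subspace_tau:
  assumes U: "fv.subspace U" "Nn n \<subseteq> U" and f: "supp f \<subseteq> Fs n"
    and t: "\<And>a ys. \<lbrakk>a \<in> carrier A; set ys \<subseteq> carrier A; length ys = n\<rbrakk> \<Longrightarrow> tau n a ys \<in> U"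
  shows "f \<in> U"
proof (rule in_subspace_pure[OF U f])
  fix a xs assume a: "a \<in> carrier A" and xs: "xs \<in> Ls (n + 2)"
  then obtain x xs' where 1: "xs = x # xs'" "length xs' = n + 1" by (cases xs) (auto simp: Ls_def)
  then obtain ys z where 2: "xs' = ys @ [z]" by (cases xs' rule: rev_cases) auto
  have *: "x \<in> carrier A" "z \<in> carrier A" "set ys \<subseteq> carrier A" "length ys = n"
    using xs 1 2 by (auto simp: Ls_def)
  have "sgl (a, pcl n xs) 1 - tau n (z \<otimes> a \<otimes> x) ys \<in> U"
    using pure_normalize[OF a *] U(2) unfolding tau_def 1 2 by auto
  moreover have "tau n (z \<otimes> a \<otimes> x) ys \<in> U" by (rule t) (use a * alg_simps in auto)
  ultimately show "sgl (a, pcl n xs) 1 \<in> U"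
    using fv.subspace_add[OF U(1)] by fastforce
qed

lemma tau_add_left:
  "\<lbrakk>a \<in> carrier A; b \<in> carrier A; set ys \<subseteq> carrier A; length ys = n\<rbrakk> \<Longrightarrow>
    tau n (a \<oplus>\<^bsub>A\<^esub> b) ys - tau n a ys - tau n b ys \<in> Nn n"
  unfolding tau_def by (rule Nn_rules(1)) (assumption | rule unital_in)+

lemma tau_smult_left:
  "\<lbrakk>a \<in> carrier A; set ys \<subseteq> carrier A; length ys = n\<rbrakk> \<Longrightarrow>
    tau n (c \<odot> a) ys - sc c (tau n a ys) \<in> Nn n"
  unfolding tau_def sc_single mult_1_right by (rule Nn_rules(3)) (assumption | rule unital_in)+

lemma tau_add_right:
  assumes "a \<in> carrier A" "x \<in> carrier A" "y \<in> carrier A"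
  shows "tau 1 a [x \<oplus>\<^bsub>A\<^esub> y] - tau 1 a [x] - tau 1 a [y] \<in> Nn 1"
proof -
  have "sgl ([\<one>] @ (x \<oplus>\<^bsub>A\<^esub> y) # [\<one>]) 1
      - sgl ([\<one>] @ x # [\<one>]) 1
      - sgl ([\<one>] @ y # [\<one>]) 1 \<in> power_null A (1 + 2)"
    by (rule power_null_add) (use assms alg_one in auto)
  moreover have L: "supp (sgl [\<one>, z, \<one>] (1::'k)) \<subseteq> Ls (1 + 2)"
    if "z \<in> carrier A" for z
    using unital_Ls[of "[z]" 1] that by simp
  moreover note xy = L[OF assms(2)] L[OF assms(3)]
  moreover have "x \<oplus>\<^bsub>A\<^esub> y \<in> carrier A" using assms by simp
  ultimately have "pcl 1 [\<one>, x \<oplus>\<^bsub>A\<^esub> y, \<one>] =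
      bcst 1 (sgl [\<one>, x, \<one>] 1 + sgl [\<one>, y, \<one>] 1)"
    by (subst pw.cst_eq[OF L keys_plus[OF xy]]) (simp_all add: diff_diff_eq)
  then show ?thesis
    unfolding tau_def using Nn_add_right[OF assms(1) xy] by simp
qed

lemma tau_smult_right:
  assumes "a \<in> carrier A" "x \<in> carrier A"
  shows "tau 1 a [c \<odot> x] - sc c (tau 1 a [x]) \<in> Nn 1"
proof -
  have "sgl ([\<one>] @ (c \<odot> x) # [\<one>]) 1
      - sgl ([\<one>] @ x # [\<one>]) c \<in> power_null A (1 + 2)"
    by (rule power_null_smult) (use assms alg_one in auto)
  moreover have L: "supp (sgl [\<one>, z, \<one>] (1::'k)) \<subseteq> Ls (1 + 2)"
    if "z \<in> carrier A" for z
    using unital_Ls[of "[z]" 1] that by simp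
  ultimately have "pcl 1 [\<one>, c \<odot> x, \<one>] = bcst 1 (sc c (sgl [\<one>, x, \<one>] 1))"
    by (subst pw.cst_eq[OF L[OF smult_in[OF assms(2)]] keys_sc_sub[OF L[OF assms(2)]]]) simp_all
  then show ?thesis
    unfolding tau_def using Nn_sc_right[OF assms(1) L[OF assms(2)], of c] by simp
qed

lemma bar_list_1: "bar_list 1 [x, y, z] =
  sgl [x \<otimes> y, z] 1 - sgl [x, y \<otimes> z] 1"
  by (simp add: bar_list_def merge_def single_uminus)

lemma bar_list_2: "bar_list 2 [w, x, y, z] =
  sgl [w \<otimes> x, y, z] 1 - sgl [w, x \<otimes> y, z] 1
    + sgl [w, x, y \<otimes> z] 1"
  by (simp add: bar_list_def merge_def single_uminus eval_nat_numeral)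

lemma Dn_single:
  assumes "supp f \<subseteq> Ls (Suc n + 2)"
  shows "Dn (Suc n) (sgl (a, bcst (Suc n) f) 1) =
    sgl (a, bcst n (lin_ext (bar_list (Suc n)) f)) 1"
  unfolding Dn_def using bar_diff_bcst[OF assms] by simp

text \<open>The two merges of 1, x, 1 leave x in an outer position, on the left or on the right, and
  normalization moves it to the corresponding side of the coefficient.\<close>

lemma Dn_tau_1:
  assumes "a \<in> carrier A" "x \<in> carrier A"
  shows "Dn 1 (tau 1 a [x]) - (tau 0 (a \<otimes> x) [] - tau 0 (x \<otimes> a) []) \<in> Nn 0"
proof -
  let ?s = "\<lambda>xs. sgl xs (1::'k)"
  have L: "[x, \<one>] \<in> Ls (0 + 2)" "[\<one>, x] \<in> Ls (0 + 2)" "[\<one>, x, \<one>] \<in> Ls (Suc 0 + 2)"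
    using assms alg_one by (auto simp: Ls_def)
  have D: "Dn 1 (tau 1 a [x]) = ?s (a, bcst 0 (?s [x, \<one>] - ?s [\<one>, x]))"
    using Dn_single[OF single_keys[OF L(3), of 1], of a] assms alg_one
    by (simp add: tau_def bar_list_1[simplified] alg_simps)
  have k: "supp (?s [x, \<one>] - ?s [\<one>, x]) \<subseteq> Ls (0 + 2)"
    by (rule subset_trans[OF keys_diff3(2)]) (use L in auto)
  have "?s (a, bcst 0 (?s [x, \<one>] - ?s [\<one>, x])) - (?s (a, pcl 0 [x, \<one>]) - ?s (a, pcl 0 [\<one>, x])) \<in> Nn 0"
    using Nn_lin_right[OF assms(1) k] by (simp add: lin_ext_diff)
  moreover have "?s (a, pcl 0 [x, \<one>]) - tau 0 (a \<otimes> x) [] \<in> Nn 0"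
    using pure_normalize[of a x "\<one>" "[]" 0] assms alg_one by (simp add: tau_def alg_simps)
  moreover have "?s (a, pcl 0 [\<one>, x]) - tau 0 (x \<otimes> a) [] \<in> Nn 0"
    using pure_normalize[of a "\<one>" x "[]" 0] assms alg_one by (simp add: tau_def alg_simps)
  ultimately show ?thesis
    unfolding D by (rule mod_trans[OF tn.U_subspace _ mod_diff[OF tn.U_subspace]])
qed

text \<open>Source of Leibniz's rule. The outer merges put x and y in outer positions, from where
  they are absorbed by the coefficient; the inner merge produces the product xy.\<close>

lemma Dn_tau_2:
  assumes "a \<in> carrier A" "x \<in> carrier A" "y \<in> carrier A"
  shows "Dn 2 (tau 2 a [x, y])
    - (tau 1 (a \<otimes> x) [y] - tau 1 a [x \<otimes> y] + tau 1 (y \<otimes> a) [x]) \<in> Nn 1"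
proof -
  let ?s = "\<lambda>xs. sgl xs (1::'k)"
  let ?e = "\<one>"
  have L: "[x, y, ?e] \<in> Ls (1 + 2)" "[?e, x \<otimes> y, ?e] \<in> Ls (1 + 2)" "[?e, x, y] \<in> Ls (1 + 2)"
    "[?e, x, y, ?e] \<in> Ls (Suc 1 + 2)"
    using assms alg_one by (auto simp: Ls_def alg_simps)
  let ?f = "?s [x, y, ?e] - ?s [?e, x \<otimes> y, ?e] + ?s [?e, x, y]"
  have D: "Dn 2 (tau 2 a [x, y]) = ?s (a, bcst 1 ?f)"
    using Dn_single[OF single_keys[OF L(4), of 1], of a] assms alg_one
    by (simp add: tau_def bar_list_2[unfolded numeral_2_eq_2] alg_simps numeral_2_eq_2)
  have k: "supp ?f \<subseteq> Ls (1 + 2)"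
    by (rule keys_plus[OF subset_trans[OF keys_diff3(2)]]) (use L in auto)
  have "?s (a, bcst 1 ?f) - (?s (a, pcl 1 [x, y, ?e]) - ?s (a, pcl 1 [?e, x \<otimes> y, ?e]) + ?s (a, pcl 1 [?e, x, y])) \<in> Nn 1"
    using Nn_lin_right[OF assms(1) k] by (simp add: lin_ext_diff lin_ext_add)
  moreover have "?s (a, pcl 1 [x, y, ?e]) - tau 1 (a \<otimes> x) [y] \<in> Nn 1"
    using pure_normalize[of a x ?e "[y]" 1] assms alg_one by (simp add: tau_def alg_simps)
  moreover have "?s (a, pcl 1 [?e, x \<otimes> y, ?e]) - tau 1 a [x \<otimes> y] \<in> Nn 1"
    using fv.subspace_0[OF tn.U_subspace[of 1]] by (simp add: tau_def)
  moreover have "?s (a, pcl 1 [?e, x, y]) - tau 1 (y \<otimes> a) [x] \<in> Nn 1"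
    using pure_normalize[of a ?e y "[x]" 1] assms alg_one by (simp add: tau_def alg_simps)
  ultimately show ?thesis
    unfolding D
    by (rule mod_trans[OF tn.U_subspace _ mod_add[OF tn.U_subspace mod_diff[OF tn.U_subspace]]])
qed

text \<open>On a pure tensor the six terms of the iterated differential cancel in pairs by
  associativity.\<close>

lemma Dn_Dn: 
  assumes "supp f \<subseteq> Fs 2" shows "Dn 1 (Dn 2 f) \<in> Nn 0"
proof -
  let ?U = "{f. Dn 1 (Dn 2 f) \<in> Nn 0}"
  have "f \<in> ?U"
  proof (rule in_subspace_pure[OF _ _ assms])
    show "fv.subspace ?U"
      using subspace_lin_ext_vimage[OF subspace_lin_ext_vimage[OF tn.U_subspace[of 0]]]
      unfolding Dn_def by simp
    show "Nn 2 \<subseteq> ?U" using Dn_null[of _ 1] Dn_null[of _ 0] by (auto simp: numeral_2_eq_2)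
    fix a xs assume a: "a \<in> carrier A" and xs: "xs \<in> Ls (2 + 2)"
    then obtain w x y z where x: "xs = [w, x, y, z]"
      by (auto simp: Ls_def eval_nat_numeral length_Suc_conv)
    have k: "supp (bar_list 2 xs) \<subseteq> Ls (Suc 0 + 2)"
      using bar_list_keys[of xs 2] xs by (simp add: eval_nat_numeral)
    have 0: "lin_ext (bar_list 1) (bar_list 2 xs) = 0"
      using xs by (simp add: x bar_list_2 lin_ext_add lin_ext_diff bar_list_1[simplified] Ls_def alg_simps)
    have 2: "Dn 2 (sgl (a, pcl 2 xs) 1) = sgl (a, bcst 1 (bar_list 2 xs)) 1"
      using Dn_single[of "sgl xs 1" 1 a] xs by (simp add: numeral_2_eq_2)
    have "Dn 1 (sgl (a, bcst 1 (bar_list 2 xs)) 1) = sgl (a, bcst 0 0) 1"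
      using Dn_single[OF k, of a] 0 by simp
    \<comment> \<open>The generator that pairs \<open>a\<close> with the zero coset is not zero in
      the free space, only null.\<close>
    also have "\<dots> \<in> Nn 0" using Nn_sc_right[OF a, of 0 0 0] by simp
    finally show "sgl (a, pcl 2 xs) 1 \<in> ?U" using 2 by simp
  qed
  then show ?thesis by simp
qed

end


text \<open>The map h is a linear isomorphism from the free space on M, so the images of the
  generators form a basis. Injectivity is required in the form of a trivial kernel.\<close>

lemma fin_dim_image:
  fixes W :: "('k::field, 'w) module" and h :: "('x \<Rightarrow>\<^sub>0 'k) \<Rightarrow> 'w"
  assumes M: "finite M"
    and im: "carrier W = h ` {f. supp f \<subseteq> M}"
    and add: "\<And>f g. \<lbrakk>supp f \<subseteq> M; supp g \<subseteq> M\<rbrakk> \<Longrightarrow> h (f + g) = h f \<oplus>\<^bsub>W\<^esub> h g"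
    and smult: "\<And>c f. supp f \<subseteq> M \<Longrightarrow> h (sc c f) = c \<odot>\<^bsub>W\<^esub> h f"
    and zero: "h 0 = \<zero>\<^bsub>W\<^esub>"
    and inj: "\<And>f. \<lbrakk>supp f \<subseteq> M; h f = \<zero>\<^bsub>W\<^esub>\<rbrakk> \<Longrightarrow> f = 0"
  shows "vectorspace.fin_dim class_ring W \<and> vectorspace.dim class_ring W = card M"
proof -
  have "vectorspace class_ring W"
    by (rule vectorspace_image[OF vectorspace_free_space[of M], where h = h]) (use im add smult zero in auto)
  then interpret W: vectorspace class_ring W .
  define b where "b m = h (sgl m 1)" for m
  have b_in: "b m \<in> carrier W" if "m \<in> M" for m using that im by (auto simp: b_def)
  have b_inj: "inj_on b M"
  proof (rule inj_onI)
    fix m n assume mn: "m \<in> M" "n \<in> M" "b m = b n"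
    let ?s = "\<lambda>m. sgl m (1::'k)"
    have k: "supp (sc (- 1) (?s n)) \<subseteq> M" using mn by simp
    have "h (?s m + sc (- 1) (?s n)) = h (?s n + sc (- 1) (?s n))"
      using mn k add[of "?s m" "sc (- 1) (?s n)"] add[of "?s n" "sc (- 1) (?s n)"] by (simp add: b_def)
    also have "?s n + sc (- 1) (?s n) = 0" by (simp flip: single_add)
    finally have "h (?s m + sc (- 1) (?s n)) = \<zero>\<^bsub>W\<^esub>" by (simp add: zero)
    moreover have "supp (?s m + sc (- 1) (?s n)) \<subseteq> M"
      using Poly_Mapping.keys_add[of "?s m" "sc (- 1) (?s n)"] mn by auto
    ultimately have "?s m + sc (- 1) (?s n) = 0" by (rule inj[rotated])
    then have "coef (?s m + sc (- 1) (?s n)) m = 0" by simp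
    then show "m = n" by (auto simp: lookup_add lookup_single when_def split: if_splits)
  qed
  have S: "b ` M \<subseteq> carrier W" using b_in by auto
  have h_sum: "h (\<Sum>m\<in>T. sgl m (a m)) = (\<Oplus>\<^bsub>W\<^esub>m\<in>T. a m \<odot>\<^bsub>W\<^esub> b m)"
    if "T \<subseteq> M" for T a
    using finite_subset[OF that M] that
  proof (induction T rule: finite_induct)
    case (insert m T)
    have "sgl m (a m) \<in> {f. supp f \<subseteq> M}" if "m \<in> M" for m :: 'x
      using that by simp
    moreover from this have "(\<Sum>m\<in>T. sgl m (a m)) \<in> {f. supp f \<subseteq> M}"
      by (intro fv.subspace_sum[OF subspace_keys]) (use insert.prems in blast)
    moreover have "h (sgl m (a m)) = a m \<odot>\<^bsub>W\<^esub> b m"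
      using smult[of "sgl m 1" "a m"] insert.prems by (simp add: b_def)
    ultimately have "h (\<Sum>m\<in>insert m T. sgl m (a m)) =
        a m \<odot>\<^bsub>W\<^esub> b m \<oplus>\<^bsub>W\<^esub> (\<Oplus>\<^bsub>W\<^esub>m\<in>T. a m \<odot>\<^bsub>W\<^esub> b m)"
      using insert add by simp
    also have "\<dots> = (\<Oplus>\<^bsub>W\<^esub>m\<in>insert m T. a m \<odot>\<^bsub>W\<^esub> b m)"
      by (rule W.M.finsum_insert[symmetric])
        (use insert b_in in \<open>auto intro!: W.smult_closed\<close>)
    finally show ?case .
  qed (simp add: zero)
  have ind: "W.lin_indpt (b ` M)"
  proof (rule W.finite_lin_indpt2)
    show "finite (b ` M)" using M by simp
    show "b ` M \<subseteq> carrier W" by (rule S)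
    fix a assume a: "W.lincomb a (b ` M) = \<zero>\<^bsub>W\<^esub>"
    have "W.lincomb a (b ` M) = (\<Oplus>\<^bsub>W\<^esub>m\<in>M. a (b m) \<odot>\<^bsub>W\<^esub> b m)"
      unfolding W.lincomb_def
      by (rule W.M.finsum_reindex) (use b_in b_inj in \<open>auto intro!: W.smult_closed\<close>)
    also have "\<dots> = h (\<Sum>m\<in>M. sgl m (a (b m)))" by (simp add: h_sum)
    finally have "h (\<Sum>m\<in>M. sgl m (a (b m))) = \<zero>\<^bsub>W\<^esub>" using a by simp
    moreover have "(\<Sum>m\<in>M. sgl m (a (b m))) \<in> {f. supp f \<subseteq> M}"
      by (rule fv.subspace_sum[OF subspace_keys]) simp
    ultimately have 0: "(\<Sum>m\<in>M. sgl m (a (b m))) = 0" using inj by simp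
    have "a (b m) = 0" if "m \<in> M" for m
    proof -
      have "coef (\<Sum>m\<in>M. sgl m (a (b m))) m = a (b m)"
        using that M by (simp add: lookup_sum lookup_single when_def)
      then show ?thesis using 0 by simp
    qed
    then show "\<forall>v\<in>b ` M. a v = \<zero>\<^bsub>class_ring\<^esub>" by auto
  qed
  have "carrier W \<subseteq> W.span (b ` M)"
  proof
    fix w assume "w \<in> carrier W"
    then obtain f where f: "supp f \<subseteq> M" "w = h f" using im by auto
    have "f = (\<Sum>m\<in>M. sgl m (coef f m))"
      using M f(1) by (subst pm_expand) (auto intro!: sum.mono_neutral_left simp: in_keys_iff)
    then have "w = (\<Oplus>\<^bsub>W\<^esub>m\<in>M. coef f m \<odot>\<^bsub>W\<^esub> b m)"
      using h_sum[of M "coef f"] f(2) by simp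
    \<comment> \<open>Linear combinations are indexed by vectors, so the coefficients have to be
      transported along the inverse of \<open>b\<close>.\<close>
    also have "\<dots> = W.lincomb (\<lambda>v. coef f (the_inv_into M b v)) (b ` M)"
      unfolding W.lincomb_def
      by (subst W.M.finsum_reindex)
        (use b_in b_inj in \<open>auto intro!: W.smult_closed W.M.finsum_cong' simp: the_inv_into_f_f\<close>)
    finally show "w \<in> W.span (b ` M)"
      unfolding W.span_def using M by (auto intro!: exI[of _ "b ` M"])
  qed
  then have gen: "W.gen_set (b ` M)"
    using W.span_is_subset2[OF S] by auto
  have "W.basis (b ` M)" unfolding W.basis_def using ind gen S by simp
  then have "W.dim = card (b ` M)" by (rule W.dim_basis[rotated]) (use M in simp)
  then show ?thesis
    using gen S M unfolding W.fin_dim_def by (auto simp: card_image[OF b_inj])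
qed

context k_algebra
begin

section \<open>Linear maps out of the chains of degree zero and one\<close>

definition ev :: "('a \<Rightarrow> 'a list \<Rightarrow> ('w \<Rightarrow>\<^sub>0 'k)) \<Rightarrow> 'a \<times> ('a list \<Rightarrow>\<^sub>0 'k) set \<Rightarrow> ('w \<Rightarrow>\<^sub>0 'k)" where
  "ev G = (\<lambda>(a, X). lin_ext (G a) (SOME f. f \<in> X))"

text \<open>The choice inside \<open>ev\<close> does not matter: two representatives of a coset
  differ by a null vector, which is killed by assumption.\<close>

lemma ev_bcst:
  assumes G: "\<And>u. u \<in> power_null A (n + 2) \<Longrightarrow> lin_ext (G a) u = 0"
    and f: "supp f \<subseteq> Ls (n + 2)"
  shows "ev G (a, bcst n f) = lin_ext (G a) f"
  using G[OF pw.some_cst[OF f]] by (simp add: ev_def lin_ext_diff)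

lemma ev_null:
  assumes null: "\<And>a u. \<lbrakk>a \<in> carrier A; u \<in> power_null A (n + 2)\<rbrakk> \<Longrightarrow> lin_ext (G a) u = 0"
    and add: "\<And>a b xs. \<lbrakk>a \<in> carrier A; b \<in> carrier A; xs \<in> Ls (n + 2)\<rbrakk> \<Longrightarrow> G (a \<oplus>\<^bsub>A\<^esub> b) xs = G a xs + G b xs"
    and smult: "\<And>c a xs. \<lbrakk>a \<in> carrier A; xs \<in> Ls (n + 2)\<rbrakk> \<Longrightarrow> G (c \<odot> a) xs = sc c (G a xs)"
    and left: "\<And>a b xs. \<lbrakk>a \<in> carrier A; b \<in> carrier A; xs \<in> Ls (n + 2)\<rbrakk> \<Longrightarrow> G (a \<otimes> b) xs = G a (lact_list b xs)"
    and right: "\<And>a b xs. \<lbrakk>a \<in> carrier A; b \<in> carrier A; xs \<in> Ls (n + 2)\<rbrakk> \<Longrightarrow> G (b \<otimes> a) xs = G a (ract_list b xs)"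
    and f: "f \<in> Nn n"
  shows "lin_ext (ev G) f = 0"
proof -
  have ev: "ev G (a, bcst n f) = lin_ext (G a) f" if "a \<in> carrier A" "supp f \<subseteq> Ls (n + 2)" for a f
    by (rule ev_bcst[OF _ that(2)]) (rule null[OF that(1)])
  have ext_add: "lin_ext (G (a \<oplus>\<^bsub>A\<^esub> b)) f = lin_ext (G a) f + lin_ext (G b) f"
    and ext_left: "lin_ext (G (a \<otimes> b)) f = lin_ext (\<lambda>xs. G a (lact_list b xs)) f"
    and ext_right: "lin_ext (G (b \<otimes> a)) f = lin_ext (\<lambda>xs. G a (ract_list b xs)) f"
    if "a \<in> carrier A" "b \<in> carrier A" "supp f \<subseteq> Ls (n + 2)" for a b f
    unfolding lin_ext_fun_add[symmetric]
    by (rule lin_ext_cong, rule add left right; use that in auto)+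
  have ext_smult: "lin_ext (G (c \<odot> a)) f = sc c (lin_ext (G a) f)"
    if "a \<in> carrier A" "supp f \<subseteq> Ls (n + 2)" for a c f
    unfolding lin_ext_fun_sc[symmetric]
    by (rule lin_ext_cong, rule smult) (use that in auto)
  have "lin_ext (ev G) f \<in> {0}"
  proof (rule lin_ext_Nn[OF _ f])
    fix a X assume a: "a \<in> carrier A" and "X \<in> carrier (bar A n)"
    then obtain h where h: "supp h \<subseteq> Ls (n + 2)" "X = bcst n h" using bar_cases by blast
    note hyps = a h(1)
    show "ev G (c \<odot> a, X) - sc c (ev G (a, X)) \<in> {0}" for c
      unfolding h(2) using hyps by (simp add: ev ext_smult smult_in del: add_2_eq_Suc')
    show "ev G (a, c \<odot>\<^bsub>bar A n\<^esub> X) - sc c (ev G (a, X)) \<in> {0}" for c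
      unfolding h(2) bcst_smult[OF h(1)] using hyps keys_sc_sub[OF h(1), of c] by (simp add: ev lin_ext_sc del: add_2_eq_Suc')
    show "ev G (a, X \<oplus>\<^bsub>bar A n\<^esub> Y) - ev G (a, X) - ev G (a, Y) \<in> {0}" if Y: "Y \<in> carrier (bar A n)" for Y
    proof -
      obtain g where g: "supp g \<subseteq> Ls (n + 2)" "Y = bcst n g" using bar_cases[OF Y] .
      show ?thesis
        unfolding h(2) g(2) bcst_add[OF h(1) g(1)]
        using hyps g(1) keys_plus[OF h(1) g(1)] by (simp add: ev lin_ext_add del: add_2_eq_Suc')
    qed
    fix b assume b: "b \<in> carrier A"
    show "ev G (a \<oplus>\<^bsub>A\<^esub> b, X) - ev G (a, X) - ev G (b, X) \<in> {0}"
      unfolding h(2) using hyps b by (simp add: ev ext_add del: add_2_eq_Suc')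
    show "ev G (a \<otimes> b, X) - ev G (a, lact (bar A n) b X) \<in> {0}"
      unfolding h(2) lact_bcst[OF b h(1)]
      using hyps b keys_lact_list[OF b h(1)] by (simp add: ev ext_left alg_closed lin_ext_comp del: add_2_eq_Suc')
    show "ev G (b \<otimes> a, X) - ev G (a, ract (bar A n) X b) \<in> {0}"
      unfolding h(2) ract_bcst[OF b h(1)]
      using hyps b keys_ract_list[OF b h(1)] by (simp add: ev ext_right alg_closed lin_ext_comp del: add_2_eq_Suc')
  qed (simp add: fv.subspace_def)
  then show ?thesis by simp
qed

text \<open>The argument of \<psi> is the coefficient to which \<open>pure_normalize\<close> brings
  the tensor. Wrapping the outer factors round \<open>a\<close> in this way makes the bimodule
  relations a matter of associativity; the same holds for \<open>ev1\<close>.\<close>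

definition ev0 :: "('a \<Rightarrow> ('w \<Rightarrow>\<^sub>0 'k)) \<Rightarrow> ('a \<times> ('a list \<Rightarrow>\<^sub>0 'k) set \<Rightarrow>\<^sub>0 'k) \<Rightarrow> ('w \<Rightarrow>\<^sub>0 'k)" where
  "ev0 \<psi> = lin_ext (ev (\<lambda>a xs. \<psi> (xs ! 1 \<otimes> a \<otimes> xs ! 0)))"

definition ev1 :: "('a \<Rightarrow> 'a \<Rightarrow> ('w \<Rightarrow>\<^sub>0 'k)) \<Rightarrow> ('a \<times> ('a list \<Rightarrow>\<^sub>0 'k) set \<Rightarrow>\<^sub>0 'k) \<Rightarrow> ('w \<Rightarrow>\<^sub>0 'k)" where
  "ev1 \<phi> = lin_ext (ev (\<lambda>a xs. \<phi> (xs ! 2 \<otimes> a \<otimes> xs ! 0) (xs ! 1)))"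

lemma split2: "length us + 1 + length ws = 0 + 2 \<Longrightarrow>
    (us = [] \<and> (\<exists>b. ws = [b])) \<or> (ws = [] \<and> (\<exists>b. us = [b]))"
  by (cases us; cases ws) (auto simp: length_Suc_conv)

lemma split3: "length us + 1 + length ws = 1 + 2 \<Longrightarrow>
    (us = [] \<and> (\<exists>b c. ws = [b, c])) \<or> (\<exists>b c. us = [b] \<and> ws = [c]) \<or> (ws = [] \<and> (\<exists>b c. us = [b, c]))"
  by (cases us; cases ws) (auto simp: length_Suc_conv Suc_length_conv eval_nat_numeral)

context
  fixes \<psi> :: "'a \<Rightarrow> ('w \<Rightarrow>\<^sub>0 'k)"
  assumes lin: "\<And>a b. \<lbrakk>a \<in> carrier A; b \<in> carrier A\<rbrakk> \<Longrightarrow> \<psi> (a \<oplus>\<^bsub>A\<^esub> b) = \<psi> a + \<psi> b"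
    "\<And>c a. a \<in> carrier A \<Longrightarrow> \<psi> (c \<odot> a) = sc c (\<psi> a)"
begin

lemma ev0_aux:
  assumes a: "a \<in> carrier A" and u: "u \<in> power_null A (0 + 2)"
  shows "lin_ext (\<lambda>xs. \<psi> (xs ! 1 \<otimes> a \<otimes> xs ! 0)) u = 0"
proof -
  have "lin_ext (\<lambda>xs. \<psi> (xs ! 1 \<otimes> a \<otimes> xs ! 0)) u \<in> {0}"
    by (rule lin_ext_power_null[OF _ _ _ u])
      (use a in \<open>auto simp: fv.subspace_def alg_simps lin dest!: split2[simplified]\<close>)
  then show ?thesis by simp
qed

lemma ev0_null: "f \<in> Nn 0 \<Longrightarrow> ev0 \<psi> f = 0"
  unfolding ev0_def
  by (rule ev_null[OF ev0_aux])
    (auto simp: alg_simps lin Ls_def length_Suc_conv eval_nat_numeral lact_list_def ract_list_def)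

lemma ev0_tau: "a \<in> carrier A \<Longrightarrow> ev0 \<psi> (tau 0 a []) = \<psi> a"
  using ev_bcst[where G = "\<lambda>a xs. \<psi> (xs ! 1 \<otimes> a \<otimes> xs ! 0)"
        and n = 0 and a = a and f = "sgl [\<one>, \<one>] 1",
      OF ev0_aux[of a]] unital_Ls[of "[]" 0]
  by (simp add: ev0_def tau_def alg_simps)

end

context
  fixes \<phi> :: "'a \<Rightarrow> 'a \<Rightarrow> ('w \<Rightarrow>\<^sub>0 'k)"
  assumes lin: "\<And>a b x. \<lbrakk>a \<in> carrier A; b \<in> carrier A; x \<in> carrier A\<rbrakk> \<Longrightarrow> \<phi> (a \<oplus>\<^bsub>A\<^esub> b) x = \<phi> a x + \<phi> b x"
    "\<And>c a x. \<lbrakk>a \<in> carrier A; x \<in> carrier A\<rbrakk> \<Longrightarrow> \<phi> (c \<odot> a) x = sc c (\<phi> a x)"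
    "\<And>a x y. \<lbrakk>a \<in> carrier A; x \<in> carrier A; y \<in> carrier A\<rbrakk> \<Longrightarrow> \<phi> a (x \<oplus>\<^bsub>A\<^esub> y) = \<phi> a x + \<phi> a y"
    "\<And>c a x. \<lbrakk>a \<in> carrier A; x \<in> carrier A\<rbrakk> \<Longrightarrow> \<phi> a (c \<odot> x) = sc c (\<phi> a x)"
begin

lemma ev1_aux:
  assumes a: "a \<in> carrier A" and u: "u \<in> power_null A (1 + 2)"
  shows "lin_ext (\<lambda>xs. \<phi> (xs ! 2 \<otimes> a \<otimes> xs ! 0) (xs ! 1)) u = 0"
proof -
  have "lin_ext (\<lambda>xs. \<phi> (xs ! 2 \<otimes> a \<otimes> xs ! 0) (xs ! 1)) u \<in> {0}"
    by (rule lin_ext_power_null[OF _ _ _ u])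
      (use a in \<open>auto simp: fv.subspace_def alg_simps lin dest!: split3[simplified]\<close>)
  then show ?thesis by simp
qed

lemma ev1_null: "f \<in> Nn 1 \<Longrightarrow> ev1 \<phi> f = 0"
  unfolding ev1_def
  by (rule ev_null[OF ev1_aux])
    (auto simp: alg_simps lin Ls_def length_Suc_conv eval_nat_numeral lact_list_def ract_list_def)

lemma ev1_tau: "\<lbrakk>a \<in> carrier A; x \<in> carrier A\<rbrakk> \<Longrightarrow> ev1 \<phi> (tau 1 a [x]) = \<phi> a x"
  using ev_bcst[where G = "\<lambda>a xs. \<phi> (xs ! 2 \<otimes> a \<otimes> xs ! 0) (xs ! 1)"
        and n = 1 and a = a and f = "sgl [\<one>, x, \<one>] 1",
      OF ev1_aux[of a]] unital_Ls[of "[x]" 1]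
  by (simp add: ev1_def tau_def alg_simps)

text \<open>The subspace \<open>I\<close> measures how far \<phi> may violate Leibniz's rule. The
  map used later does violate it, so its values on boundaries are controlled but not zero.\<close>

lemma ev1_Dn:
  assumes I: "fv.subspace I"
    and rel: "\<And>a x y. \<lbrakk>a \<in> carrier A; x \<in> carrier A; y \<in> carrier A\<rbrakk> \<Longrightarrow>
      \<phi> (a \<otimes> x) y - \<phi> a (x \<otimes> y) + \<phi> (y \<otimes> a) x \<in> I"
    and f: "supp f \<subseteq> Fs 2"
  shows "ev1 \<phi> (Dn 2 f) \<in> I"
proof -
  let ?U = "{f. ev1 \<phi> (Dn 2 f) \<in> I}"
  have "f \<in> ?U"
  proof (rule in_subspace_tau[OF _ _ f])
    show "fv.subspace ?U"
      using subspace_lin_ext_vimage[OF subspace_lin_ext_vimage[OF I]]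
      unfolding Dn_def ev1_def by simp
    show "Nn 2 \<subseteq> ?U"
      using Dn_null[of _ 1] ev1_null fv.subspace_0[OF I] by (auto simp: numeral_2_eq_2)
    fix a ys assume a: "a \<in> carrier A" and ys: "set ys \<subseteq> carrier A" "length ys = 2"
    then obtain x y where xy: "ys = [x, y]" "x \<in> carrier A" "y \<in> carrier A"
      by (auto simp: eval_nat_numeral length_Suc_conv)
    have "ev1 \<phi> (Dn 2 (tau 2 a [x, y])) =
        ev1 \<phi> (tau 1 (a \<otimes> x) [y] - tau 1 a [x \<otimes> y] + tau 1 (y \<otimes> a) [x])"
      using ev1_null[OF Dn_tau_2[OF a xy(2,3)]] by (simp add: ev1_def lin_ext_diff)
    also have "\<dots> = \<phi> (a \<otimes> x) y - \<phi> a (x \<otimes> y) + \<phi> (y \<otimes> a) x"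
      using ev1_tau a xy by (simp add: ev1_def lin_ext_diff lin_ext_add alg_simps)
    finally show "tau 2 a ys \<in> ?U" using rel[OF a xy(2,3)] xy(1) by simp
  qed
  then show ?thesis by simp
qed

end


section \<open>One-cycles modulo boundaries\<close>

definition B1 :: "('a \<times> ('a list \<Rightarrow>\<^sub>0 'k) set \<Rightarrow>\<^sub>0 'k) set" where
  "B1 = {f + Dn 2 h | f h. f \<in> Nn 1 \<and> supp h \<subseteq> Fs 2}"

lemma Dn_linear: "Dn n (f + g) = Dn n f + Dn n g" "Dn n (f - g) = Dn n f - Dn n g"
  "Dn n (sc c f) = sc c (Dn n f)" "Dn n 0 = 0"
  by (simp_all add: Dn_def lin_ext_add lin_ext_diff lin_ext_sc)

lemma B1_subspace: "fv.subspace B1"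
proof (rule fv.subspaceI)
  show "0 \<in> B1"
    unfolding B1_def
    by (intro CollectI exI[of _ 0]) (simp add: Dn_linear fv.subspace_0[OF tn.U_subspace])
next
  fix x y assume "x \<in> B1" "y \<in> B1"
  then obtain f h f' h' where *: "x = f + Dn 2 h" "y = f' + Dn 2 h'" "f \<in> Nn 1" "f' \<in> Nn 1"
    "supp h \<subseteq> Fs 2" "supp h' \<subseteq> Fs 2" unfolding B1_def by blast
  have "x + y = (f + f') + Dn 2 (h + h')" by (simp add: * Dn_linear)
  moreover have "f + f' \<in> Nn 1" by (rule fv.subspace_add[OF tn.U_subspace *(3,4)])
  ultimately show "x + y \<in> B1" unfolding B1_def using keys_plus[OF *(5,6)] by blast
next
  fix c x assume "x \<in> B1"
  then obtain f h where *: "x = f + Dn 2 h" "f \<in> Nn 1" "supp h \<subseteq> Fs 2"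
    unfolding B1_def by blast
  have "sc c x = sc c f + Dn 2 (sc c h)" by (simp add: * Dn_linear fv.scale_right_distrib)
  moreover have "sc c f \<in> Nn 1" by (rule fv.subspace_scale[OF tn.U_subspace *(2)])
  ultimately show "sc c x \<in> B1" unfolding B1_def using keys_sc_sub[OF *(3)] by blast
qed

lemma Nn_B1: "Nn 1 \<subseteq> B1"
proof
  fix f assume "f \<in> Nn 1"
  then show "f \<in> B1"
    unfolding B1_def by (intro CollectI exI[of _ f] exI[of _ 0]) (simp add: Dn_linear)
qed

lemma Dn_B1: "supp h \<subseteq> Fs 2 \<Longrightarrow> Dn 2 h \<in> B1"
  unfolding B1_def
  by (intro CollectI exI[of _ 0] exI[of _ h]) (simp add: fv.subspace_0[OF tn.U_subspace])

lemma tau_leibniz: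
  assumes "a \<in> carrier A" "x \<in> carrier A" "y \<in> carrier A"
  shows "tau 1 (a \<otimes> x) [y] - tau 1 a [x \<otimes> y] + tau 1 (y \<otimes> a) [x] \<in> B1"
proof (rule mod_in[OF B1_subspace mod_sym[OF B1_subspace]])
  show "Dn 2 (tau 2 a [x, y]) - (tau 1 (a \<otimes> x) [y] - tau 1 a [x \<otimes> y]
      + tau 1 (y \<otimes> a) [x]) \<in> B1"
    using Dn_tau_2[OF assms] Nn_B1 by blast
  show "Dn 2 (tau 2 a [x, y]) \<in> B1"
    by (rule Dn_B1, rule tau_keys) (use assms in auto)
qed

text \<open>Like \<open>B1\<close>, a subspace of the free space that contains \<open>Nn 1\<close>.
  The first homology is the quotient of \<open>Z1\<close> by \<open>B1\<close>, although it is
  defined in two stages.\<close>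

definition Z1 :: "('a \<times> ('a list \<Rightarrow>\<^sub>0 'k) set \<Rightarrow>\<^sub>0 'k) set" where
  "Z1 = {f. supp f \<subseteq> Fs 1 \<and> Dn 1 f \<in> Nn 0}"

lemma Z1_subspace: "fv.subspace Z1"
proof -
  have "Z1 = {f. supp f \<subseteq> Fs 1} \<inter> {f. Dn 1 f \<in> Nn 0}" by (auto simp: Z1_def)
  then show ?thesis
    using fv.subspace_inter[OF subspace_keys subspace_lin_ext_vimage[OF tn.U_subspace]]
    by (simp add: Dn_def)
qed

lemma B1_Z1: "B1 \<subseteq> Z1"
proof
  fix x assume "x \<in> B1"
  then obtain f h where *: "x = f + Dn 2 h" "f \<in> Nn 1" "supp h \<subseteq> Fs 2"
    unfolding B1_def by blast
  have "f \<in> Z1" using *(2) tn.U_keys[of f 1] Dn_null[of f 0] by (simp add: Z1_def)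
  moreover have "Dn 2 h \<in> Z1" using *(3) Dn_keys[of h 1] Dn_Dn[of h] by (simp add: Z1_def numeral_2_eq_2)
  ultimately show "x \<in> Z1" unfolding *(1) by (rule fv.subspace_add[OF Z1_subspace])
qed

text \<open>Spelled as in \<open>HH_def\<close> at degree one, guard included, so that unfolding the
  definition yields this record literally.\<close>

abbreviation cycle_space :: "('k, ('a \<times> ('a list \<Rightarrow>\<^sub>0 'k) set \<Rightarrow>\<^sub>0 'k) set) module" where
  "cycle_space \<equiv> (HH_chain A 1)\<lparr>carrier :=
     {x \<in> carrier (HH_chain A 1). (1::nat) > 0 \<longrightarrow> HH_diff A 1 x = \<zero>\<^bsub>HH_chain A (1 - 1)\<^esub>}\<rparr>"

lemma carrier_cycle_space: "carrier cycle_space = tn.cst 1 ` Z1"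
proof -
  have "HH_diff A 1 (tn.cst 1 f) = \<zero>\<^bsub>HH_chain A (1 - 1)\<^esub> \<longleftrightarrow> Dn 1 f \<in> Nn 0"
    if f: "supp f \<subseteq> Fs 1" for f
  proof -
    have "supp (Dn 1 f) \<subseteq> Fs 0" using Dn_keys[of f 0] f by simp
    then show ?thesis
      using HH_diff_cst[of f 0] tn.cst_eq_zero_iff[of "Dn 1 f" 0] f by (simp add: HH_chain_eq)
  qed
  then show ?thesis
    by (auto simp: HH_chain_eq tn.carrier_Qm Z1_def)
qed

lemma vectorspace_cycle_space: "vectorspace class_ring cycle_space"
proof -
  define V where "V = (\<lparr>carrier = Z1, mult = undefined, one = undefined, zero = 0, add = (+),
      smult = (\<lambda>c. sc c)\<rparr> :: ('k, 'a \<times> ('a list \<Rightarrow>\<^sub>0 'k) set \<Rightarrow>\<^sub>0 'k) module)"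
  have "vectorspace class_ring V"
    by (rule vectorspace_type_level) (auto simp: V_def Z1_subspace)
  moreover have "carrier cycle_space = tn.cst 1 ` carrier V"
    unfolding carrier_cycle_space by (simp add: V_def)
  ultimately show ?thesis
    by (rule vectorspace_image)
      (auto simp: V_def HH_chain_eq tn.cst_add tn.cst_smult tn.cst_zero Z1_def)
qed

text \<open>Elements of \<open>Nn 1\<close> change no coset, so \<open>B1\<close> has the same image
  as the boundaries proper.\<close>

lemma boundary_image: "HH_diff A (1 + 1) ` carrier (HH_chain A (1 + 1)) = tn.cst 1 ` B1"
proof -
  have "HH_diff A (1 + 1) ` carrier (HH_chain A (1 + 1)) = tn.cst 1 ` Dn 2 ` {f. supp f \<subseteq> Fs 2}"
    unfolding HH_chain_eq tn.carrier_Qm image_image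
    by (rule image_cong) (use HH_diff_cst[of _ 1] in \<open>auto simp: numeral_2_eq_2\<close>)
  also have "\<dots> = tn.cst 1 ` B1"
  proof -
    have "tn.cst 1 (f + Dn 2 h) = tn.cst 1 (Dn 2 h)" if "f \<in> Nn 1" "supp h \<subseteq> Fs 2" for f h
    proof -
      have k: "supp (Dn 2 h) \<subseteq> Fs 1"
        using Dn_keys[of h 1] that(2) by (simp add: numeral_2_eq_2)
      show ?thesis
        using tn.cst_eq[OF keys_plus[OF tn.U_keys[OF that(1)] k] k] that(1) by simp
    qed
    moreover have "Dn 2 h \<in> B1" if "supp h \<subseteq> Fs 2" for h by (rule Dn_B1[OF that])
    ultimately show ?thesis unfolding B1_def by (force simp: image_iff)
  qed
  finally show ?thesis .
qed

lemma quotient_space_HH1: "quotient_space cycle_space (tn.cst 1 ` B1)"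
proof -
  have keys: "supp f \<subseteq> Fs 1" if "f \<in> B1" for f using that B1_Z1 by (auto simp: Z1_def)
  show ?thesis
    unfolding quotient_space_def
  proof (rule conjI[OF vectorspace_cycle_space], unfold_locales)
    show "tn.cst 1 ` B1 \<subseteq> carrier cycle_space"
      unfolding carrier_cycle_space using B1_Z1 by blast
    show "\<zero>\<^bsub>cycle_space\<^esub> \<in> tn.cst 1 ` B1"
      using fv.subspace_0[OF B1_subspace] by (auto simp: HH_chain_eq tn.cst_zero)
    show "x \<oplus>\<^bsub>cycle_space\<^esub> y \<in> tn.cst 1 ` B1" if "x \<in> tn.cst 1 ` B1" "y \<in> tn.cst 1 ` B1" for x y
      using that fv.subspace_add[OF B1_subspace] keys by (auto simp: HH_chain_eq tn.cst_add)
    show "c \<odot>\<^bsub>cycle_space\<^esub> x \<in> tn.cst 1 ` B1" if "x \<in> tn.cst 1 ` B1" for c x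
      using that fv.subspace_scale[OF B1_subspace] keys by (auto simp: HH_chain_eq tn.cst_smult)
  qed
qed

text \<open>From here on the two-stage quotient is out of sight: a basis of the homology is found by
  working with representatives in \<open>Z1\<close> and congruences modulo
  \<open>B1\<close>.\<close>

theorem HH1_basis:
  assumes M: "finite M"
    and g: "\<And>m. m \<in> M \<Longrightarrow> g m \<in> Z1"
    and span: "\<And>f. f \<in> Z1 \<Longrightarrow> \<exists>\<kappa>. supp \<kappa> \<subseteq> M \<and> f - lin_ext g \<kappa> \<in> B1"
    and indep: "\<And>\<kappa>. \<lbrakk>supp \<kappa> \<subseteq> M; lin_ext g \<kappa> \<in> B1\<rbrakk> \<Longrightarrow> \<kappa> = 0"
  shows "vectorspace.fin_dim class_ring (HH 1 A) \<and> vectorspace.dim class_ring (HH 1 A) = card M"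
proof -
  interpret Q: quotient_space cycle_space "tn.cst 1 ` B1" by (rule quotient_space_HH1)
  have HH: "HH 1 A = quot_module cycle_space (tn.cst 1 ` B1)"
    unfolding HH_def boundary_image ..
  define cls where "cls f = tn.cst 1 ` B1 +>\<^bsub>cycle_space\<^esub> (tn.cst 1 f)" for f
  have Z1_keys: "supp f \<subseteq> Fs 1" if "f \<in> Z1" for f using that by (simp add: Z1_def)
  have cst_in: "tn.cst 1 f \<in> carrier cycle_space" if "f \<in> Z1" for f
    unfolding carrier_cycle_space using that by blast
  have ops: "tn.cst 1 f \<oplus>\<^bsub>cycle_space\<^esub> tn.cst 1 h = tn.cst 1 (f + h)"
    "c \<odot>\<^bsub>cycle_space\<^esub> tn.cst 1 f = tn.cst 1 (sc c f)"
    "\<zero>\<^bsub>cycle_space\<^esub> = tn.cst 1 0" if "f \<in> Z1" "h \<in> Z1" for f h c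
    using that by (simp_all add: HH_chain_eq tn.cst_add tn.cst_smult tn.cst_zero Z1_keys[simplified])
  note Z1_0 = fv.subspace_0[OF Z1_subspace]
  have cls_add: "cls (f + h) = cls f \<oplus>\<^bsub>HH 1 A\<^esub> cls h" if "f \<in> Z1" "h \<in> Z1" for f h
    using Q.add_quot[OF cst_in[OF that(1)] cst_in[OF that(2)]] unfolding ops[OF that] HH cls_def by (rule sym)
  have cls_smult: "cls (sc c f) = c \<odot>\<^bsub>HH 1 A\<^esub> cls f" if "f \<in> Z1" for c f
    using Q.smult_quot[OF cst_in[OF that], of c] unfolding ops[OF that that] HH cls_def by (rule sym)
  have cls_zero: "cls 0 = \<zero>\<^bsub>HH 1 A\<^esub>"
    using Q.coset_zero unfolding ops(3)[OF Z1_0 Z1_0] HH cls_def Q.zero_quot .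
  have cls_B1: "cls f = \<zero>\<^bsub>HH 1 A\<^esub> \<longleftrightarrow> f \<in> B1" if f: "f \<in> Z1" for f
  proof -
    have "cls f = \<zero>\<^bsub>HH 1 A\<^esub> \<longleftrightarrow> tn.cst 1 f \<in> tn.cst 1 ` B1"
      unfolding HH Q.zero_quot cls_def by (rule Q.coset_eq_self_iff[OF cst_in[OF f]])
    also have "tn.cst 1 f \<in> tn.cst 1 ` B1 \<longleftrightarrow> f \<in> B1"
    proof
      assume "tn.cst 1 f \<in> tn.cst 1 ` B1"
      then obtain b where b: "b \<in> B1" "tn.cst 1 f = tn.cst 1 b" by blast
      \<comment> \<open>Equal cosets identify \<open>f\<close> with \<open>b\<close> only up to
        \<open>Nn 1\<close>, which is contained in \<open>B1\<close>.\<close>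
      then have "f - b \<in> Nn 1" using tn.cst_eq[of f 1 b] B1_Z1 Z1_keys f by blast
      then show "f \<in> B1" using Nn_B1 b(1) by (blast intro: mod_in[OF B1_subspace])
    qed blast
    finally show ?thesis .
  qed
  have g_in: "lin_ext g \<kappa> \<in> Z1" if "supp \<kappa> \<subseteq> M" for \<kappa>
    by (rule lin_ext_in[OF Z1_subspace]) (use that g in blast)
  show ?thesis
  proof (rule fin_dim_image[OF M, where h = "\<lambda>\<kappa>. cls (lin_ext g \<kappa>)"])
    show "carrier (HH 1 A) = (\<lambda>\<kappa>. cls (lin_ext g \<kappa>)) ` {\<kappa>. supp \<kappa> \<subseteq> M}"
    proof -
      have "carrier (HH 1 A) = cls ` Z1"
        unfolding HH Q.carrier_quot carrier_cycle_space image_image cls_def ..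
      moreover have "\<exists>\<kappa>. supp \<kappa> \<subseteq> M \<and> cls f = cls (lin_ext g \<kappa>)" if f: "f \<in> Z1" for f
      proof -
        obtain \<kappa> where \<kappa>: "supp \<kappa> \<subseteq> M" "f - lin_ext g \<kappa> \<in> B1" using span[OF f] by blast
        have "cls f = cls (f - lin_ext g \<kappa> + lin_ext g \<kappa>)" by simp
        also have "\<dots> = cls (f - lin_ext g \<kappa>) \<oplus>\<^bsub>HH 1 A\<^esub> cls (lin_ext g \<kappa>)"
          by (rule cls_add[OF _ g_in[OF \<kappa>(1)]]) (use \<kappa>(2) B1_Z1 in blast)
        also have "cls (f - lin_ext g \<kappa>) = cls 0"
          using cls_B1[of "f - lin_ext g \<kappa>"] \<kappa>(2) B1_Z1 by (auto simp: cls_zero)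
        also have "cls 0 \<oplus>\<^bsub>HH 1 A\<^esub> cls (lin_ext g \<kappa>) = cls (lin_ext g \<kappa>)"
          using cls_add[OF fv.subspace_0[OF Z1_subspace] g_in[OF \<kappa>(1)]] by simp
        finally show ?thesis using \<kappa>(1) by blast
      qed
      ultimately show ?thesis using g_in by (auto simp: image_iff)
    qed
  qed (use g_in cls_add cls_smult cls_zero cls_B1 indep in \<open>simp_all add: lin_ext_add lin_ext_sc\<close>)
qed

end


section \<open>Paths in a quiver\<close>

lemma ptgt_Nil [simp]: "ptgt Q (u, []) = u"
  by (simp add: ptgt_def pre_digraph.awalk_verts.simps)

lemma ptgt_Cons [simp]: "ptgt Q (u, a # p) = ptgt Q (head Q a, p)"
  by (simp add: ptgt_def pre_digraph.awalk_verts_conv)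

lemma ptgt_append [simp]: "ptgt Q (u, p @ q) = ptgt Q (ptgt Q (u, p), q)"
  by (induction p arbitrary: u) auto

lemma ptgt_snoc [simp]: "ptgt Q (u, p @ [a]) = head Q a"
  by simp

lemma psrc_pcomp [simp]: "psrc (pcomp \<alpha> \<beta>) = psrc \<beta>"
  by (simp add: pcomp_def)

lemma snd_pcomp [simp]: "snd (pcomp \<alpha> \<beta>) = snd \<beta> @ snd \<alpha>"
  by (simp add: pcomp_def)

lemma ptgt_pcomp [simp]: "ptgt Q \<beta> = psrc \<alpha> \<Longrightarrow> ptgt Q (pcomp \<alpha> \<beta>) = ptgt Q \<alpha>"
  by (cases \<alpha>; cases \<beta>) (simp add: pcomp_def)

lemma pcomp_assoc: "pcomp (pcomp \<alpha> \<beta>) \<gamma> = pcomp \<alpha> (pcomp \<beta> \<gamma>)"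
  by (simp add: pcomp_def)

text \<open>The parameter \<open>fld\<close> only serves to fix the type of the coefficients.\<close>

locale monomial_quiver = fin_digraph Q for Q :: "('v, 'e) pre_digraph" +
  fixes Z :: "('v, 'e) qpath set" and fld :: "'k::field itself"
  assumes Z: "monomial_relations Q Z"
begin

abbreviation P :: "('v, 'e) qpath set" where "P \<equiv> qpaths Q"
abbreviation B :: "('v, 'e) qpath set" where "B \<equiv> nonzero_paths Q Z"

lemma path_iff: "(u, p) \<in> P \<longleftrightarrow> awalk u p (ptgt Q (u, p))"
proof
  assume "(u, p) \<in> P"
  then obtain v where v: "awalk u p v" by (auto simp: qpaths_def)
  then have "awlast u p = v" by simp
  with v show "awalk u p (ptgt Q (u, p))" by (simp add: ptgt_def)
qed (auto simp: qpaths_def)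

lemma path_Nil [simp]: "(u, []) \<in> P \<longleftrightarrow> u \<in> verts Q"
  by (simp add: path_iff awalk_Nil_iff)

lemma path_Cons [simp]: "(u, a # p) \<in> P \<longleftrightarrow> a \<in> arcs Q \<and> u = tail Q a \<and> (head Q a, p) \<in> P"
  by (auto simp: path_iff awalk_Cons_iff)

lemma path_verts: "(u, p) \<in> P \<Longrightarrow> u \<in> verts Q"
  by (cases p) auto

lemma path_append [simp]: "(u, p @ q) \<in> P \<longleftrightarrow> (u, p) \<in> P \<and> (ptgt Q (u, p), q) \<in> P"
  by (induction p arbitrary: u) (auto dest: path_verts)

lemma ptgt_verts: "(u, p) \<in> P \<Longrightarrow> ptgt Q (u, p) \<in> verts Q"
  by (induction p arbitrary: u) auto

lemma pcomp_path: "\<lbrakk>\<alpha> \<in> P; \<beta> \<in> P; ptgt Q \<beta> = psrc \<alpha>\<rbrakk> \<Longrightarrow> pcomp \<alpha> \<beta> \<in> P"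
  by (cases \<alpha>; cases \<beta>) (auto simp: pcomp_def)

lemma path_source: "\<lbrakk>(u, p) \<in> P; p \<noteq> []\<rbrakk> \<Longrightarrow> u = tail Q (hd p)"
  by (cases p) auto

lemma Z_props:
  "Z \<subseteq> P" "\<zeta> \<in> Z \<Longrightarrow> plength \<zeta> \<ge> 2" "\<lbrakk>\<zeta> \<in> Z; \<xi> \<in> Z; is_subpath Q \<xi> \<zeta>\<rbrakk> \<Longrightarrow> \<xi> = \<zeta>"
  using Z by (auto simp: monomial_relations_def)

text \<open>A path with at least one arrow starts at the tail of its first arrow, so comparing
  arrows also compares the starting vertices. A trivial path has no arrow to compare.\<close>

lemma occurs_at_iff:
  assumes "\<zeta> \<in> P" "snd \<zeta> \<noteq> []" "\<gamma> \<in> P"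
  shows "occurs_at Q \<zeta> \<gamma> i \<longleftrightarrow> (\<exists>xs ys. snd \<gamma> = xs @ snd \<zeta> @ ys \<and> length xs = i)"
proof
  assume "occurs_at Q \<zeta> \<gamma> i"
  then have *: "i + plength \<zeta> \<le> plength \<gamma>" "take (plength \<zeta>) (drop i (snd \<gamma>)) = snd \<zeta>"
    by (auto simp: occurs_at_def)
  have "snd \<gamma> = take i (snd \<gamma>) @ snd \<zeta> @ drop (plength \<zeta>) (drop i (snd \<gamma>))"
    by (metis *(2) append_take_drop_id)
  moreover have "length (take i (snd \<gamma>)) = i" using *(1) by simp
  ultimately show "\<exists>xs ys. snd \<gamma> = xs @ snd \<zeta> @ ys \<and> length xs = i" by blast
next
  assume "\<exists>xs ys. snd \<gamma> = xs @ snd \<zeta> @ ys \<and> length xs = i"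
  then obtain xs ys where *: "snd \<gamma> = xs @ snd \<zeta> @ ys" "length xs = i" by blast
  have "psrc \<zeta> = tail Q (hd (snd \<zeta>))" using path_source[of "psrc \<zeta>" "snd \<zeta>"] assms by simp
  moreover have "awalk_verts (psrc \<gamma>) (snd \<gamma>) ! i = tail Q (hd (snd \<zeta>))"
    using assms(2) * by (auto simp: awalk_verts_conv nth_append hd_append hd_conv_nth)
  ultimately show "occurs_at Q \<zeta> \<gamma> i" using * by (simp add: occurs_at_def)
qed

text \<open>Being zero is read off the arrow list alone, so that it can be tested on pieces and
  rotations of a cycle without keeping track of vertices.\<close>

definition bad :: "'e list \<Rightarrow> bool" where
  "bad p \<longleftrightarrow> (\<exists>\<zeta>\<in>Z. \<exists>xs ys. p = xs @ snd \<zeta> @ ys)"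

lemma Z_ne: "\<zeta> \<in> Z \<Longrightarrow> snd \<zeta> \<noteq> []"
  using Z_props(2)[of \<zeta>] by auto

lemma is_subpath_iff:
  assumes "\<zeta> \<in> Z" "\<gamma> \<in> P"
  shows "is_subpath Q \<zeta> \<gamma> \<longleftrightarrow> (\<exists>xs ys. snd \<gamma> = xs @ snd \<zeta> @ ys)"
  using occurs_at_iff[OF subsetD[OF Z_props(1) assms(1)] Z_ne[OF assms(1)] assms(2)]
  by (simp add: is_subpath_def)

lemma B_iff: "\<gamma> \<in> B \<longleftrightarrow> \<gamma> \<in> P \<and> \<not> bad (snd \<gamma>)"
  unfolding nonzero_paths_def bad_def using is_subpath_iff[of _ \<gamma>] by blast

lemma bad_append: "bad p \<Longrightarrow> bad (xs @ p)" "bad p \<Longrightarrow> bad (p @ xs)"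
  unfolding bad_def by (metis append.assoc)+

lemma not_bad_short: "length p \<le> 1 \<Longrightarrow> \<not> bad p"
proof
  assume p: "length p \<le> 1" and "bad p"
  then obtain \<zeta> xs ys where "\<zeta> \<in> Z" "p = xs @ snd \<zeta> @ ys" unfolding bad_def by blast
  with p Z_props(2)[of \<zeta>] show False by simp
qed

section \<open>The path algebra\<close>

abbreviation KQ :: "('k, ('v, 'e) qpath \<Rightarrow>\<^sub>0 'k) module" where "KQ \<equiv> path_algebra Q"

definition pm :: "('v, 'e) qpath \<Rightarrow> ('v, 'e) qpath \<Rightarrow> (('v, 'e) qpath \<Rightarrow>\<^sub>0 'k)" where
  "pm \<alpha> \<beta> = (if ptgt Q \<beta> = psrc \<alpha> then sgl (pcomp \<alpha> \<beta>) 1 else 0)"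

definition pmul :: "(('v, 'e) qpath \<Rightarrow>\<^sub>0 'k) \<Rightarrow> (('v, 'e) qpath \<Rightarrow>\<^sub>0 'k) \<Rightarrow> (('v, 'e) qpath \<Rightarrow>\<^sub>0 'k)" where
  "pmul f g = lin_ext (\<lambda>\<alpha>. lin_ext (pm \<alpha>) g) f"

lemma KQ_simps:
  "carrier KQ = {f. supp f \<subseteq> P}" "add KQ = (+)" "zero KQ = 0"
  "smult KQ = (\<lambda>c. sc c)" "one KQ = (\<Sum>v\<in>verts Q. sgl (v, []) 1)" "mult KQ = pmul"
proof -
  have "mult KQ f g = pmul f g" for f g
    unfolding pmul_def lin_ext_def fv.scale_sum_right
    by (auto simp: path_algebra_def pm_def intro!: sum.cong)
  then show "mult KQ = pmul" by (intro ext)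
qed (simp_all add: path_algebra_def)

lemma pmul_single: "pmul (sgl \<alpha> c) (sgl \<beta> d) = sc (c * d) (pm \<alpha> \<beta>)"
  by (simp add: pmul_def)

lemma pmul_add: "pmul (f + f') g = pmul f g + pmul f' g" "pmul f (g + g') = pmul f g + pmul f g'"
  by (simp_all add: pmul_def lin_ext_add lin_ext_fun_add)

lemma pmul_sc: "pmul (sc c f) g = sc c (pmul f g)" "pmul f (sc c g) = sc c (pmul f g)"
  by (simp_all add: pmul_def lin_ext_sc lin_ext_fun_sc)

lemma pmul_0 [simp]: "pmul 0 g = 0" "pmul f 0 = 0"
  by (simp_all add: pmul_def)

lemma pmul_sum: "pmul (sum F S) g = (\<Sum>s\<in>S. pmul (F s) g)" "pmul g (sum F S) = (\<Sum>s\<in>S. pmul g (F s))"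
  by (induction S rule: infinite_finite_induct) (simp_all add: pmul_add)

lemma pm_keys: "\<lbrakk>\<alpha> \<in> P; \<beta> \<in> P\<rbrakk> \<Longrightarrow> supp (pm \<alpha> \<beta>) \<subseteq> P"
  by (simp add: pm_def pcomp_path)

lemma pmul_keys:
  assumes "supp f \<subseteq> P" "supp g \<subseteq> P"
  shows "supp (pmul f g) \<subseteq> P"
  unfolding pmul_def by (intro lin_ext_keys) (use assms pm_keys in blast)

text \<open>Clear on paths, and extended in one argument after the other: with the other two
  arguments fixed, the elements that satisfy the law form a subspace.\<close>

lemma pmul_assoc: "pmul (pmul f g) h = pmul f (pmul g h)"
proof -
  let ?s = "\<lambda>\<alpha>. sgl \<alpha> (1::'k)"
  have 1: "pmul (pmul (?s \<alpha>) (?s \<beta>)) (?s \<gamma>) = pmul (?s \<alpha>) (pmul (?s \<beta>) (?s \<gamma>))" for \<alpha> \<beta> \<gamma>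
    by (auto simp: pmul_single pm_def pcomp_assoc)
  have S: "fv.subspace {h. pmul (pmul f g) h = pmul f (pmul g h)}" for f g
    by (auto simp: fv.subspace_def pmul_add pmul_sc)
  have "h \<in> {h. pmul (pmul (?s \<alpha>) (?s \<beta>)) h = pmul (?s \<alpha>) (pmul (?s \<beta>) h)}" for h \<alpha> \<beta>
    by (rule in_subspace_keys[OF S]) (use 1 in simp)
  then have 2: "pmul (pmul (?s \<alpha>) (?s \<beta>)) h = pmul (?s \<alpha>) (pmul (?s \<beta>) h)" for h \<alpha> \<beta> by blast
  have S: "fv.subspace {g. pmul (pmul f g) h = pmul f (pmul g h)}" for f h
    by (auto simp: fv.subspace_def pmul_add pmul_sc)
  have "g \<in> {g. pmul (pmul (?s \<alpha>) g) h = pmul (?s \<alpha>) (pmul g h)}" for h \<alpha> g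
    by (rule in_subspace_keys[OF S]) (use 2 in simp)
  then have 3: "pmul (pmul (?s \<alpha>) g) h = pmul (?s \<alpha>) (pmul g h)" for h \<alpha> g by blast
  have S: "fv.subspace {f. pmul (pmul f g) h = pmul f (pmul g h)}" for g h
    by (auto simp: fv.subspace_def pmul_add pmul_sc)
  have "f \<in> {f. pmul (pmul f g) h = pmul f (pmul g h)}"
    by (rule in_subspace_keys[OF S]) (use 3 in simp)
  then show ?thesis by blast
qed

lemma pmul_one:
  assumes "supp f \<subseteq> P"
  shows "pmul (\<Sum>v\<in>verts Q. sgl (v, []) 1) f = f"
    and "pmul f (\<Sum>v\<in>verts Q. sgl (v, []) 1) = f"
proof -
  let ?e = "\<Sum>v\<in>verts Q. sgl (v, []) (1::'k)"
  have v: "psrc \<gamma> \<in> verts Q" "ptgt Q \<gamma> \<in> verts Q" if "\<gamma> \<in> supp f" for \<gamma>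
    using that assms path_verts[of "psrc \<gamma>" "snd \<gamma>"] ptgt_verts[of "psrc \<gamma>" "snd \<gamma>"] by auto
  have S: "fv.subspace {f. pmul ?e f = f}" "fv.subspace {f. pmul f ?e = f}"
    by (auto simp: fv.subspace_def pmul_add pmul_sc)
  have "f \<in> {f. pmul ?e f = f}"
  proof (rule in_subspace_keys[OF S(1)])
    fix \<gamma> assume \<gamma>: "\<gamma> \<in> supp f"
    have "pmul ?e (sgl \<gamma> 1) = (\<Sum>w\<in>verts Q. pm (w, []) \<gamma>)"
      by (simp add: pmul_sum pmul_single)
    also have "\<dots> = (\<Sum>w\<in>verts Q. if w = ptgt Q \<gamma> then sgl \<gamma> 1 else 0)"
      by (intro sum.cong) (auto simp: pm_def pcomp_def)
    finally show "sgl \<gamma> 1 \<in> {f. pmul ?e f = f}" using v[OF \<gamma>] by simp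
  qed
  then show "pmul ?e f = f" by blast
  have "f \<in> {f. pmul f ?e = f}"
  proof (rule in_subspace_keys[OF S(2)])
    fix \<gamma> assume \<gamma>: "\<gamma> \<in> supp f"
    have "pmul (sgl \<gamma> 1) ?e = (\<Sum>w\<in>verts Q. pm \<gamma> (w, []))"
      by (simp add: pmul_sum pmul_single)
    also have "\<dots> = (\<Sum>w\<in>verts Q. if w = psrc \<gamma> then sgl \<gamma> 1 else 0)"
      by (intro sum.cong) (auto simp: pm_def pcomp_def)
    finally show "sgl \<gamma> 1 \<in> {f. pmul f ?e = f}" using v[OF \<gamma>] by simp
  qed
  then show "pmul f ?e = f" by blast
qed

lemma vectorspace_KQ: "vectorspace class_ring KQ"
  by (rule vectorspace_type_level) (simp_all add: KQ_simps subspace_keys)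

lemma one_keys: "supp (\<Sum>v\<in>verts Q. sgl (v, []) (1::'k)) \<subseteq> P"
proof -
  have "(\<Sum>v\<in>verts Q. sgl (v, []) (1::'k)) \<in> {f. supp f \<subseteq> P}"
    by (rule fv.subspace_sum[OF subspace_keys]) simp
  then show ?thesis by simp
qed

lemma ring_KQ: "ring KQ"
proof (rule ringI)
  interpret vectorspace class_ring KQ by (rule vectorspace_KQ)
  show "abelian_group KQ" by (rule M.abelian_group_axioms)
  show "monoid KQ"
    by (rule monoidI) (simp_all add: KQ_simps pmul_keys pmul_assoc pmul_one one_keys)
qed (simp_all add: KQ_simps pmul_add)


definition J :: "(('v, 'e) qpath \<Rightarrow>\<^sub>0 'k) set" where
  "J = {f. supp f \<subseteq> P - B}"

lemma J_subspace: "fv.subspace J"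
  unfolding J_def by (rule subspace_keys)

lemma pm_J: "\<lbrakk>\<alpha> \<in> P; \<beta> \<in> P; \<alpha> \<notin> B \<or> \<beta> \<notin> B\<rbrakk> \<Longrightarrow> pm \<alpha> \<beta> \<in> J"
  using pcomp_path[of \<alpha> \<beta>] bad_append by (auto simp: pm_def J_def B_iff)

lemma pmul_J:
  assumes "f \<in> J" "supp g \<subseteq> P"
  shows "pmul f g \<in> J" "pmul g f \<in> J"
proof -
  have f: "\<alpha> \<in> P" "\<alpha> \<notin> B" if "\<alpha> \<in> supp f" for \<alpha>
    using that assms(1) by (auto simp: J_def)
  have g: "\<beta> \<in> P" if "\<beta> \<in> supp g" for \<beta> using that assms(2) by auto
  show "pmul f g \<in> J" "pmul g f \<in> J"
    unfolding pmul_def by (intro lin_ext_in[OF J_subspace] pm_J; simp add: f g)+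
qed

lemma ideal_J: "ideal J KQ"
proof (rule idealI[OF ring_KQ])
  interpret vectorspace class_ring KQ by (rule vectorspace_KQ)
  show "subgroup J (add_monoid KQ)"
  proof (rule group.subgroupI[OF M.a_group])
    show "J \<noteq> {}" using fv.subspace_0[OF J_subspace] by auto
    show "inv\<^bsub>add_monoid KQ\<^esub> f \<in> J" if "f \<in> J" for f
    proof -
      have "f \<in> carrier KQ" using that by (auto simp: KQ_simps J_def)
      then have "\<ominus>\<^bsub>KQ\<^esub> f + f = 0" using M.l_neg[of f] by (simp add: KQ_simps)
      then have "\<ominus>\<^bsub>KQ\<^esub> f = - f" by (metis add_eq_0_iff2)
      then show ?thesis using fv.subspace_neg[OF J_subspace that] by (simp add: a_inv_def)
    qed
  qed (use fv.subspace_add[OF J_subspace] in \<open>auto simp: KQ_simps J_def\<close>)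
qed (use pmul_J in \<open>auto simp: KQ_simps\<close>)

text \<open>A path that contains some \<zeta> in Z is a product with \<zeta> in the middle, hence
  lies in every ideal containing Z. Conversely, the span of these paths is already an ideal.\<close>

lemma genideal_eq: "genideal KQ ((\<lambda>\<zeta>. sgl \<zeta> 1) ` Z) = J"
proof
  have "\<zeta> \<in> P - B" if "\<zeta> \<in> Z" for \<zeta>
  proof -
    have "bad (snd \<zeta>)" unfolding bad_def using that by (intro bexI[of _ \<zeta>] exI[of _ "[]"]) auto
    then show ?thesis using that Z_props(1) by (auto simp: B_iff)
  qed
  then have "(\<lambda>\<zeta>. sgl \<zeta> 1) ` Z \<subseteq> J" by (auto simp: J_def)
  then show "genideal KQ ((\<lambda>\<zeta>. sgl \<zeta> 1) ` Z) \<subseteq> J"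
    unfolding genideal_def using ideal_J by blast
  show "J \<subseteq> genideal KQ ((\<lambda>\<zeta>. sgl \<zeta> 1) ` Z)"
    unfolding genideal_def
  proof (intro subsetI InterI, elim CollectE conjE)
    fix f I assume f: "f \<in> J" and I: "ideal I KQ" and Z_I: "(\<lambda>\<zeta>. sgl \<zeta> 1) ` Z \<subseteq> I"
    interpret I: ideal I KQ by (rule I)
    have mult: "pmul g h \<in> I" "pmul h g \<in> I" if "h \<in> I" "supp g \<subseteq> P" for g h
      using I.I_l_closed[OF that(1)] I.I_r_closed[OF that(1)] that(2) by (auto simp: KQ_simps)
    have I_keys: "supp g \<subseteq> P" if "g \<in> I" for g
      using I.a_subset that by (auto simp: KQ_simps)
    have "fv.subspace I"
    proof (rule fv.subspaceI)
      show "0 \<in> I" using additive_subgroup.zero_closed[OF ideal.axioms(1)[OF I]] by (simp add: KQ_simps)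
      show "g + h \<in> I" if "g \<in> I" "h \<in> I" for g h
        using additive_subgroup.a_closed[OF ideal.axioms(1)[OF I] that] by (simp add: KQ_simps)
      \<comment> \<open>An ideal of a ring is not assumed to be closed under scalars; here scaling
        is multiplication by c times the identity.\<close>
      show "sc c g \<in> I" if "g \<in> I" for c g
        using mult(1)[OF that keys_sc_sub[OF one_keys], of c] pmul_one(1)[OF I_keys[OF that]]
        by (simp add: pmul_sc)
    qed
    then show "f \<in> I"
    proof (rule in_subspace_keys)
      fix \<gamma> assume "\<gamma> \<in> supp f"
      then have "\<gamma> \<in> P" "bad (snd \<gamma>)" using f by (auto simp: J_def B_iff)
      then obtain \<zeta> xs ys where \<zeta>: "\<zeta> \<in> Z" "snd \<gamma> = xs @ snd \<zeta> @ ys" unfolding bad_def by blast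
      have \<gamma>: "\<gamma> = (psrc \<gamma>, xs @ snd \<zeta> @ ys)" using \<zeta>(2) by (cases \<gamma>) simp
      have "(psrc \<gamma>, xs @ snd \<zeta> @ ys) \<in> P" using \<open>\<gamma> \<in> P\<close> \<gamma> by simp
      then have p: "(psrc \<gamma>, xs) \<in> P" "(ptgt Q (psrc \<gamma>, xs), snd \<zeta>) \<in> P"
        "(ptgt Q (ptgt Q (psrc \<gamma>, xs), snd \<zeta>), ys) \<in> P" by auto
      have "psrc \<zeta> = ptgt Q (psrc \<gamma>, xs)"
        using path_source[OF p(2)] path_source[of "psrc \<zeta>" "snd \<zeta>"] Z_ne[OF \<zeta>(1)] Z_props(1) \<zeta>(1) by auto
      then have z: "\<zeta> = (ptgt Q (psrc \<gamma>, xs), snd \<zeta>)" by (cases \<zeta>) simp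
      have "sgl \<zeta> 1 \<in> I" using Z_I \<zeta>(1) by blast
      then have "pmul (sgl (ptgt Q \<zeta>, ys) 1)
          (pmul (sgl \<zeta> 1) (sgl (psrc \<gamma>, xs) 1)) \<in> I"
        by (intro mult) (use p z in auto)
      also have "pmul (sgl (ptgt Q \<zeta>, ys) 1)
          (pmul (sgl \<zeta> 1) (sgl (psrc \<gamma>, xs) (1::'k))) = sgl \<gamma> 1"
        using z \<gamma> by (metis (no_types, lifting) append.assoc fst_conv fv.scale_one mult_1 pcomp_def
            pm_def pmul_single ptgt_append snd_conv)
      finally show "sgl \<gamma> 1 \<in> I" .
    qed
  qed
qed

section \<open>The monomial algebra and its normal forms\<close>

abbreviation Aalg :: "('k, (('v, 'e) qpath \<Rightarrow>\<^sub>0 'k) set) module" where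
  "Aalg \<equiv> monomial_algebra Q Z"

lemma Aalg_eq: "Aalg = quot_module KQ J"
  by (simp add: monomial_algebra_def genideal_eq)

sublocale QA: quotient_space KQ J
  unfolding quotient_space_def
  by (rule conjI[OF vectorspace_KQ], unfold_locales)
    (use fv.subspace_0[OF J_subspace] fv.subspace_add[OF J_subspace] fv.subspace_scale[OF J_subspace]
      in \<open>auto simp: KQ_simps J_def\<close>)

definition cl :: "(('v, 'e) qpath \<Rightarrow>\<^sub>0 'k) \<Rightarrow> (('v, 'e) qpath \<Rightarrow>\<^sub>0 'k) set" where
  "cl f = J +>\<^bsub>KQ\<^esub> f"

lemma cl_add: "\<lbrakk>supp f \<subseteq> P; supp g \<subseteq> P\<rbrakk> \<Longrightarrow> cl (f + g) = cl f \<oplus>\<^bsub>Aalg\<^esub> cl g"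
  using QA.add_quot[of f g] by (simp add: cl_def Aalg_eq KQ_simps)

lemma cl_sc: "supp f \<subseteq> P \<Longrightarrow> cl (sc c f) = c \<odot>\<^bsub>Aalg\<^esub> cl f"
  using QA.smult_quot[of f c] by (simp add: cl_def Aalg_eq KQ_simps)

lemma cl_zero: "cl 0 = \<zero>\<^bsub>Aalg\<^esub>"
  using QA.coset_zero by (simp add: cl_def Aalg_eq QA.zero_quot KQ_simps)

lemma carrier_Aalg: "carrier Aalg = cl ` {f. supp f \<subseteq> P}"
  by (simp add: Aalg_eq QA.carrier_quot KQ_simps cl_def[abs_def])

lemma cl_mult: "\<lbrakk>supp f \<subseteq> P; supp g \<subseteq> P\<rbrakk> \<Longrightarrow> cl f \<otimes>\<^bsub>Aalg\<^esub> cl g = cl (pmul f g)"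
  using ideal.rcoset_mult_add[OF ideal_J, of f g]
  by (simp add: cl_def Aalg_eq KQ_simps quot_module_def ring.defs module.defs FactRing_def)

lemma cl_one: "\<one>\<^bsub>Aalg\<^esub> = cl (\<Sum>v\<in>verts Q. sgl (v, []) 1)"
  by (simp add: cl_def Aalg_eq KQ_simps quot_module_def ring.defs module.defs FactRing_def)

lemma cl_in: "supp f \<subseteq> P \<Longrightarrow> cl f \<in> carrier Aalg"
  by (auto simp: carrier_Aalg)

lemma k_algebra_Aalg: "k_algebra Aalg"
  unfolding k_algebra_def
proof
  show "vectorspace class_ring Aalg" unfolding Aalg_eq by (rule QA.vectorspace_quot)
  show "k_algebra_axioms Aalg"
    by (unfold_locales; (unfold carrier_Aalg cl_one)?; (elim imageE CollectE; hypsubst)?)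
      (auto simp: cl_mult pmul_keys pmul_assoc pmul_one one_keys pmul_add pmul_sc keys_plus keys_sc_sub
        simp flip: cl_add cl_sc)
qed


sublocale alg: k_algebra Aalg by (rule k_algebra_Aalg)

lemma cl_eq:
  assumes "supp f \<subseteq> P" "supp g \<subseteq> P"
  shows "cl f = cl g \<longleftrightarrow> f - g \<in> J"
proof -
  have "f \<ominus>\<^bsub>KQ\<^esub> g = f - g"
    by (rule a_minus_type_level[OF vectorspace_KQ]) (use assms in \<open>auto simp: KQ_simps\<close>)
  then show ?thesis using QA.coset_eq_iff[of f g] assms by (simp add: cl_def KQ_simps)
qed

definition pb :: "('v, 'e) qpath \<Rightarrow> (('v, 'e) qpath \<Rightarrow>\<^sub>0 'k) set" where
  "pb \<gamma> = cl (sgl \<gamma> 1)"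

lemma pb_in: "\<gamma> \<in> P \<Longrightarrow> pb \<gamma> \<in> carrier Aalg"
  by (simp add: pb_def cl_in)

lemma pb_zero: "\<lbrakk>\<gamma> \<in> P; \<gamma> \<notin> B\<rbrakk> \<Longrightarrow> pb \<gamma> = \<zero>\<^bsub>Aalg\<^esub>"
  using cl_eq[of "sgl \<gamma> 1" 0] by (simp add: pb_def J_def flip: cl_zero)

lemma pb_mult: "\<lbrakk>\<alpha> \<in> P; \<beta> \<in> P\<rbrakk> \<Longrightarrow>
    pb \<alpha> \<otimes>\<^bsub>Aalg\<^esub> pb \<beta> = (if ptgt Q \<beta> = psrc \<alpha> then pb (pcomp \<alpha> \<beta>) else \<zero>\<^bsub>Aalg\<^esub>)"
  by (simp add: pb_def cl_mult pmul_single pm_def cl_zero)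

lemma zero_mult: "x \<in> carrier Aalg \<Longrightarrow> \<zero>\<^bsub>Aalg\<^esub> \<otimes>\<^bsub>Aalg\<^esub> x = \<zero>\<^bsub>Aalg\<^esub>"
  "x \<in> carrier Aalg \<Longrightarrow> x \<otimes>\<^bsub>Aalg\<^esub> \<zero>\<^bsub>Aalg\<^esub> = \<zero>\<^bsub>Aalg\<^esub>"
  by (auto simp: carrier_Aalg cl_mult simp flip: cl_zero)

definition rho :: "(('v, 'e) qpath \<Rightarrow>\<^sub>0 'k) \<Rightarrow> (('v, 'e) qpath \<Rightarrow>\<^sub>0 'k)" where
  "rho = lin_ext (\<lambda>\<gamma>. if \<gamma> \<in> B then sgl \<gamma> 1 else 0)"

lemma lookup_rho: "coef (rho f) \<gamma> = (if \<gamma> \<in> B then coef f \<gamma> else 0)"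
proof -
  have "coef (rho f) \<gamma> =
      (\<Sum>x\<in>supp f. if x = \<gamma> then (if \<gamma> \<in> B then coef f \<gamma> else 0) else 0)"
    unfolding rho_def lin_ext_def lookup_sum
    by (rule sum.cong) (auto simp: lookup_single when_def)
  then show ?thesis by (auto simp: in_keys_iff)
qed

lemma rho_keys: "supp (rho f) \<subseteq> B"
  by (auto simp: in_keys_iff lookup_rho split: if_splits)

lemma rho_J: "f \<in> J \<Longrightarrow> rho f = 0"
  by (rule poly_mapping_eqI) (auto simp: lookup_rho J_def in_keys_iff)

lemma rho_id: "supp f \<subseteq> B \<Longrightarrow> rho f = f"
  by (rule poly_mapping_eqI) (auto simp: lookup_rho in_keys_iff)

lemma B_P: "B \<subseteq> P"
  by (auto simp: nonzero_paths_def)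

text \<open>Coordinates with respect to the basis \<open>B\<close>. The chosen representative does
  not matter because \<open>rho\<close> kills \<open>J\<close>.\<close>

definition nf :: "(('v, 'e) qpath \<Rightarrow>\<^sub>0 'k) set \<Rightarrow> (('v, 'e) qpath \<Rightarrow>\<^sub>0 'k)" where
  "nf X = rho (SOME f. f \<in> X)"

lemma nf_cl: "supp f \<subseteq> P \<Longrightarrow> nf (cl f) = rho f"
proof -
  assume "supp f \<subseteq> P"
  then have "f \<in> cl f" using QA.US.a_rcos_self[of f] by (simp add: cl_def KQ_simps)
  then have "(SOME g. g \<in> cl f) \<in> cl f" by (rule someI[of "\<lambda>g. g \<in> cl f"])
  then have "(SOME g. g \<in> cl f) - f \<in> J" by (auto simp: cl_def a_r_coset_def r_coset_def KQ_simps)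
  from rho_J[OF this] show ?thesis by (simp add: nf_def rho_def lin_ext_diff)
qed

lemma cl_nf: "x \<in> carrier Aalg \<Longrightarrow> cl (nf x) = x"
proof -
  assume "x \<in> carrier Aalg"
  then obtain f where f: "supp f \<subseteq> P" "x = cl f" by (auto simp: carrier_Aalg)
  have "supp (rho f - f) \<subseteq> P - B"
    using f(1) by (auto simp: in_keys_iff lookup_minus lookup_rho split: if_splits)
  then show ?thesis
    using cl_eq[of "rho f" f] rho_keys[of f] B_P f by (auto simp: nf_cl J_def)
qed

lemma nf_add: "\<lbrakk>x \<in> carrier Aalg; y \<in> carrier Aalg\<rbrakk> \<Longrightarrow> nf (x \<oplus>\<^bsub>Aalg\<^esub> y) = nf x + nf y"
  by (auto simp: carrier_Aalg nf_cl keys_plus rho_def lin_ext_add simp flip: cl_add)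

lemma nf_sc: "x \<in> carrier Aalg \<Longrightarrow> nf (c \<odot>\<^bsub>Aalg\<^esub> x) = sc c (nf x)"
  by (auto simp: carrier_Aalg nf_cl keys_sc_sub rho_def lin_ext_sc simp flip: cl_sc)

lemma nf_pb: "\<gamma> \<in> B \<Longrightarrow> nf (pb \<gamma>) = sgl \<gamma> 1"
  using B_P by (auto simp: pb_def nf_cl rho_id)

lemma nf_zero: "nf \<zero>\<^bsub>Aalg\<^esub> = 0"
  by (simp add: nf_cl rho_def flip: cl_zero)

lemma Aalg_induct [consumes 1, case_names zero add smult pb]:
  assumes x: "x \<in> carrier Aalg" and zero: "R \<zero>\<^bsub>Aalg\<^esub>"
    and add: "\<And>x y. \<lbrakk>x \<in> carrier Aalg; y \<in> carrier Aalg; R x; R y\<rbrakk> \<Longrightarrow> R (x \<oplus>\<^bsub>Aalg\<^esub> y)"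
    and smult: "\<And>c x. \<lbrakk>x \<in> carrier Aalg; R x\<rbrakk> \<Longrightarrow> R (c \<odot>\<^bsub>Aalg\<^esub> x)"
    and pb: "\<And>\<gamma>. \<gamma> \<in> B \<Longrightarrow> R (pb \<gamma>)"
  shows "R x"
proof -
  let ?S = "{f. supp f \<subseteq> P \<and> R (cl f)}"
  have "fv.subspace ?S"
    by (rule fv.subspaceI) (auto simp: keys_plus keys_sc_sub cl_add cl_sc cl_zero zero intro!: add smult cl_in)
  moreover have "sgl \<gamma> 1 \<in> ?S" if "\<gamma> \<in> supp (nf x)" for \<gamma>
    using that rho_keys pb B_P by (fastforce simp: nf_def pb_def)
  ultimately have "nf x \<in> ?S" by (rule in_subspace_keys)
  then show ?thesis using cl_nf[OF x] by simp
qed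

lemma pb_B: "\<gamma> \<in> B \<Longrightarrow> pb \<gamma> \<in> carrier Aalg"
  using B_P pb_in by blast

text \<open>The normal forms of a finite spanning set involve finitely many paths, and these carry
  the normal forms of all elements. The normal form of the class of a nonzero path is that
  path.\<close>

lemma finite_B:
  assumes "vectorspace.fin_dim class_ring Aalg"
  shows "finite B"
proof -
  obtain S where S: "finite S" "S \<subseteq> carrier Aalg" "carrier Aalg = alg.span S"
    using assms by (auto simp: alg.fin_dim_def)
  let ?K = "\<Union>s\<in>S. supp (nf s)"
  have "supp (nf x) \<subseteq> ?K" if x: "x \<in> carrier Aalg" for x
  proof -
    obtain a T where T: "finite T" "T \<subseteq> S" "x = alg.lincomb a T"
      using x S(3) by (auto simp: alg.span_def)
    have "alg.lincomb a T \<in> carrier Aalg \<and> supp (nf (alg.lincomb a T)) \<subseteq> ?K"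
      unfolding alg.lincomb_def using T(1,2)
    proof (induction T rule: finite_induct)
      case empty
      then show ?case by (simp add: nf_zero)
    next
      case (insert t T)
      have t: "t \<in> carrier Aalg" "a t \<odot>\<^bsub>Aalg\<^esub> t \<in> carrier Aalg"
        using insert.prems S(2) by (auto intro!: alg.smult_in)
      have "(\<Oplus>\<^bsub>Aalg\<^esub>v\<in>insert t T. a v \<odot>\<^bsub>Aalg\<^esub> v) =
          a t \<odot>\<^bsub>Aalg\<^esub> t \<oplus>\<^bsub>Aalg\<^esub> (\<Oplus>\<^bsub>Aalg\<^esub>v\<in>T. a v \<odot>\<^bsub>Aalg\<^esub> v)"
        by (rule alg.M.finsum_insert) (use insert t S(2) in \<open>auto intro!: alg.smult_in\<close>)
      moreover have "supp (sc (a t) (nf t)) \<subseteq> ?K"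
        by (rule keys_sc_sub) (use insert.prems in blast)
      ultimately show ?case
        using insert t by (simp add: nf_add nf_sc keys_plus)
    qed
    then show ?thesis using T(3) by simp
  qed
  note K = this
  have "B \<subseteq> ?K"
  proof
    fix \<gamma> assume "\<gamma> \<in> B"
    then show "\<gamma> \<in> ?K" using K[OF pb_in, of \<gamma>] B_P nf_pb[of \<gamma>] by auto
  qed
  moreover have "finite ?K" using S(1) by simp
  ultimately show ?thesis by (rule finite_subset)
qed

section \<open>Multilinear statements tested on nonzero paths\<close>

definition bil :: "(('v, 'e) qpath \<Rightarrow> ('v, 'e) qpath \<Rightarrow> ('w \<Rightarrow>\<^sub>0 'k)) \<Rightarrow>
    (('v, 'e) qpath \<Rightarrow>\<^sub>0 'k) set \<Rightarrow> (('v, 'e) qpath \<Rightarrow>\<^sub>0 'k) set \<Rightarrow> ('w \<Rightarrow>\<^sub>0 'k)" where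
  "bil F a x = lin_ext (\<lambda>\<alpha>. lin_ext (F \<alpha>) (nf x)) (nf a)"

lemma bil_linear:
  "\<lbrakk>a \<in> carrier Aalg; b \<in> carrier Aalg\<rbrakk> \<Longrightarrow> bil F (a \<oplus>\<^bsub>Aalg\<^esub> b) x = bil F a x + bil F b x"
  "a \<in> carrier Aalg \<Longrightarrow> bil F (c \<odot>\<^bsub>Aalg\<^esub> a) x = sc c (bil F a x)"
  "\<lbrakk>x \<in> carrier Aalg; y \<in> carrier Aalg\<rbrakk> \<Longrightarrow> bil F a (x \<oplus>\<^bsub>Aalg\<^esub> y) = bil F a x + bil F a y"
  "x \<in> carrier Aalg \<Longrightarrow> bil F a (c \<odot>\<^bsub>Aalg\<^esub> x) = sc c (bil F a x)"
  "bil F \<zero>\<^bsub>Aalg\<^esub> x = 0" "bil F a \<zero>\<^bsub>Aalg\<^esub> = 0"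
  by (simp_all add: bil_def nf_add nf_sc nf_zero lin_ext_add lin_ext_sc lin_ext_fun_add lin_ext_fun_sc)

lemma bil_pb:
  assumes "\<alpha> \<in> P" "\<beta> \<in> P"
  shows "bil F (pb \<alpha>) (pb \<beta>) = (if \<alpha> \<in> B \<and> \<beta> \<in> B then F \<alpha> \<beta> else 0)"
  using assms by (auto simp: pb_zero bil_linear) (auto simp: bil_def nf_pb)

text \<open>The left side of Leibniz's rule is trilinear although products occur inside the
  arguments, so it suffices to test basis elements, in one argument after the other.\<close>

lemma bil_rel:
  assumes I: "fv.subspace I"
    and rel: "\<And>\<alpha> \<beta> \<gamma>. \<lbrakk>\<alpha> \<in> B; \<beta> \<in> B; \<gamma> \<in> B\<rbrakk> \<Longrightarrow>
      bil F (pb \<alpha> \<otimes>\<^bsub>Aalg\<^esub> pb \<beta>) (pb \<gamma>) - bil F (pb \<alpha>) (pb \<beta> \<otimes>\<^bsub>Aalg\<^esub> pb \<gamma>)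
        + bil F (pb \<gamma> \<otimes>\<^bsub>Aalg\<^esub> pb \<alpha>) (pb \<beta>) \<in> I"
    and mem: "a \<in> carrier Aalg" "x \<in> carrier Aalg" "y \<in> carrier Aalg"
  shows "bil F (a \<otimes>\<^bsub>Aalg\<^esub> x) y - bil F a (x \<otimes>\<^bsub>Aalg\<^esub> y) + bil F (y \<otimes>\<^bsub>Aalg\<^esub> a) x \<in> I"
proof -
  define T where "T a x y = bil F (a \<otimes>\<^bsub>Aalg\<^esub> x) y - bil F a (x \<otimes>\<^bsub>Aalg\<^esub> y) + bil F (y \<otimes>\<^bsub>Aalg\<^esub> a) x"
    for a x y
  note I0 = fv.subspace_0[OF I] and Ia = fv.subspace_add[OF I] and Is = fv.subspace_scale[OF I]
  have lin_add: "T (a \<oplus>\<^bsub>Aalg\<^esub> b) x y = T a x y + T b x y"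
    "T x (a \<oplus>\<^bsub>Aalg\<^esub> b) y = T x a y + T x b y"
    "T x y (a \<oplus>\<^bsub>Aalg\<^esub> b) = T x y a + T x y b"
    if "a \<in> carrier Aalg" "b \<in> carrier Aalg" "x \<in> carrier Aalg" "y \<in> carrier Aalg" for a b x y
    using that by (simp_all add: T_def alg.alg_simps bil_linear)
  have lin_smult: "T (c \<odot>\<^bsub>Aalg\<^esub> a) x y = sc c (T a x y)" "T x (c \<odot>\<^bsub>Aalg\<^esub> a) y = sc c (T x a y)"
    "T x y (c \<odot>\<^bsub>Aalg\<^esub> a) = sc c (T x y a)"
    if "a \<in> carrier Aalg" "x \<in> carrier Aalg" "y \<in> carrier Aalg" for a c x y
    using that by (simp_all add: T_def alg.alg_simps bil_linear fv.scale_right_distrib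
        fv.scale_right_diff_distrib)
  have lin_zero: "T \<zero>\<^bsub>Aalg\<^esub> x y = 0" "T x \<zero>\<^bsub>Aalg\<^esub> y = 0" "T x y \<zero>\<^bsub>Aalg\<^esub> = 0"
    if "x \<in> carrier Aalg" "y \<in> carrier Aalg" for x y
    using that by (simp_all add: T_def bil_linear zero_mult)
  note lin = lin_add lin_smult lin_zero
  have 1: "T (pb \<alpha>) (pb \<beta>) y \<in> I" if \<alpha>: "\<alpha> \<in> B" "\<beta> \<in> B" and y: "y \<in> carrier Aalg" for \<alpha> \<beta> y
    using y by (induction rule: Aalg_induct) (use rel[OF \<alpha>] in \<open>simp_all add: lin \<alpha> pb_B I0 Ia Is T_def[of "pb _" "pb _" "pb _"]\<close>)
  have 2: "T (pb \<alpha>) x y \<in> I" if \<alpha>: "\<alpha> \<in> B" and x: "x \<in> carrier Aalg" and y: "y \<in> carrier Aalg" for \<alpha> x y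
    using x by (induction rule: Aalg_induct) (simp_all add: lin y 1 I0 Ia Is pb_B \<alpha>)
  have "T a x y \<in> I"
    using mem(1) by (induction rule: Aalg_induct) (simp_all add: mem lin 2 I0 Ia Is)
  then show ?thesis by (simp add: T_def)
qed

lemma tau_in:
  assumes U: "fv.subspace U" "alg.Nn 1 \<subseteq> U"
    and pb: "\<And>\<alpha> \<beta>. \<lbrakk>\<alpha> \<in> B; \<beta> \<in> B\<rbrakk> \<Longrightarrow> alg.tau 1 (pb \<alpha>) [pb \<beta>] \<in> U"
    and mem: "a \<in> carrier Aalg" "x \<in> carrier Aalg"
  shows "alg.tau 1 a [x] \<in> U"
proof -
  have Ud: "f \<in> U" if "f - g - h \<in> alg.Nn 1" "g \<in> U" "h \<in> U" for f g h
    using fv.subspace_add[OF U(1) fv.subspace_add[OF U(1) subsetD[OF U(2) that(1)] that(2)] that(3)]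
    by simp
  have Us: "f \<in> U" if "f - sc c g \<in> alg.Nn 1" "g \<in> U" for f g c
    using mod_in[OF U(1) subsetD[OF U(2) that(1)] fv.subspace_scale[OF U(1) that(2)]] .
  \<comment> \<open>Zero is written as a scalar multiple so that homogeneity of \<open>tau\<close>
    shows that a chain with a zero entry is null.\<close>
  have z: "\<zero>\<^bsub>Aalg\<^esub> = 0 \<odot>\<^bsub>Aalg\<^esub> \<zero>\<^bsub>Aalg\<^esub>"
    using cl_sc[of 0 0] by (simp add: cl_zero)
  have tau0: "f \<in> U" if "f - sc 0 g \<in> alg.Nn 1" for f g
    using that U(2) by auto
  have 1: "alg.tau 1 (pb \<alpha>) [x] \<in> U" if \<alpha>: "\<alpha> \<in> B" and x: "x \<in> carrier Aalg" for \<alpha> x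
    using x
  proof (induction rule: Aalg_induct)
    case zero
    show ?case by (rule tau0, subst z, rule alg.tau_smult_right) (use \<alpha> pb_B in simp_all)
  next
    case (add x y)
    then show ?case using pb_B[OF \<alpha>] by (intro Ud[OF alg.tau_add_right]) auto
  next
    case (smult c x)
    then show ?case using pb_B[OF \<alpha>] by (intro Us[OF alg.tau_smult_right]) auto
  qed (use pb \<alpha> in blast)
  show ?thesis
    using mem(1)
  proof (induction rule: Aalg_induct)
    case zero
    show ?case by (rule tau0, subst z, rule alg.tau_smult_left) (use mem in auto)
  next
    case (add x y)
    then show ?case using mem by (intro Ud[OF alg.tau_add_left]) auto
  next
    case (smult c x)
    then show ?case using mem by (intro Us[OF alg.tau_smult_left]) auto
  qed (use 1 mem in blast)
qed

end


section \<open>Circuits\<close>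

context monomial_quiver
begin

definition NC :: "('v, 'e) qpath set" where
  "NC = {\<gamma> \<in> cycles Q. snd \<gamma> \<noteq> []}"

definition rot :: "('v, 'e) qpath \<Rightarrow> ('v, 'e) qpath" where
  "rot \<gamma> = (head Q (hd (snd \<gamma>)), rotate1 (snd \<gamma>))"

lemma NC_iff: "(u, p) \<in> NC \<longleftrightarrow> (u, p) \<in> P \<and> p \<noteq> [] \<and> ptgt Q (u, p) = u"
  by (auto simp: NC_def cycles_def)

lemma NC_path: "\<gamma> \<in> NC \<Longrightarrow> \<gamma> \<in> P"
  by (cases \<gamma>) (simp add: NC_iff)

lemma rot_NC: "\<gamma> \<in> NC \<Longrightarrow> rot \<gamma> \<in> NC"
proof -
  assume "\<gamma> \<in> NC"
  moreover obtain u p where "\<gamma> = (u, p)" by force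
  moreover obtain a q where "p = a # q" using calculation by (cases p) (auto simp: NC_iff)
  ultimately show ?thesis by (auto simp: NC_iff rot_def)
qed

lemma snd_rot [simp]: "snd (rot \<gamma>) = rotate1 (snd \<gamma>)"
  by (simp add: rot_def)

lemma rots_NC: "\<gamma> \<in> NC \<Longrightarrow> (rot ^^ i) \<gamma> \<in> NC"
  by (induction i) (auto simp: rot_NC)

lemma snd_rots [simp]: "snd ((rot ^^ i) \<gamma>) = rotate i (snd \<gamma>)"
  by (induction i) (auto simp: rotate_def)

text \<open>The source of a nontrivial cycle is the tail of its first arrow, so rotations of cycles
  can be compared as rotations of lists.\<close>

lemma NC_eqI: "\<lbrakk>\<gamma> \<in> NC; \<delta> \<in> NC; snd \<gamma> = snd \<delta>\<rbrakk> \<Longrightarrow> \<gamma> = \<delta>"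
  using path_source by (cases \<gamma>; cases \<delta>) (auto simp: NC_iff)

lemma rots_length: "\<gamma> \<in> NC \<Longrightarrow> (rot ^^ plength \<gamma>) \<gamma> = \<gamma>"
  by (rule NC_eqI) (auto simp: rots_NC)

lemma rots_split:
  assumes "(u, p @ q) \<in> NC" shows "(rot ^^ length p) (u, p @ q) = (ptgt Q (u, p), q @ p)"
proof (rule NC_eqI[OF rots_NC[OF assms]])
  show "(ptgt Q (u, p), q @ p) \<in> NC" using assms by (auto simp: NC_iff)
qed (simp add: rotate_append)

lemma rotation_iff: "(\<gamma>, \<delta>) \<in> rotation Q \<longleftrightarrow> \<gamma> \<in> NC \<and> \<delta> = rot \<gamma>"
proof -
  obtain u p where "\<gamma> = (u, p)" by force
  then show ?thesis by (cases p) (auto simp: rotation_def NC_def rot_def)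
qed

definition cir :: "('v, 'e) qpath \<Rightarrow> ('v, 'e) qpath set" where
  "cir \<gamma> = (rotation Q \<union> (rotation Q)\<inverse>)\<^sup>* `` {\<gamma>}"

lemma circuits_eq: "circuits Q = cir ` cycles Q"
  by (auto simp: circuits_def quotient_def cir_def)

lemma self_cir: "\<gamma> \<in> cir \<gamma>"
  by (simp add: cir_def)

lemma cir_eq: "\<delta> \<in> cir \<gamma> \<Longrightarrow> cir \<delta> = cir \<gamma>"
proof -
  have "sym ((rotation Q \<union> (rotation Q)\<inverse>)\<^sup>*)"
    by (rule sym_rtrancl) (auto simp: sym_def)
  moreover assume "\<delta> \<in> cir \<gamma>"
  ultimately show ?thesis
    unfolding cir_def by (auto dest: symD intro: rtrancl_trans)
qed

text \<open>The equivalence is generated by rotations in both directions, but a backward step equals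
  a forward rotation repeated one time less than the length of the cycle.\<close>

lemma cir_NC: assumes "\<gamma> \<in> NC" shows "cir \<gamma> = {(rot ^^ i) \<gamma> | i. True}"
proof
  have "(rot ^^ i) \<gamma> \<in> cir \<gamma>" for i
  proof (induction i)
    case (Suc i)
    have "((rot ^^ i) \<gamma>, (rot ^^ Suc i) \<gamma>) \<in> rotation Q"
      using rots_NC[OF assms, of i] by (simp add: rotation_iff)
    with Suc show ?case unfolding cir_def by (auto intro: rtrancl_into_rtrancl)
  qed (simp add: self_cir)
  then show "{(rot ^^ i) \<gamma> | i. True} \<subseteq> cir \<gamma>" by blast
  show "cir \<gamma> \<subseteq> {(rot ^^ i) \<gamma> | i. True}"
  proof
    fix \<delta> assume "\<delta> \<in> cir \<gamma>"
    then have "(\<gamma>, \<delta>) \<in> (rotation Q \<union> (rotation Q)\<inverse>)\<^sup>*" by (simp add: cir_def)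
    then show "\<delta> \<in> {(rot ^^ i) \<gamma> | i. True}"
    proof (induction rule: rtrancl_induct)
      case base
      then show ?case by (auto intro: exI[of _ 0])
    next
      case (step \<delta> \<epsilon>)
      then obtain i where i: "\<delta> = (rot ^^ i) \<gamma>" by blast
      from step(2) show ?case
      proof
        assume "(\<delta>, \<epsilon>) \<in> rotation Q"
        then have "\<epsilon> = (rot ^^ Suc i) \<gamma>" by (simp add: rotation_iff i)
        then show ?case by blast
      next
        assume "(\<delta>, \<epsilon>) \<in> (rotation Q)\<inverse>"
        then have \<epsilon>: "\<epsilon> \<in> NC" "\<delta> = rot \<epsilon>" by (auto simp: rotation_iff)
        then have "plength \<epsilon> = Suc (plength \<epsilon> - 1)" by (cases \<epsilon>) (auto simp: NC_iff)
        then have "\<epsilon> = (rot ^^ (plength \<epsilon> - 1)) (rot \<epsilon>)"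
          using rots_length[OF \<epsilon>(1)] by (metis funpow_Suc_right o_apply)
        also have "\<dots> = (rot ^^ (plength \<epsilon> - 1 + i)) \<gamma>"
          using \<epsilon>(2) i by (simp add: funpow_add)
        finally show ?case by blast
      qed
    qed
  qed
qed

lemma cir_sub_NC: "\<gamma> \<in> NC \<Longrightarrow> cir \<gamma> \<subseteq> NC"
  unfolding cir_NC using rots_NC by blast

lemma cir_rot: "\<gamma> \<in> NC \<Longrightarrow> cir (rot \<gamma>) = cir \<gamma>"
  by (rule cir_eq, unfold cir_NC) (intro CollectI exI[of _ 1], simp)

lemma cir_Nil: "cir (u, []) = {(u, [])}"
proof -
  have "\<delta> = (u, [])" if "((u, []), \<delta>) \<in> (rotation Q \<union> (rotation Q)\<inverse>)\<^sup>*" for \<delta>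
    using that
  proof (induction rule: rtrancl_induct)
    case (step \<delta> \<epsilon>)
    then have "(\<delta> \<in> NC \<or> \<epsilon> \<in> NC \<and> \<delta> = rot \<epsilon>)" by (auto simp: rotation_iff)
    then have "snd \<delta> \<noteq> []" by (auto simp: NC_def)
    then show ?case using step(3) by simp
  qed simp
  then show ?thesis using self_cir by (auto simp: cir_def)
qed

text \<open>Indexes the terms \<beta> dc: the last arrow of the cycle is c, and what precedes it is
  the nonzero path \<beta>. The cycle c\<beta> itself may be zero.\<close>

definition Edg :: "('v, 'e) qpath set" where
  "Edg = {\<gamma> \<in> NC. \<not> bad (butlast (snd \<gamma>))}"

definition Wc :: "('v, 'e) qpath set" where
  "Wc = {\<gamma> \<in> Edg. bad (snd \<gamma>)}"

lemma bad_butlast: "bad (butlast p) \<Longrightarrow> bad p"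
  by (cases p rule: rev_cases) (auto dest: bad_append(2))

lemma good_Edg: "\<lbrakk>\<gamma> \<in> NC; \<not> bad (snd \<gamma>)\<rbrakk> \<Longrightarrow> \<gamma> \<in> Edg"
  using bad_butlast by (auto simp: Edg_def)

lemma good_rot_Edg: assumes "\<gamma> \<in> NC" "\<not> bad (snd \<gamma>)" shows "rot \<gamma> \<in> Edg"
proof -
  obtain u a p where "\<gamma> = (u, a # p)" using assms(1) by (cases \<gamma>; cases "snd \<gamma>") (auto simp: NC_iff)
  then show ?thesis using assms rot_NC[OF assms(1)] bad_append(1)[of p "[a]"] by (auto simp: Edg_def)
qed

text \<open>If dropping the last arrow leaves a nonzero path, every occurrence of a relation ends
  where the cycle ends. Of two such occurrences one is a subpath of the other, and minimality of Z
  makes them equal; this is the uniqueness demanded in W.\<close>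

lemma W_cycles_eq: "W_cycles Q Z = Wc"
proof (intro equalityI subsetI)
  fix \<gamma> assume "\<gamma> \<in> W_cycles Q Z"
  then obtain \<xi> \<alpha> where \<gamma>: "\<gamma> \<in> cycles Q" "\<xi> \<in> Z" "\<alpha> \<in> P" "\<gamma> = pcomp \<xi> \<alpha>"
    and uniq: "\<And>\<zeta> i. \<lbrakk>\<zeta> \<in> Z; occurs_at Q \<zeta> \<gamma> i\<rbrakk> \<Longrightarrow> \<zeta> = \<xi> \<and> i = plength \<alpha>"
    unfolding W_cycles_def by blast
  have p: "snd \<gamma> = snd \<alpha> @ snd \<xi>" using \<gamma>(4) by simp
  have NC: "\<gamma> \<in> NC" using \<gamma>(1) p Z_ne[OF \<gamma>(2)] by (simp add: NC_def)
  have "bad (snd \<gamma>)" unfolding bad_def p using \<gamma>(2) by (intro bexI[of _ \<xi>] exI[of _ "snd \<alpha>"] exI[of _ "[]"]) auto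
  moreover have "\<not> bad (butlast (snd \<gamma>))"
  proof
    assume "bad (butlast (snd \<gamma>))"
    then obtain \<zeta> xs ys where \<zeta>: "\<zeta> \<in> Z" "butlast (snd \<gamma>) = xs @ snd \<zeta> @ ys" unfolding bad_def by blast
    have "snd \<gamma> = butlast (snd \<gamma>) @ [last (snd \<gamma>)]" using NC by (simp add: NC_def)
    also have "\<dots> = xs @ snd \<zeta> @ (ys @ [last (snd \<gamma>)])" unfolding \<zeta>(2) by simp
    finally have "occurs_at Q \<zeta> \<gamma> (length xs)"
      unfolding occurs_at_iff[OF subsetD[OF Z_props(1) \<zeta>(1)] Z_ne[OF \<zeta>(1)] NC_path[OF NC]] by blast
    then have "\<zeta> = \<xi>" "length xs = plength \<alpha>" using uniq \<zeta>(1) by auto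
    \<comment> \<open>The occurrence would start right after \<alpha> and have the length of \<xi>,
      which does not fit once the last arrow is gone.\<close>
    moreover have "length (butlast (snd \<gamma>)) + 1 = plength \<alpha> + plength \<xi>"
      using p Z_ne[OF \<gamma>(2)] by (cases "snd \<xi>" rule: rev_cases) auto
    ultimately show False using \<zeta>(2) by simp
  qed
  ultimately show "\<gamma> \<in> Wc" using NC by (simp add: Wc_def Edg_def)
next
  fix \<gamma> assume "\<gamma> \<in> Wc"
  then have NC: "\<gamma> \<in> NC" and b: "\<not> bad (butlast (snd \<gamma>))" "bad (snd \<gamma>)" by (auto simp: Wc_def Edg_def)
  have end_only: "ys = []" if "\<zeta> \<in> Z" "snd \<gamma> = xs @ snd \<zeta> @ ys" for \<zeta> xs ys
  proof (rule ccontr)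
    assume "ys \<noteq> []"
    then have "butlast (snd \<gamma>) = xs @ snd \<zeta> @ butlast ys" using that(2) by (simp add: butlast_append)
    then show False using b(1) that(1) unfolding bad_def by blast
  qed
  obtain \<xi> xs ys where "\<xi> \<in> Z" "snd \<gamma> = xs @ snd \<xi> @ ys" using b(2) unfolding bad_def by blast
  then have \<xi>: "\<xi> \<in> Z" "snd \<gamma> = xs @ snd \<xi>" using end_only by auto
  have zP: "\<xi> \<in> P" using \<xi>(1) Z_props(1) by blast
  have "(psrc \<gamma>, xs @ snd \<xi>) \<in> P" using NC_path[OF NC] \<xi>(2) by (metis prod.collapse)
  then have \<alpha>: "(psrc \<gamma>, xs) \<in> P" "(ptgt Q (psrc \<gamma>, xs), snd \<xi>) \<in> P" by auto
  have t: "ptgt Q (psrc \<gamma>, xs) = psrc \<xi>"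
    using path_source[OF \<alpha>(2)] path_source[of "psrc \<xi>" "snd \<xi>"] Z_ne[OF \<xi>(1)] zP by simp
  have "\<zeta> = \<xi> \<and> i = length xs" if \<zeta>: "\<zeta> \<in> Z" "occurs_at Q \<zeta> \<gamma> i" for \<zeta> i
  proof -
    have zP': "\<zeta> \<in> P" using \<zeta>(1) Z_props(1) by blast
    obtain xs' ys' where 1: "snd \<gamma> = xs' @ snd \<zeta> @ ys'" "length xs' = i"
      using \<zeta> occurs_at_iff[OF zP' Z_ne[OF \<zeta>(1)] NC_path[OF NC]] by blast
    then have 2: "xs @ snd \<xi> = xs' @ snd \<zeta>" using \<xi>(2) end_only[OF \<zeta>(1) 1(1)] by simp
    have "\<zeta> = \<xi>"
    proof -
      from 2 consider us where "xs = xs' @ us" "us @ snd \<xi> = snd \<zeta>" | us where "xs @ us = xs'" "snd \<xi> = us @ snd \<zeta>"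
        by (auto simp: append_eq_append_conv2)
      then show ?thesis
      proof cases
        case 1
        then have "snd \<zeta> = us @ snd \<xi> @ []" by simp
        then have "is_subpath Q \<xi> \<zeta>" using is_subpath_iff[OF \<xi>(1) zP'] by blast
        then show ?thesis using Z_props(3)[OF \<zeta>(1) \<xi>(1)] by simp
      next
        case 2
        then have "snd \<xi> = us @ snd \<zeta> @ []" by simp
        then have "is_subpath Q \<zeta> \<xi>" using is_subpath_iff[OF \<zeta>(1) zP] by blast
        then show ?thesis using Z_props(3)[OF \<xi>(1) \<zeta>(1)] by simp
      qed
    qed
    then show ?thesis using 2 1(2) by simp
  qed
  moreover have "\<gamma> = pcomp \<xi> (psrc \<gamma>, xs)" using \<xi>(2) by (simp add: pcomp_def prod_eq_iff)
  moreover have "\<gamma> \<in> cycles Q" using NC by (simp add: NC_def)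
  ultimately show "\<gamma> \<in> W_cycles Q Z"
    unfolding W_cycles_def using \<xi>(1) \<alpha>(1) t
    by (intro CollectI conjI bexI[of _ \<xi>] bexI[of _ "(psrc \<gamma>, xs)"]) auto
qed

text \<open>Cutting off the last arrow turns a cycle of \<open>Edg\<close> into a pair of an arrow
  and a nonzero path; composing the pair gives the cycle back.\<close>

lemma useful_iff: "\<gamma> \<in> NC \<Longrightarrow> useful Q Z (cir \<gamma>) \<longleftrightarrow> cir \<gamma> \<inter> Edg \<noteq> {}"
proof
  assume NC: "\<gamma> \<in> NC" and "useful Q Z (cir \<gamma>)"
  then obtain a \<beta> where *: "a \<in> arcs Q" "\<beta> \<in> B" "pcomp (tail Q a, [a]) \<beta> \<in> cir \<gamma>"
    by (auto simp: useful_def odot_at_def odot_def arrow_paths_def)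
  then have "pcomp (tail Q a, [a]) \<beta> \<in> Edg"
    using cir_sub_NC[OF NC] by (auto simp: Edg_def B_iff pcomp_def)
  with * show "cir \<gamma> \<inter> Edg \<noteq> {}" by blast
next
  assume NC: "\<gamma> \<in> NC" and "cir \<gamma> \<inter> Edg \<noteq> {}"
  then obtain \<delta> where \<delta>: "\<delta> \<in> cir \<gamma>" "\<delta> \<in> Edg" by blast
  then have D: "\<delta> \<in> NC" by (simp add: Edg_def)
  obtain u q a where d: "\<delta> = (u, q @ [a])"
    using D by (cases \<delta>; cases "snd \<delta>" rule: rev_cases) (auto simp: NC_iff)
  have "((tail Q a, [a]), (u, q)) \<in> odot_at Q (arrow_paths Q) B (cir \<gamma>)"
    using D \<delta> by (auto simp: d odot_at_def odot_def arrow_paths_def NC_iff B_iff Edg_def pcomp_def)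
  then show "useful Q Z (cir \<gamma>)" by (auto simp: useful_def)
qed

lemma strong_iff: "\<gamma> \<in> NC \<Longrightarrow> strong Q Z (cir \<gamma>) \<longleftrightarrow> (\<forall>i. \<not> bad (rotate i (snd \<gamma>)))"
proof -
  assume NC: "\<gamma> \<in> NC"
  have "(rot ^^ i) \<gamma> \<in> B \<longleftrightarrow> \<not> bad (rotate i (snd \<gamma>))" for i
    using rots_NC[OF NC, of i] NC_path by (simp add: B_iff)
  then show ?thesis by (auto simp: strong_def cir_NC[OF NC])
qed

text \<open>The fibres of \<open>stop\<close> on \<open>Edg\<close> are the pieces of the circuits on which the coefficients of a
  one-cycle of the Hochschild complex have to be constant.\<close>

definition stop :: "('v, 'e) qpath \<Rightarrow> ('v, 'e) qpath" where
  "stop \<gamma> = (if \<exists>i. bad (rotate i (snd \<gamma>)) then (rot ^^ (LEAST i. bad (rotate i (snd \<gamma>)))) \<gamma>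
     else (SOME \<delta>. \<delta> \<in> cir \<gamma>))"

text \<open>Treats both cases of \<open>stop\<close> alike. In a strong circuit all rotations are
  nonzero, so any walk to the chosen representative qualifies.\<close>

lemma stop_walk:
  assumes "\<gamma> \<in> NC"
  obtains k where "stop \<gamma> = (rot ^^ k) \<gamma>" "\<And>i. i < k \<Longrightarrow> \<not> bad (rotate i (snd \<gamma>))"
proof (cases "\<exists>i. bad (rotate i (snd \<gamma>))")
  case True
  then show ?thesis using that[of "LEAST i. bad (rotate i (snd \<gamma>))"] not_less_Least by (auto simp: stop_def)
next
  case False
  have "(SOME \<delta>. \<delta> \<in> cir \<gamma>) \<in> cir \<gamma>" by (rule someI[of _ \<gamma>]) (rule self_cir)
  then obtain k where "stop \<gamma> = (rot ^^ k) \<gamma>" using False by (auto simp: stop_def cir_NC[OF assms])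
  then show ?thesis using that False by blast
qed

lemma stop_cir: "\<gamma> \<in> NC \<Longrightarrow> stop \<gamma> \<in> cir \<gamma>"
  using stop_walk[of \<gamma>] unfolding cir_NC by blast

lemma walk_Edg:
  assumes "\<gamma> \<in> Edg" "\<And>i. i < k \<Longrightarrow> \<not> bad (rotate i (snd \<gamma>))"
  shows "(rot ^^ k) \<gamma> \<in> Edg"
proof (cases k)
  case (Suc j)
  have "(rot ^^ j) \<gamma> \<in> NC" using assms(1) rots_NC by (auto simp: Edg_def)
  then show ?thesis using good_rot_Edg[of "(rot ^^ j) \<gamma>"] assms(2)[of j] Suc by simp
qed (simp add: assms)

lemma stop_Edg: "\<gamma> \<in> Edg \<Longrightarrow> stop \<gamma> \<in> Edg"
  using stop_walk[of \<gamma>] walk_Edg[of \<gamma>] by (metis (no_types, lifting) Edg_def mem_Collect_eq)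

text \<open>Rotating a nonzero cycle stays in the same run: the first zero cycle ahead is unchanged
  and one step closer. In a strong circuit the choice depends on the circuit only.\<close>

lemma stop_rot:
  assumes "\<gamma> \<in> NC" "\<not> bad (snd \<gamma>)"
  shows "stop (rot \<gamma>) = stop \<gamma>"
proof -
  have r: "rotate i (rotate1 (snd \<gamma>)) = rotate (Suc i) (snd \<gamma>)" for i
    by (simp add: rotate1_rotate_swap)
  have ex: "(\<exists>i. bad (rotate (Suc i) (snd \<gamma>))) \<longleftrightarrow> (\<exists>i. bad (rotate i (snd \<gamma>)))"
    using assms(2) by (metis not0_implies_Suc rotate0 id_apply)
  show ?thesis
  proof (cases "\<exists>i. bad (rotate i (snd \<gamma>))")
    case True
    then obtain n where "bad (rotate n (snd \<gamma>))" by blast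
    then have "(LEAST i. bad (rotate i (snd \<gamma>))) = Suc (LEAST i. bad (rotate (Suc i) (snd \<gamma>)))"
      by (rule Least_Suc) (use assms(2) in simp)
    then show ?thesis
      using True ex by (simp add: stop_def r del: rotate_Suc) (simp add: funpow_swap1)
  next
    case False
    then show ?thesis using ex cir_rot[OF assms(1)] by (simp add: stop_def r del: rotate_Suc)
  qed
qed

lemma stop_W: "\<gamma> \<in> Wc \<Longrightarrow> stop \<gamma> = \<gamma>"
proof -
  assume "\<gamma> \<in> Wc"
  then have 0: "bad (rotate 0 (snd \<gamma>))" by (simp add: Wc_def)
  then have "(LEAST i. bad (rotate i (snd \<gamma>))) = 0" by (rule Least_equality) simp
  moreover have "\<exists>i. bad (rotate i (snd \<gamma>))" using 0 by blast
  ultimately show ?thesis by (simp add: stop_def)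
qed

lemma stop_bad: 
  assumes "\<gamma> \<in> Edg" "bad (rotate i (snd \<gamma>))" shows "stop \<gamma> \<in> Wc"
proof -
  have "bad (rotate (LEAST i. bad (rotate i (snd \<gamma>))) (snd \<gamma>))" using assms(2) by (rule LeastI)
  then have "bad (snd (stop \<gamma>))" using assms(2) by (auto simp: stop_def)
  then show ?thesis using stop_Edg[OF assms(1)] by (simp add: Wc_def)
qed

lemma stop_stop: assumes "\<gamma> \<in> Edg" shows "stop (stop \<gamma>) = stop \<gamma>"
proof (cases "\<exists>i. bad (rotate i (snd \<gamma>))")
  case True
  then show ?thesis using stop_W stop_bad[OF assms] by blast
next
  case False
  have NC: "\<gamma> \<in> NC" using assms by (simp add: Edg_def)
  obtain k where k: "stop \<gamma> = (rot ^^ k) \<gamma>" using stop_walk[OF NC] by blast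
  have "\<not> bad (rotate i (snd (stop \<gamma>)))" for i using False by (simp add: k rotate_rotate)
  then have "stop (stop \<gamma>) = (SOME \<delta>. \<delta> \<in> cir (stop \<gamma>))"
    by (subst stop_def) simp
  also have "\<dots> = (SOME \<delta>. \<delta> \<in> cir \<gamma>)" by (simp only: cir_eq[OF stop_cir[OF NC]])
  also have "\<dots> = stop \<gamma>" using False by (subst stop_def) simp
  finally show ?thesis .
qed

section \<open>Runs of rotations and their number\<close>

definition reps :: "('v, 'e) qpath set" where
  "reps = stop ` Edg"

definition SC :: "('v, 'e) qpath set set" where
  "SC = nontrivial_strong_circuits Q Z"

definition EC :: "('v, 'e) qpath set set" where
  "EC = efficient_circuits Q Z"

lemma SC_iff: "C \<in> SC \<longleftrightarrow> (\<exists>\<gamma>\<in>NC. C = cir \<gamma> \<and> (\<forall>i. \<not> bad (rotate i (snd \<gamma>))))"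
proof
  assume C: "C \<in> SC"
  then obtain \<gamma> where \<gamma>: "\<gamma> \<in> cycles Q" "C = cir \<gamma>" "strong Q Z C" "\<not> trivial_circuit Q C"
    by (auto simp: SC_def nontrivial_strong_circuits_def circuits_eq)
  have "snd \<gamma> \<noteq> []"
  proof
    assume "snd \<gamma> = []"
    then obtain u where u: "\<gamma> = (u, [])" by (cases \<gamma>) simp
    show False using \<gamma>(1,2,4) unfolding u cir_Nil by (auto simp: trivial_circuit_def cycles_def)
  qed
  then have "\<gamma> \<in> NC" using \<gamma>(1) by (simp add: NC_def)
  then show "\<exists>\<gamma>\<in>NC. C = cir \<gamma> \<and> (\<forall>i. \<not> bad (rotate i (snd \<gamma>)))" using \<gamma> strong_iff by blast
next
  assume "\<exists>\<gamma>\<in>NC. C = cir \<gamma> \<and> (\<forall>i. \<not> bad (rotate i (snd \<gamma>)))"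
  then obtain \<gamma> where \<gamma>: "\<gamma> \<in> NC" "C = cir \<gamma>" "\<forall>i. \<not> bad (rotate i (snd \<gamma>))" by blast
  have "\<not> trivial_circuit Q C"
  proof
    assume "trivial_circuit Q C"
    then have "snd \<gamma> = []" using self_cir[of \<gamma>] unfolding trivial_circuit_def \<gamma>(2) by force
    then show False using \<gamma>(1) by (simp add: NC_def)
  qed
  moreover have "C \<in> circuits Q" using \<gamma>(1) unfolding circuits_eq \<gamma>(2) NC_def by blast
  moreover have "strong Q Z C" using strong_iff[OF \<gamma>(1)] \<gamma>(3) unfolding \<gamma>(2) by blast
  ultimately show "C \<in> SC"
    unfolding SC_def nontrivial_strong_circuits_def by blast
qed

text \<open>As \<xi> has at least one arrow, the path \<alpha> lies in the part of the cycle before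
  the last arrow, and this part is nonzero.\<close>

lemma odot_Z:
  assumes "\<gamma> \<in> Wc" shows "\<exists>\<xi>\<in>Z. \<exists>\<alpha>\<in>B. ptgt Q \<alpha> = psrc \<xi> \<and> ptgt Q \<xi> = psrc \<alpha> \<and> \<gamma> = pcomp \<xi> \<alpha>"
proof -
  obtain \<xi> \<alpha> where *: "\<xi> \<in> Z" "\<alpha> \<in> P" "ptgt Q \<alpha> = psrc \<xi>" "\<gamma> = pcomp \<xi> \<alpha>"
    using assms unfolding W_cycles_eq[symmetric] W_cycles_def by blast
  have "\<not> bad (butlast (snd \<gamma>))" using assms by (simp add: Wc_def Edg_def)
  moreover have "butlast (snd \<gamma>) = snd \<alpha> @ butlast (snd \<xi>)"
    using *(4) Z_ne[OF *(1)] by (simp add: butlast_append)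
  ultimately have "\<alpha> \<in> B" using *(2) bad_append(2) by (auto simp: B_iff)
  moreover have "ptgt Q \<gamma> = psrc \<gamma>" using assms by (cases \<gamma>) (auto simp: Wc_def Edg_def NC_iff)
  then have "ptgt Q \<xi> = psrc \<alpha>" using * by simp
  ultimately show ?thesis using * by blast
qed

text \<open>In a circuit that is not strong, rotating a cycle of \<open>Edg\<close> up to the first
  zero cycle leads into \<open>Wc\<close>. Conversely, a cycle of \<open>Wc\<close> lies in
  \<open>Edg\<close>, is zero, and factors as in \<open>odot_Z\<close>.\<close>

lemma EC_iff: "C \<in> EC \<longleftrightarrow> (\<exists>\<gamma>\<in>Wc. C = cir \<gamma>)"
proof
  assume C: "C \<in> EC"
  then obtain \<gamma> where \<gamma>: "\<gamma> \<in> cycles Q" "C = cir \<gamma>" "useful Q Z C" "\<not> strong Q Z C"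
    by (auto simp: EC_def efficient_circuits_def efficient_def circuits_eq)
  have "snd \<gamma> \<noteq> []"
  proof
    assume "snd \<gamma> = []"
    then obtain u where u: "\<gamma> = (u, [])" by (cases \<gamma>) simp
    show False using \<gamma>(2,3) unfolding u cir_Nil by (auto simp: useful_def odot_at_def arrow_paths_def odot_def pcomp_def)
  qed
  then have NC: "\<gamma> \<in> NC" using \<gamma>(1) by (simp add: NC_def)
  then obtain \<delta> where \<delta>: "\<delta> \<in> C" "\<delta> \<in> Edg" using \<gamma> useful_iff by blast
  have D: "\<delta> \<in> NC" using \<delta>(2) by (simp add: Edg_def)
  have C': "C = cir \<delta>" using \<delta>(1) \<gamma>(2) cir_eq by simp
  then obtain i where "bad (rotate i (snd \<delta>))" using \<gamma>(4) strong_iff[OF D] by blast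
  then have "stop \<delta> \<in> Wc" using stop_bad \<delta>(2) by blast
  moreover have "C = cir (stop \<delta>)" using C' cir_eq[OF stop_cir[OF D]] by simp
  ultimately show "\<exists>\<gamma>\<in>Wc. C = cir \<gamma>" by blast
next
  assume "\<exists>\<gamma>\<in>Wc. C = cir \<gamma>"
  then obtain \<gamma> where \<gamma>: "\<gamma> \<in> Wc" "C = cir \<gamma>" by blast
  then have NC: "\<gamma> \<in> NC" and E: "\<gamma> \<in> Edg" by (auto simp: Wc_def Edg_def)
  have "C \<in> circuits Q" using NC \<gamma>(2) by (auto simp: circuits_eq NC_def)
  moreover have "useful Q Z C" using useful_iff[OF NC] E \<gamma>(2) self_cir by blast
  moreover have "\<not> strong Q Z C"
    using strong_iff[OF NC] \<gamma> by (auto simp: Wc_def intro: exI[of _ 0])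
  moreover have "odot_at Q Z B C \<noteq> {}"
    using odot_Z[OF \<gamma>(1)] self_cir[of \<gamma>] \<gamma>(2) by (fastforce simp: odot_at_def odot_def)
  ultimately show "C \<in> EC" by (simp add: EC_def efficient_circuits_def efficient_def)
qed

lemma Wc_sub: "Wc \<subseteq> Edg" "Edg \<subseteq> NC"
  by (auto simp: Wc_def Edg_def)

lemma finite_Edg: assumes "finite B" shows "finite Edg"
proof -
  have "Edg \<subseteq> (\<lambda>(\<beta>, a). (psrc \<beta>, snd \<beta> @ [a])) ` (B \<times> arcs Q)"
  proof
    fix \<gamma> assume g: "\<gamma> \<in> Edg"
    obtain u q a where d: "\<gamma> = (u, q @ [a])"
      using g by (cases \<gamma>; cases "snd \<gamma>" rule: rev_cases) (auto simp: Edg_def NC_iff)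
    show "\<gamma> \<in> (\<lambda>(\<beta>, a). (psrc \<beta>, snd \<beta> @ [a])) ` (B \<times> arcs Q)"
      by (rule image_eqI[of _ _ "((u, q), a)"]) (use g in \<open>auto simp: d Edg_def NC_iff B_iff\<close>)
  qed
  then show ?thesis by (rule finite_subset) (simp add: assms)
qed

text \<open>A run that meets a zero cycle stops there, in \<open>Wc\<close>; a run that meets none
  is a whole strong circuit and is represented by the chosen cycle.\<close>

lemma reps_eq: "reps = Wc \<union> (\<lambda>C. SOME \<delta>. \<delta> \<in> C) ` SC"
proof (intro equalityI subsetI)
  fix m assume "m \<in> reps"
  then obtain \<gamma> where \<gamma>: "\<gamma> \<in> Edg" "m = stop \<gamma>" by (auto simp: reps_def)
  show "m \<in> Wc \<union> (\<lambda>C. SOME \<delta>. \<delta> \<in> C) ` SC"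
  proof (cases "\<exists>i. bad (rotate i (snd \<gamma>))")
    case True
    then show ?thesis using stop_bad \<gamma> by blast
  next
    case False
    then have "cir \<gamma> \<in> SC" using \<gamma>(1) Wc_sub by (auto simp: SC_iff)
    then show ?thesis using False \<gamma>(2) by (auto simp: stop_def)
  qed
next
  fix m assume "m \<in> Wc \<union> (\<lambda>C. SOME \<delta>. \<delta> \<in> C) ` SC"
  then show "m \<in> reps"
  proof
    assume "m \<in> Wc"
    then show ?thesis using stop_W Wc_sub unfolding reps_def by (metis imageI subsetD)
  next
    assume "m \<in> (\<lambda>C. SOME \<delta>. \<delta> \<in> C) ` SC"
    then obtain \<gamma> where \<gamma>: "\<gamma> \<in> NC" "m = (SOME \<delta>. \<delta> \<in> cir \<gamma>)" "\<forall>i. \<not> bad (rotate i (snd \<gamma>))"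
      by (auto simp: SC_iff)
    then have "m = stop \<gamma>" by (auto simp: stop_def)
    moreover have "\<gamma> \<in> Edg" using good_Edg[OF \<gamma>(1)] \<gamma>(3) by (metis rotate0 id_apply)
    ultimately show ?thesis by (auto simp: reps_def)
  qed
qed

text \<open>The generator that is given up in exchange for the relation of its circuit.\<close>

definition wit :: "('v, 'e) qpath set \<Rightarrow> ('v, 'e) qpath" where
  "wit C = (SOME w. w \<in> Wc \<inter> C)"

lemma wit_in: "C \<in> EC \<Longrightarrow> wit C \<in> Wc \<inter> C"
  unfolding wit_def using self_cir by (intro someI_ex[of "\<lambda>w. w \<in> Wc \<inter> C"]) (auto simp: EC_iff)

lemma EC_cir: "\<lbrakk>C \<in> EC; \<gamma> \<in> C\<rbrakk> \<Longrightarrow> C = cir \<gamma>"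
  unfolding EC_iff using cir_eq by blast

lemma SC_cir: "\<lbrakk>C \<in> SC; \<gamma> \<in> C\<rbrakk> \<Longrightarrow> C = cir \<gamma>"
  unfolding SC_iff using cir_eq by blast

text \<open>\<open>Wc\<close> is the disjoint union of its parts in the efficient circuits, and each
  part loses its one witness. Integers keep the subtraction from being truncated.\<close>

lemma card_reps:
  assumes "finite B"
  shows "finite (reps - wit ` EC)"
    and "int (card (reps - wit ` EC)) = int (card SC) + (\<Sum>C\<in>EC. int (card (Wc \<inter> C))) - int (card EC)"
proof -
  let ?r = "\<lambda>C :: ('v, 'e) qpath set. SOME \<delta>. \<delta> \<in> C"
  have fin: "finite Edg" by (rule finite_Edg[OF assms])
  then have finW: "finite Wc" using Wc_sub by (auto intro: finite_subset)
  have fr: "finite reps" by (simp add: reps_def fin)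
  then show "finite (reps - wit ` EC)" by simp
  have r: "?r C \<in> C" if C: "C \<in> SC" for C
  proof -
    obtain \<gamma> where "C = cir \<gamma>" using C unfolding SC_iff by blast
    then show ?thesis using self_cir by (intro someI[of "\<lambda>\<delta>. \<delta> \<in> C" \<gamma>]) simp
  qed
  have inj_r: "inj_on ?r SC" using r SC_cir by (intro inj_onI) metis
  have EC_im: "EC = cir ` Wc" by (auto simp: EC_iff)
  have fE: "finite EC" using finW by (simp add: EC_im)
  have inj_wit: "inj_on wit EC" using wit_in EC_cir by (intro inj_onI) (metis IntE)
  have disj: "Wc \<inter> ?r ` SC = {}"
  proof (rule ccontr)
    assume "Wc \<inter> ?r ` SC \<noteq> {}"
    then obtain C where C: "C \<in> SC" "?r C \<in> Wc" by blast
    then obtain \<gamma> i where "\<forall>i. \<not> bad (rotate i (snd \<gamma>))" "?r C = (rot ^^ i) \<gamma>"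
      using r[OF C(1)] by (auto simp: SC_iff cir_NC)
    then show False using C(2) by (auto simp: Wc_def)
  qed
  have "card reps = card Wc + card (?r ` SC)"
    unfolding reps_eq by (rule card_Un_disjoint) (use finW fr disj in \<open>auto simp: reps_eq\<close>)
  also have "card (?r ` SC) = card SC" by (rule card_image[OF inj_r])
  also have "card Wc = (\<Sum>C\<in>EC. card (Wc \<inter> C))"
  proof -
    have "Wc = (\<Union>C\<in>EC. Wc \<inter> C)" using self_cir by (auto simp: EC_im)
    then have "card Wc = card (\<Union>C\<in>EC. Wc \<inter> C)" by simp
    also have "\<dots> = (\<Sum>C\<in>EC. card (Wc \<inter> C))"
    proof (rule card_UN_disjoint[OF fE])
      show "\<forall>C\<in>EC. \<forall>D\<in>EC. C \<noteq> D \<longrightarrow> (Wc \<inter> C) \<inter> (Wc \<inter> D) = {}" using EC_cir by blast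
    qed (simp add: finW)
    finally show ?thesis .
  qed
  finally have 1: "card reps = (\<Sum>C\<in>EC. card (Wc \<inter> C)) + card SC" .
  have sub: "wit ` EC \<subseteq> reps" using wit_in by (auto simp: reps_eq)
  then have "card (reps - wit ` EC) = card reps - card EC" "card EC \<le> card reps"
    using card_Diff_subset[of "wit ` EC" reps] card_mono[OF fr sub] fE by (auto simp: card_image[OF inj_wit])
  with 1 show "int (card (reps - wit ` EC)) = int (card SC) + (\<Sum>C\<in>EC. int (card (Wc \<inter> C))) - int (card EC)"
    by simp
qed

end


section \<open>Sums over a full turn of a circuit\<close>

lemma sum_periodic_shift:
  fixes f :: "nat \<Rightarrow> 'a::ab_group_add"
  assumes "\<And>j. f (j + n) = f j"
  shows "(\<Sum>j<n. f (j + i)) = (\<Sum>j<n. f j)"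
proof (induction i)
  case (Suc i)
  have "(\<Sum>j<n. f (j + Suc i)) + f i = (\<Sum>j<Suc n. f (j + i))"
    by (simp only: sum.lessThan_Suc_shift) (simp add: add.commute)
  also have "\<dots> = (\<Sum>j<n. f (j + i)) + f (n + i)" by simp
  also have "f (n + i) = f i" using assms[of i] by (simp add: add.commute)
  finally show ?case using Suc by simp
qed simp

lemma sum_lessThan_add:
  fixes f :: "nat \<Rightarrow> 'a::comm_monoid_add"
  shows "(\<Sum>j<m + n. f j) = (\<Sum>j<m. f j) + (\<Sum>j<n. f (m + j))"
  by (induction n) (simp_all add: ac_simps)

lemma span_image_lin_ext:
  assumes "x \<in> fv.span (g ` X)"
  obtains \<kappa> where "supp \<kappa> \<subseteq> X" "x = lin_ext g \<kappa>"
proof -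
  have "fv.span (g ` X) \<subseteq> lin_ext g ` {\<kappa>. supp \<kappa> \<subseteq> X}"
  proof (rule fv.span_minimal[OF _ subspace_lin_ext_image[OF subspace_keys]])
    show "g ` X \<subseteq> lin_ext g ` {\<kappa>. supp \<kappa> \<subseteq> X}"
    proof
      fix y assume "y \<in> g ` X"
      then obtain x where "x \<in> X" "y = g x" by blast
      then show "y \<in> lin_ext g ` {\<kappa>. supp \<kappa> \<subseteq> X}"
        by (intro image_eqI[of _ _ "sgl x 1"]) auto
    qed
  qed
  then show ?thesis using assms that by blast
qed

lemma lookup_lin_ext:
  "coef (lin_ext g f) y =
    (\<Sum>x\<in>supp f. coef f x * coef (g x) y)"
  by (simp add: lin_ext_def lookup_sum)

context monomial_quiver
begin

text \<open>Set to zero where the path before the last arrow vanishes, because the term \<beta> dc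
  then vanishes as well.\<close>

definition eE :: "('v, 'e) qpath \<Rightarrow> (('v, 'e) qpath \<Rightarrow>\<^sub>0 'k)" where
  "eE \<gamma> = (if \<gamma> \<in> Edg then sgl \<gamma> 1 else 0)"

text \<open>Every cycle of a circuit is met equally often by the summation, so that \<open>osum g\<close> is a multiple
  of the sum over the circuit; see \<open>osum_seg\<close>.\<close>

definition osum :: "('v, 'e) qpath \<Rightarrow> (('v, 'e) qpath \<Rightarrow>\<^sub>0 'k)" where
  "osum g = (\<Sum>j<plength g. eE ((rot ^^ j) g))"

text \<open>Exceeds one on powers of a shorter cycle, whose rotations repeat within a full turn;
  \<open>cnt g g\<close> is the largest exponent with which \<open>g\<close> is a power of a
  cycle.\<close>

definition cnt :: "('v, 'e) qpath \<Rightarrow> ('v, 'e) qpath \<Rightarrow> nat" where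
  "cnt g \<gamma> = card {j. j < plength g \<and> (rot ^^ j) g = \<gamma>}"

lemma rots_period: "g \<in> NC \<Longrightarrow> (rot ^^ (j + plength g)) g = (rot ^^ j) g"
  by (simp add: funpow_add rots_length)

lemma rot_inj: "\<lbrakk>\<gamma> \<in> NC; \<delta> \<in> NC; rot \<gamma> = rot \<delta>\<rbrakk> \<Longrightarrow> \<gamma> = \<delta>"
proof (rule NC_eqI)
  assume NC: "\<gamma> \<in> NC" "\<delta> \<in> NC" and eq: "rot \<gamma> = rot \<delta>"
  then have "rotate1 (snd \<gamma>) = rotate1 (snd \<delta>)" by (metis snd_rot)
  moreover have "snd \<gamma> \<noteq> []" "snd \<delta> \<noteq> []" using NC by (auto simp: NC_def)
  ultimately show "snd \<gamma> = snd \<delta>" by (cases "snd \<gamma>"; cases "snd \<delta>") auto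
qed

lemma osum_shift:
  assumes "g \<in> NC"
  shows "(\<Sum>j<plength g. eE ((rot ^^ (j + i)) g)) = osum g"
  unfolding osum_def by (rule sum_periodic_shift) (simp only: rots_period[OF assms])

lemma cnt_sum: "of_nat (cnt g \<gamma>) = (\<Sum>j<plength g. if (rot ^^ j) g = \<gamma> then (1::'k) else 0)"
proof -
  have "(\<Sum>j<plength g. if (rot ^^ j) g = \<gamma> then (1::'k) else 0) =
      (\<Sum>j\<in>{j \<in> {..<plength g}. (rot ^^ j) g = \<gamma>}. 1)"
    by (rule sum.inter_filter[symmetric]) simp
  then show ?thesis by (simp add: cnt_def)
qed

text \<open>Stated in the field because shifting a periodic sum cancels a summand, which calls for
  an abelian group.\<close>

lemma cnt_rot:
  assumes "g \<in> NC" "\<gamma> \<in> NC"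
  shows "(of_nat (cnt g (rot \<gamma>)) :: 'k) = of_nat (cnt g \<gamma>)"
proof -
  have "(of_nat (cnt g (rot \<gamma>)) :: 'k) = (\<Sum>j<plength g. if (rot ^^ (j + 1)) g = rot \<gamma> then 1 else 0)"
    unfolding cnt_sum by (rule sum_periodic_shift[symmetric]) (simp only: rots_period[OF assms(1)])
  also have "\<dots> = (\<Sum>j<plength g. if (rot ^^ j) g = \<gamma> then 1 else 0)"
    using rot_inj[OF rots_NC[OF assms(1)] assms(2)] by (intro sum.cong) auto
  finally show ?thesis by (simp add: cnt_sum)
qed

lemma cnt_cir:
  assumes "g \<in> NC"
  shows "\<gamma> \<in> cir g \<Longrightarrow> (of_nat (cnt g \<gamma>) :: 'k) = of_nat (cnt g g)"
    and "\<gamma> \<notin> cir g \<Longrightarrow> cnt g \<gamma> = 0"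
    and "cnt g g \<noteq> 0"
proof -
  have "(of_nat (cnt g ((rot ^^ i) g)) :: 'k) = of_nat (cnt g g)" for i
    by (induction i) (simp_all add: cnt_rot[OF assms rots_NC[OF assms]])
  then show "\<gamma> \<in> cir g \<Longrightarrow> (of_nat (cnt g \<gamma>) :: 'k) = of_nat (cnt g g)"
    unfolding cir_NC[OF assms] by blast
  show "\<gamma> \<notin> cir g \<Longrightarrow> cnt g \<gamma> = 0" unfolding cir_NC[OF assms] cnt_def by auto
  have "0 \<in> {j. j < plength g \<and> (rot ^^ j) g = g}" using assms by (auto simp: NC_def)
  moreover have "finite {j. j < plength g \<and> (rot ^^ j) g = g}" by simp
  ultimately show "cnt g g \<noteq> 0" unfolding cnt_def by (metis card_0_eq empty_iff)
qed

lemma lookup_osum: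
  "coef (osum g) \<gamma> = (if \<gamma> \<in> Edg then of_nat (cnt g \<gamma>) else 0)"
proof -
  have "coef (osum g) \<gamma> =
      (\<Sum>j<plength g. if \<gamma> \<in> Edg then if (rot ^^ j) g = \<gamma> then 1 else 0 else 0)"
    unfolding osum_def lookup_sum
    by (rule sum.cong) (auto simp: eE_def lookup_single when_def)
  then show ?thesis by (simp add: cnt_sum)
qed

section \<open>Sums over runs\<close>

definition seg :: "('v, 'e) qpath \<Rightarrow> (('v, 'e) qpath \<Rightarrow>\<^sub>0 'k)" where
  "seg m = (\<Sum>\<gamma>\<in>{\<gamma> \<in> Edg. stop \<gamma> = m}. sgl \<gamma> 1)"

lemma lookup_seg:
  assumes "finite Edg"
  shows "coef (seg m) \<gamma> = (if \<gamma> \<in> Edg \<and> stop \<gamma> = m then 1 else 0)"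
  using assms by (simp add: seg_def lookup_sum lookup_single when_def sum.If_cases Int_def)

lemma seg_keys: "supp (seg m) \<subseteq> Edg"
proof -
  have "seg m \<in> {f. supp f \<subseteq> Edg}"
    unfolding seg_def by (rule fv.subspace_sum[OF subspace_keys]) simp
  then show ?thesis by simp
qed

text \<open>The cycles of \<open>Edg\<close> in an efficient circuit fall into runs, one for each
  member of W at which they stop, and a full turn meets all of them equally often.\<close>

lemma osum_seg:
  assumes "finite Edg" "C \<in> EC" "g \<in> C"
  shows "osum g = sc (of_nat (cnt g g)) (\<Sum>m\<in>Wc \<inter> C. seg m)"
proof (rule poly_mapping_eqI)
  fix \<gamma>
  have fin: "finite (Wc \<inter> C)" using assms(1) Wc_sub by (auto intro: finite_subset)
  have C: "C = cir g" by (rule EC_cir[OF assms(2,3)])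
  obtain w where w: "w \<in> Wc" "C = cir w" using assms(2) unfolding EC_iff by blast
  have W_NC: "w \<in> NC" using w(1) Wc_sub by blast
  have g: "g \<in> NC" using cir_sub_NC[OF W_NC] assms(3) w(2) by blast
  have stop_C: "stop \<gamma> \<in> Wc \<inter> C \<longleftrightarrow> \<gamma> \<in> C" if E: "\<gamma> \<in> Edg"
  proof
    have NC: "\<gamma> \<in> NC" using E Wc_sub by blast
    show "\<gamma> \<in> C" if "stop \<gamma> \<in> Wc \<inter> C"
      using EC_cir[OF assms(2), of "stop \<gamma>"] cir_eq[OF stop_cir[OF NC]] self_cir[of \<gamma>] that by simp
    show "stop \<gamma> \<in> Wc \<inter> C" if "\<gamma> \<in> C"
    proof -
      have C\<gamma>: "C = cir \<gamma>" by (rule EC_cir[OF assms(2) that])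
      have "w \<in> cir \<gamma>" using self_cir[of w] w(2) C\<gamma> by simp
      then obtain i where "w = (rot ^^ i) \<gamma>" unfolding cir_NC[OF NC] by blast
      then have "bad (rotate i (snd \<gamma>))" using w(1) by (simp add: Wc_def)
      then show ?thesis using stop_bad[OF E] stop_cir[OF NC] C\<gamma> by blast
    qed
  qed
  have "coef (\<Sum>m\<in>Wc \<inter> C. seg m) \<gamma> =
      (\<Sum>m\<in>Wc \<inter> C. if m = stop \<gamma> then (if \<gamma> \<in> Edg then 1 else 0) else 0)"
    unfolding lookup_sum by (rule sum.cong) (auto simp: lookup_seg[OF assms(1)])
  also have "\<dots> = (if \<gamma> \<in> Edg \<and> \<gamma> \<in> C then 1 else 0)"
    using stop_C fin by (auto simp: sum.delta)
  finally show "coef (osum g) \<gamma> =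
      coef (sc (of_nat (cnt g g)) (\<Sum>m\<in>Wc \<inter> C. seg m)) \<gamma>"
    using cnt_cir(1,2)[OF g, of \<gamma>] C by (simp add: lookup_osum)
qed

definition osums :: "(('v, 'e) qpath \<Rightarrow>\<^sub>0 'k) set" where
  "osums = fv.span (osum ` {g \<in> NC. \<exists>i. bad (rotate i (snd g))})"

lemma osums_subspace: "fv.subspace osums"
  by (simp add: osums_def)

text \<open>A full turn gives equal coefficients to all cycles of \<open>Edg\<close> in one circuit.
  For the independence proof this means that a vanishing coefficient at the witness forces the
  coefficients at all members of W in the circuit to vanish.\<close>

lemma osums_lookup:
  assumes f: "f \<in> osums" and C: "C \<in> EC" and w: "w \<in> Wc \<inter> C" "w' \<in> Wc \<inter> C"
  shows "coef f w = coef f w'"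
proof -
  have "f \<in> {f. coef f w = coef f w'}"
  proof (rule subsetD[OF fv.span_minimal f[unfolded osums_def]])
    show "fv.subspace {f. coef f w = (coef f w' :: 'k)}"
      by (auto simp: fv.subspace_def lookup_add)
    show "osum ` {g \<in> NC. \<exists>i. bad (rotate i (snd g))} \<subseteq>
        {f. coef f w = coef f w'}"
    proof
      fix f assume "f \<in> osum ` {g \<in> NC. \<exists>i. bad (rotate i (snd g))}"
      then obtain g where g: "g \<in> NC" and f: "f = osum g" by blast
      have E: "w \<in> Edg" "w' \<in> Edg" using w Wc_sub by auto
      have "cir w = cir w'" using EC_cir[OF C] w by blast
      then have "w \<in> cir g \<longleftrightarrow> w' \<in> cir g" using cir_eq self_cir by metis
      then show "f \<in> {f. coef f w = coef f w'}"
        using E cnt_cir(1,2)[OF g, of w] cnt_cir(1,2)[OF g, of w']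
        by (cases "w \<in> cir g") (simp_all add: f lookup_osum)
    qed
  qed
  then show ?thesis by blast
qed

lemma osums_strong:
  assumes f: "f \<in> osums" and m: "m \<in> NC" "\<forall>i. \<not> bad (rotate i (snd m))"
  shows "coef f m = 0"
proof -
  have "f \<in> {f. coef f m = 0}"
  proof (rule subsetD[OF fv.span_minimal f[unfolded osums_def]])
    show "fv.subspace {f. coef f m = (0 :: 'k)}"
      by (auto simp: fv.subspace_def lookup_add)
    show "osum ` {g \<in> NC. \<exists>i. bad (rotate i (snd g))} \<subseteq> {f. coef f m = 0}"
    proof
      fix f assume "f \<in> osum ` {g \<in> NC. \<exists>i. bad (rotate i (snd g))}"
      then obtain g i where g: "g \<in> NC" "bad (rotate i (snd g))" "f = osum g" by blast
      have "m \<notin> cir g"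
      proof
        assume "m \<in> cir g"
        then have "g \<in> cir m" using cir_eq[of m g] self_cir[of g] by simp
        then obtain k where "g = (rot ^^ k) m" unfolding cir_NC[OF m(1)] by blast
        then have "snd g = rotate k (snd m)" by simp
        then show False using g(2) m(2) by (simp add: rotate_rotate)
      qed
      then show "f \<in> {f. coef f m = 0}"
        using cnt_cir(2)[OF g(1)] by (simp add: g(3) lookup_osum)
    qed
  qed
  then show ?thesis by blast
qed

lemma cycle_values:
  assumes \<kappa>: "\<And>\<delta>. \<lbrakk>\<delta> \<in> NC; \<not> bad (snd \<delta>)\<rbrakk> \<Longrightarrow> coef \<kappa> (rot \<delta>) = coef \<kappa> \<delta>"
    and \<gamma>: "\<gamma> \<in> NC"
  shows "coef \<kappa> (stop \<gamma>) = coef \<kappa> \<gamma>"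
proof -
  obtain k where k: "stop \<gamma> = (rot ^^ k) \<gamma>" "\<And>i. i < k \<Longrightarrow> \<not> bad (rotate i (snd \<gamma>))"
    using stop_walk[OF \<gamma>] by blast
  have "i \<le> k \<Longrightarrow> coef \<kappa> ((rot ^^ i) \<gamma>) = coef \<kappa> \<gamma>" for i
  proof (induction i)
    case (Suc i)
    then show ?case using \<kappa>[OF rots_NC[OF \<gamma>], of i] k(2)[of i] by simp
  qed simp
  then show ?thesis by (simp add: k(1))
qed

text \<open>The hypothesis on \<kappa> is the one-cycle condition read off in
  \<open>lookup_ev0_Psi\<close>; it makes \<kappa> constant along each run.\<close>

lemma cycle_expand:
  assumes "finite Edg" "supp \<kappa> \<subseteq> Edg"
    and \<kappa>: "\<And>\<delta>. \<lbrakk>\<delta> \<in> NC; \<not> bad (snd \<delta>)\<rbrakk> \<Longrightarrow> coef \<kappa> (rot \<delta>) = coef \<kappa> \<delta>"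
  shows "\<kappa> = (\<Sum>m\<in>reps. sc (coef \<kappa> m) (seg m))"
proof (rule poly_mapping_eqI)
  fix \<gamma>
  have "coef (\<Sum>m\<in>reps. sc (coef \<kappa> m) (seg m)) \<gamma> =
      (\<Sum>m\<in>reps. if m = stop \<gamma> then (if \<gamma> \<in> Edg then coef \<kappa> (stop \<gamma>) else 0) else 0)"
    unfolding lookup_sum by (rule sum.cong) (auto simp: lookup_seg[OF assms(1)])
  also have "\<dots> = (if \<gamma> \<in> Edg then coef \<kappa> (stop \<gamma>) else 0)"
    using assms(1) by (simp add: sum.delta reps_def)
  also have "\<dots> = coef \<kappa> \<gamma>"
    using cycle_values[OF \<kappa>, of \<gamma>] assms(2) Wc_sub by (auto simp: in_keys_iff)
  finally show "coef \<kappa> \<gamma> =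
      coef (\<Sum>m\<in>reps. sc (coef \<kappa> m) (seg m)) \<gamma>" by simp
qed

lemma seg_cycle:
  assumes "finite Edg" "\<delta> \<in> NC" "\<not> bad (snd \<delta>)"
  shows "coef (seg m) (rot \<delta>) = coef (seg m) \<delta>"
  using good_Edg[OF assms(2,3)] good_rot_Edg[OF assms(2,3)] stop_rot[OF assms(2,3)]
  by (simp add: lookup_seg[OF assms(1)])

end


section \<open>Noncommutative differentials of the monomial algebra\<close>

context monomial_quiver
begin

definition dt :: "('v, 'e) qpath \<Rightarrow> ('v, 'e) qpath \<Rightarrow> _" where
  "dt \<alpha> x = alg.tau 1 (pb \<alpha>) [pb x]"

definition arr :: "'e \<Rightarrow> ('v, 'e) qpath" where
  "arr a = (tail Q a, [a])"

text \<open>With \<open>dt \<alpha> x\<close> read as \<alpha> dx, this is the term \<beta> dc of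
  the cycle \<gamma> = c\<beta>.\<close>

definition tg :: "('v, 'e) qpath \<Rightarrow> _" where
  "tg \<gamma> = dt (psrc \<gamma>, butlast (snd \<gamma>)) (arr (last (snd \<gamma>)))"

lemma tau_zero:
  assumes "x \<in> carrier Aalg"
  shows "alg.tau 1 \<zero>\<^bsub>Aalg\<^esub> [x] \<in> alg.Nn 1" "alg.tau 1 x [\<zero>\<^bsub>Aalg\<^esub>] \<in> alg.Nn 1"
proof -
  have z: "0 \<odot>\<^bsub>Aalg\<^esub> \<zero>\<^bsub>Aalg\<^esub> = \<zero>\<^bsub>Aalg\<^esub>" using cl_sc[of 0 0] by (simp add: cl_zero)
  show "alg.tau 1 \<zero>\<^bsub>Aalg\<^esub> [x] \<in> alg.Nn 1"
    using alg.tau_smult_left[of "\<zero>\<^bsub>Aalg\<^esub>" "[x]" 1 0] assms by (simp add: z)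
  show "alg.tau 1 x [\<zero>\<^bsub>Aalg\<^esub>] \<in> alg.Nn 1"
    using alg.tau_smult_right[of x "\<zero>\<^bsub>Aalg\<^esub>" 0] assms by (simp add: z)
qed

lemma NC_cases:
  assumes "\<gamma> \<in> NC"
  obtains q c where "\<gamma> = (head Q c, q @ [c])" "c \<in> arcs Q" "(head Q c, q) \<in> P"
    "ptgt Q (head Q c, q) = tail Q c" "(tail Q c, c # q) \<in> NC" "rot (tail Q c, c # q) = \<gamma>"
proof -
  obtain u q c where g: "\<gamma> = (u, q @ [c])"
    using assms by (cases \<gamma>; cases "snd \<gamma>" rule: rev_cases) (auto simp: NC_iff)
  then have *: "u = head Q c" "c \<in> arcs Q" "(head Q c, q) \<in> P" "ptgt Q (head Q c, q) = tail Q c"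
    using assms by (auto simp: NC_iff)
  moreover have "(tail Q c, c # q) \<in> NC" using * by (simp add: NC_iff)
  moreover have "rot (tail Q c, c # q) = \<gamma>" using * g by (simp add: rot_def)
  ultimately show ?thesis using that g by blast
qed

lemma tg_Nn: "\<lbrakk>\<gamma> \<in> NC; \<gamma> \<notin> Edg\<rbrakk> \<Longrightarrow> tg \<gamma> \<in> alg.Nn 1"
proof -
  assume g: "\<gamma> \<in> NC" "\<gamma> \<notin> Edg"
  obtain q c where q: "\<gamma> = (head Q c, q @ [c])" "c \<in> arcs Q" "(head Q c, q) \<in> P" using NC_cases[OF g(1)] .
  then have "pb (head Q c, q) = \<zero>\<^bsub>Aalg\<^esub>" using g by (intro pb_zero) (auto simp: Edg_def B_iff)
  then show ?thesis using tau_zero(1)[OF pb_in[of "arr c"]] q by (simp add: tg_def dt_def arr_def)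
qed

lemma dt_leibniz:
  assumes "a \<in> carrier Aalg" "x \<in> carrier Aalg" "y \<in> carrier Aalg"
  shows "alg.tau 1 a [x \<otimes>\<^bsub>Aalg\<^esub> y] -
    (alg.tau 1 (a \<otimes>\<^bsub>Aalg\<^esub> x) [y] + alg.tau 1 (y \<otimes>\<^bsub>Aalg\<^esub> a) [x]) \<in> alg.B1"
  using fv.subspace_neg[OF alg.B1_subspace alg.tau_leibniz[OF assms]] by (simp add: algebra_simps)

text \<open>Each arrow of p receives the differential in turn, and the rest of the cycle, read from
  behind that arrow round to it, becomes the coefficient. The arrow with index j, counted from 0, is
  brought to the last place by \<open>Suc j\<close> rotations.\<close>

lemma leibniz_cycle:
  assumes "(u, p) \<in> P" "(ptgt Q (u, p), q) \<in> P" "ptgt Q (ptgt Q (u, p), q) = u"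
  shows "dt (ptgt Q (u, p), q) (u, p) - (\<Sum>j<length p. tg ((rot ^^ Suc j) (u, p @ q))) \<in> alg.B1"
  using assms
proof (induction p arbitrary: q rule: rev_induct)
  case Nil
  then have q: "(u, q) \<in> P" "ptgt Q (u, q) = u" "(u, []) \<in> P" by auto
  have 1: "pb (u, q) \<otimes>\<^bsub>Aalg\<^esub> pb (u, []) = pb (u, q)" "pb (u, []) \<otimes>\<^bsub>Aalg\<^esub> pb (u, q) = pb (u, q)"
    "pb (u, []) \<otimes>\<^bsub>Aalg\<^esub> pb (u, []) = pb (u, [])"
    using q by (simp_all add: pb_mult pcomp_def)
  \<comment> \<open>The vertex is idempotent and acts as identity on q from both sides, so Leibniz's
    rule reads x = x + x modulo boundaries.\<close>
  have "dt (u, q) (u, []) - (dt (u, q) (u, []) + dt (u, q) (u, [])) \<in> alg.B1"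
    using dt_leibniz[of "pb (u, q)" "pb (u, [])" "pb (u, [])"] pb_in[OF q(1)] pb_in[OF q(3)]
    unfolding dt_def by (simp add: 1)
  from fv.subspace_neg[OF alg.B1_subspace this] show ?case by simp
next
  case (snoc c p)
  have c: "c \<in> arcs Q" "ptgt Q (u, p) = tail Q c" "(u, p) \<in> P" "(head Q c, q) \<in> P"
    "ptgt Q (head Q c, q) = u" using snoc.prems by auto
  have ac: "arr c \<in> P" using c by (simp add: arr_def)
  have mult: "pb (head Q c, q) \<otimes>\<^bsub>Aalg\<^esub> pb (arr c) = pb (tail Q c, c # q)"
    "pb (arr c) \<otimes>\<^bsub>Aalg\<^esub> pb (u, p) = pb (u, p @ [c])"
    "pb (u, p) \<otimes>\<^bsub>Aalg\<^esub> pb (head Q c, q) = pb (head Q c, q @ p)"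
    using c ac by (simp_all add: pb_mult) (simp_all add: arr_def pcomp_def)
  \<comment> \<open>The last arrow of p is split off: q d(cp) = qc dp + pq dc. The first term falls
    under the induction hypothesis with the enlarged remainder qc, the second is the new
    summand.\<close>
  have L: "dt (head Q c, q) (u, p @ [c]) -
      (dt (tail Q c, c # q) (u, p) + dt (head Q c, q @ p) (arr c)) \<in> alg.B1"
    using dt_leibniz[OF pb_in[OF c(4)] pb_in[OF ac] pb_in[OF c(3)]] by (simp add: mult dt_def)
  have IH: "dt (tail Q c, c # q) (u, p) - (\<Sum>j<length p. tg ((rot ^^ Suc j) (u, p @ c # q))) \<in> alg.B1"
    using snoc.IH[of "c # q"] c by simp
  have NC: "(u, (p @ [c]) @ q) \<in> NC" using snoc.prems by (simp add: NC_iff)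
  have "(rot ^^ Suc (length p)) (u, p @ c # q) = (head Q c, q @ p @ [c])"
    using rots_split[OF NC] by simp
  then have last: "tg ((rot ^^ Suc (length p)) (u, p @ c # q)) = dt (head Q c, q @ p) (arr c)"
    by (simp add: tg_def butlast_append)
  have "dt (head Q c, q) (u, p @ [c]) - ((\<Sum>j<length p. tg ((rot ^^ Suc j) (u, p @ c # q)))
      + dt (head Q c, q @ p) (arr c)) \<in> alg.B1"
    by (rule mod_trans[OF alg.B1_subspace L mod_add[OF alg.B1_subspace IH mod_refl[OF alg.B1_subspace]]])
  then show ?case unfolding last[symmetric] by simp
qed

definition Psi :: "(('v, 'e) qpath \<Rightarrow>\<^sub>0 'k) \<Rightarrow> _" where
  "Psi = lin_ext tg"

lemma Psi_eE: "\<gamma> \<in> NC \<Longrightarrow> Psi (eE \<gamma>) - tg \<gamma> \<in> alg.B1"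
  using tg_Nn[of \<gamma>] fv.subspace_neg[OF alg.tn.U_subspace] fv.subspace_0[OF alg.B1_subspace] alg.Nn_B1
  by (auto simp: Psi_def eE_def)

lemma Psi_sum: "Psi (sum F S) = (\<Sum>s\<in>S. Psi (F s))"
  by (simp add: Psi_def lin_ext_sum)

text \<open>The cycle g runs through \<xi> before \<alpha>. The terms at the arrows of \<xi> add up
  to \<alpha> d\<xi>, which is null; the terms at the arrows of \<alpha> are null because their
  coefficients still contain \<xi>. Together they make up a full turn.\<close>

lemma Psi_osum:
  assumes C: "C \<in> EC"
  obtains g where "g \<in> C" "g \<in> NC" "Psi (osum g) \<in> alg.B1"
proof -
  obtain w where w: "w \<in> Wc" "C = cir w" using C unfolding EC_iff by blast
  obtain \<xi> \<alpha> where x: "\<xi> \<in> Z" "\<alpha> \<in> B" "ptgt Q \<alpha> = psrc \<xi>" "ptgt Q \<xi> = psrc \<alpha>" "w = pcomp \<xi> \<alpha>"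
    using odot_Z[OF w(1)] by blast
  define u p v q where "u = psrc \<xi>" "p = snd \<xi>" "v = psrc \<alpha>" "q = snd \<alpha>"
  note d = this
  have xi: "\<xi> = (u, p)" "\<alpha> = (v, q)" by (simp_all add: d)
  have P: "(u, p) \<in> P" "(v, q) \<in> P" using Z_props(1) x(1,2) B_P xi by auto
  have t: "ptgt Q (u, p) = v" "ptgt Q (v, q) = u" using x(3,4) xi by simp_all
  have wNC: "w \<in> NC" using w(1) Wc_sub by blast
  have wq: "w = (v, q @ p)" using x(5) by (simp add: xi pcomp_def)
  have p: "p \<noteq> []" using Z_ne[OF x(1)] xi by simp
  have badp: "bad p" unfolding bad_def using x(1) xi(1)
    by (intro bexI[of _ \<xi>] exI[of _ "[]"]) auto
  let ?g = "(u, p @ q)"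
  have g: "?g \<in> NC" using P t p by (simp add: NC_iff)
  have "?g = (rot ^^ length q) w" using rots_split[of v q p] wNC wq t by simp
  then have gC: "?g \<in> C" using w(2) unfolding cir_NC[OF wNC] by blast
  have "pb (u, p) = \<zero>\<^bsub>Aalg\<^esub>" using P(1) badp by (intro pb_zero) (auto simp: B_iff)
  then have "dt (v, q) (u, p) \<in> alg.B1"
    using tau_zero(2)[OF pb_in[OF P(2)]] alg.Nn_B1 by (auto simp: dt_def)
  moreover have "dt (v, q) (u, p) - (\<Sum>j<length p. tg ((rot ^^ Suc j) ?g)) \<in> alg.B1"
    using leibniz_cycle[of u p q] P t by simp
  ultimately have 1: "(\<Sum>j<length p. tg ((rot ^^ Suc j) ?g)) \<in> alg.B1"
    using mod_in[OF alg.B1_subspace mod_sym[OF alg.B1_subspace]] by blast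
  have 2: "tg ((rot ^^ Suc (length p + j)) ?g) \<in> alg.B1" if j: "j < length q" for j
  proof -
    obtain q1 c q2 where q: "q = q1 @ c # q2" "length q1 = j"
      using j id_take_nth_drop[of j q] by (metis length_take min.absorb4)
    have "rotate (length (p @ q1 @ [c])) ((p @ q1 @ [c]) @ q2) = q2 @ p @ q1 @ [c]"
      by (subst rotate_append) simp
    then have "snd ((rot ^^ Suc (length p + j)) ?g) = q2 @ p @ q1 @ [c]"
      using q by simp
    then have "bad (butlast (snd ((rot ^^ Suc (length p + j)) ?g)))"
      using bad_append(1)[OF bad_append(2)[OF badp, of q1], of q2] by (simp add: butlast_append)
    then have "(rot ^^ Suc (length p + j)) ?g \<notin> Edg" by (simp add: Edg_def)
    then show ?thesis using tg_Nn[OF rots_NC[OF g]] alg.Nn_B1 by blast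
  qed
  have "(\<Sum>j<length p + length q. tg ((rot ^^ Suc j) ?g)) \<in> alg.B1"
    unfolding sum_lessThan_add
    by (intro fv.subspace_add[OF alg.B1_subspace] fv.subspace_sum[OF alg.B1_subspace] 1 2) simp
  moreover have "Psi (osum ?g) - (\<Sum>j<length p + length q. tg ((rot ^^ Suc j) ?g)) \<in> alg.B1"
  proof -
    \<comment> \<open>Leibniz's rule starts with one rotation and \<open>osum\<close> with none;
      over a full turn the shift is immaterial.\<close>
    have "Psi (osum ?g) = (\<Sum>j<length p + length q. Psi (eE ((rot ^^ Suc j) ?g)))"
      using osum_shift[OF g, of 1] by (simp add: Psi_sum[symmetric])
    then have "Psi (osum ?g) - (\<Sum>j<length p + length q. tg ((rot ^^ Suc j) ?g)) =
        (\<Sum>j<length p + length q. Psi (eE ((rot ^^ Suc j) ?g)) - tg ((rot ^^ Suc j) ?g))"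
      by (simp only: sum_subtractf)
    also have "\<dots> \<in> alg.B1"
      by (intro fv.subspace_sum[OF alg.B1_subspace] Psi_eE rots_NC g)
    finally show ?thesis .
  qed
  ultimately have "Psi (osum ?g) \<in> alg.B1" using mod_in[OF alg.B1_subspace] by blast
  then show ?thesis using that gC g by blast
qed

text \<open>The retraction of \<open>\<alpha> dx\<close> onto the terms \<open>\<beta> dc\<close>; it descends to the quotient up to \<open>osums\<close>, which
  gives the linear independence of the classes.\<close>

definition F :: "('v, 'e) qpath \<Rightarrow> ('v, 'e) qpath \<Rightarrow> (('v, 'e) qpath \<Rightarrow>\<^sub>0 'k)" where
  "F \<alpha> x = (if ptgt Q \<alpha> = psrc x \<and> ptgt Q x = psrc \<alpha>
     then \<Sum>j<plength x. eE ((rot ^^ Suc j) (pcomp \<alpha> x)) else 0)"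

text \<open>The arrow that is cut out belongs to p, so q survives intact in what precedes it after
  the rotation.\<close>

lemma eE_bad:
  assumes "bad q" "j < length p" shows "eE ((rot ^^ Suc j) (u, p @ q)) = 0"
proof -
  obtain p1 c p2 where p: "p = p1 @ c # p2" "length p1 = j"
    using assms(2) id_take_nth_drop[of j p] by (metis length_take min.absorb4)
  have "rotate (length (p1 @ [c])) ((p1 @ [c]) @ (p2 @ q)) = (p2 @ q) @ p1 @ [c]"
    by (rule rotate_append)
  then have "snd ((rot ^^ Suc j) (u, p @ q)) = p2 @ q @ p1 @ [c]" using p by simp
  then have "bad (butlast (snd ((rot ^^ Suc j) (u, p @ q))))"
    using bad_append(1)[OF bad_append(2)[OF assms(1), of p1], of p2] by (simp add: butlast_append)
  then show ?thesis by (simp add: eE_def Edg_def)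
qed

lemma F_bad: "bad (snd \<alpha>) \<Longrightarrow> F \<alpha> x = 0"
  by (simp add: F_def pcomp_def eE_bad del: funpow.simps)

text \<open>\<open>bil\<close> discards pairs that contain a zero path. In the first argument
  \<open>F\<close> vanishes there of its own accord, which leaves a case distinction on the second
  argument.\<close>

lemma bil_F:
  assumes "\<alpha> \<in> P" "x \<in> P"
  shows "bil F (pb \<alpha>) (pb x) = (if x \<in> B then F \<alpha> x else 0)"
  using bil_pb[OF assms, of F] F_bad[of \<alpha> x] assms by (auto simp: B_iff)

text \<open>If the three paths close up, the two outer terms together run over the arrows of the
  product xy. They cancel against the middle term if xy is nonzero. If xy is zero the middle term is
  missing; the arrows of \<alpha> would contribute nothing, as their coefficients contain xy, so
  what remains is already a full turn.\<close>

lemma F_rel: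
  assumes "\<alpha> \<in> B" "x \<in> B" "y \<in> B"
  shows "bil F (pb \<alpha> \<otimes>\<^bsub>Aalg\<^esub> pb x) (pb y) - bil F (pb \<alpha>) (pb x \<otimes>\<^bsub>Aalg\<^esub> pb y)
    + bil F (pb y \<otimes>\<^bsub>Aalg\<^esub> pb \<alpha>) (pb x) \<in> osums"
proof -
  have P: "\<alpha> \<in> P" "x \<in> P" "y \<in> P" using assms B_P by auto
  have e1: "bil F (pb \<alpha> \<otimes>\<^bsub>Aalg\<^esub> pb x) (pb y) =
      (if ptgt Q x = psrc \<alpha> then F (pcomp \<alpha> x) y else 0)"
    using P assms(3) by (simp add: pb_mult bil_F bil_linear pcomp_path)
  have e2: "bil F (pb \<alpha>) (pb x \<otimes>\<^bsub>Aalg\<^esub> pb y) =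
      (if ptgt Q y = psrc x \<and> pcomp x y \<in> B then F \<alpha> (pcomp x y) else 0)"
    using P by (simp add: pb_mult bil_F bil_linear pcomp_path)
  have e3: "bil F (pb y \<otimes>\<^bsub>Aalg\<^esub> pb \<alpha>) (pb x) =
      (if ptgt Q \<alpha> = psrc y then F (pcomp y \<alpha>) x else 0)"
    using P assms(2) by (simp add: pb_mult bil_F bil_linear pcomp_path)
  show ?thesis
  proof (cases "ptgt Q x = psrc \<alpha> \<and> ptgt Q y = psrc x \<and> ptgt Q \<alpha> = psrc y")
    case False
    then have "(if ptgt Q x = psrc \<alpha> then F (pcomp \<alpha> x) y else 0) = 0"
      "(if ptgt Q y = psrc x \<and> pcomp x y \<in> B then F \<alpha> (pcomp x y) else 0) = 0"
      "(if ptgt Q \<alpha> = psrc y then F (pcomp y \<alpha>) x else 0) = 0"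
      by (auto simp: F_def)
    then show ?thesis unfolding e1 e2 e3 using fv.subspace_0[OF osums_subspace] by simp
  next
    case True
    define u p v q w r where "u = psrc y" "p = snd y" "v = psrc x" "q = snd x" "w = psrc \<alpha>" "r = snd \<alpha>"
    note d = this
    have s: "y = (u, p)" "x = (v, q)" "\<alpha> = (w, r)" by (simp_all add: d)
    have t: "ptgt Q (u, p) = v" "ptgt Q (v, q) = w" "ptgt Q (w, r) = u" using True s by auto
    have P': "(u, p) \<in> P" "(v, q) \<in> P" "(w, r) \<in> P" using P s by auto
    let ?g = "(u, p @ q @ r)"
    let ?f = "\<lambda>j. eE ((rot ^^ Suc j) ?g)"
    have F1: "F (pcomp \<alpha> x) y = (\<Sum>j<length p. ?f j)"
      using t by (simp add: F_def s pcomp_def)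
    have F3: "F (pcomp y \<alpha>) x = (\<Sum>j<length q. ?f (length p + j))"
    proof (cases "p @ q @ r = []")
      case False
      then have NC: "?g \<in> NC" using t P' by (simp add: NC_iff)
      then have 1: "(rot ^^ length p) ?g = (v, q @ r @ p)" using rots_split[of u p "q @ r"] t by simp
      have "(rot ^^ Suc j) (v, q @ r @ p) = (rot ^^ Suc (length p + j)) ?g" for j
        unfolding 1[symmetric] by (simp add: funpow_add add.commute flip: funpow.simps(2))
          (metis add.commute add_Suc_right comp_apply funpow_add)
      then show ?thesis using t by (simp add: F_def s pcomp_def del: funpow.simps)
    qed (use t in \<open>simp add: F_def s pcomp_def\<close>)
    have F13: "F (pcomp \<alpha> x) y + F (pcomp y \<alpha>) x = (\<Sum>j<length p + length q. ?f j)"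
      unfolding F1 F3 sum_lessThan_add ..
    show ?thesis
    proof (cases "pcomp x y \<in> B")
      case B: True
      have "F \<alpha> (pcomp x y) = (\<Sum>j<length p + length q. ?f j)"
        using t by (simp add: F_def s pcomp_def)
      then show ?thesis
        unfolding e1 e2 e3 using True B F13 fv.subspace_0[OF osums_subspace] by (simp add: algebra_simps)
    next
      case nB: False
      then have bad: "bad (p @ q)" using pcomp_path[OF P(2,3)] True by (simp add: B_iff s pcomp_def)
      then have ne: "p @ q \<noteq> []" using not_bad_short[of "[]"] by auto
      then have NC: "?g \<in> NC" using t P' by (auto simp: NC_iff)
      have 1: "(rot ^^ (length p + length q)) ?g = (w, r @ p @ q)"
        using rots_split[of u "p @ q" r] NC t by simp
      have "?f (length p + length q + j) = 0" if "j < length r" for j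
      proof -
        have "(rot ^^ Suc (length p + length q + j)) ?g = (rot ^^ Suc j) (w, r @ p @ q)"
          unfolding 1[symmetric] by (metis add.commute add_Suc_right comp_apply funpow_add)
        then show ?thesis using eE_bad[OF bad that, of w] by simp
      qed
      then have "(\<Sum>j<length p + length q. ?f j) = (\<Sum>j<length p + length q + length r. ?f j)"
        by (simp only: sum_lessThan_add[of _ "length p + length q"]) simp
      also have "\<dots> = osum ?g" using osum_shift[OF NC, of 1] by (simp add: add.assoc)
      also have "\<dots> \<in> osums"
        unfolding osums_def using NC bad_append(2)[OF bad, of r]
        by (intro fv.span_base image_eqI[of _ _ ?g]) (auto intro!: exI[of _ 0])
      finally show ?thesis
        unfolding e1 e2 e3 using True nB F13 by simp
    qed
  qed
qed

lemma ev1_tg: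
  assumes "\<gamma> \<in> NC" shows "alg.ev1 (bil F) (tg \<gamma>) = eE \<gamma>"
proof -
  obtain q c where q: "\<gamma> = (head Q c, q @ [c])" "c \<in> arcs Q" "(head Q c, q) \<in> P"
    "ptgt Q (head Q c, q) = tail Q c" "rot (tail Q c, c # q) = \<gamma>" using NC_cases[OF assms] by metis
  have ac: "arr c \<in> P" "arr c \<in> B" using q(2) not_bad_short[of "[c]"] by (simp_all add: arr_def B_iff)
  have "alg.ev1 (bil F) (tg \<gamma>) = bil F (pb (head Q c, q)) (pb (arr c))"
    unfolding tg_def dt_def
    by (subst alg.ev1_tau) (use q ac in \<open>simp_all add: bil_linear pb_in\<close>)
  also have "\<dots> = F (head Q c, q) (arr c)" using bil_F[OF q(3) ac(1)] ac(2) by simp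
  also have "\<dots> = eE \<gamma>" using q by (simp add: F_def arr_def pcomp_def)
  finally show ?thesis .
qed

text \<open>The retraction property: it transfers the question of independence from chains to
  functions on \<open>Edg\<close>.\<close>

lemma ev1_Psi:
  assumes "supp \<kappa> \<subseteq> Edg" shows "alg.ev1 (bil F) (Psi \<kappa>) = \<kappa>"
proof -
  have "alg.ev1 (bil F) (Psi \<kappa>) = lin_ext (\<lambda>\<gamma>. alg.ev1 (bil F) (tg \<gamma>)) \<kappa>"
    by (simp add: alg.ev1_def Psi_def lin_ext_comp)
  also have "\<dots> = lin_ext (\<lambda>\<gamma>. sgl \<gamma> 1) \<kappa>"
  proof (rule lin_ext_cong)
    fix \<gamma> assume "\<gamma> \<in> supp \<kappa>"
    then have "\<gamma> \<in> Edg" "\<gamma> \<in> NC" using assms Wc_sub by blast+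
    then show "alg.ev1 (bil F) (tg \<gamma>) = sgl \<gamma> 1" by (simp add: ev1_tg eE_def)
  qed
  finally show ?thesis by (simp add: lin_ext_ident)
qed

lemma ev1_B1: "f \<in> alg.B1 \<Longrightarrow> alg.ev1 (bil F) f \<in> osums"
proof -
  assume "f \<in> alg.B1"
  then obtain g h where *: "f = g + alg.Dn 2 h" "g \<in> alg.Nn 1" "supp h \<subseteq> alg.Fs 2"
    unfolding alg.B1_def by blast
  have "alg.ev1 (bil F) g = 0"
    by (rule alg.ev1_null[OF _ _ _ _ *(2)]) (simp_all add: bil_linear)
  moreover have "alg.ev1 (bil F) (alg.Dn 2 h) \<in> osums"
    by (rule alg.ev1_Dn[OF _ _ _ _ osums_subspace _ *(3)])
      (simp_all add: bil_linear bil_rel[OF osums_subspace F_rel])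
  ultimately show ?thesis by (simp add: *(1) alg.ev1_def lin_ext_add)
qed


section \<open>Boundaries of one-chains and the spanning set\<close>

definition BN :: "('v, 'e) qpath set" where
  "BN = {\<alpha> \<in> B. ptgt Q \<alpha> \<noteq> psrc \<alpha>}"

text \<open>What Leibniz's rule leaves over from tensors that do not close up. The source vertex
  fixes \<alpha> on one side and, \<alpha> not being a cycle, kills it on the other; hence the
  boundary is \<alpha>.\<close>

definition eta :: "('v, 'e) qpath \<Rightarrow> _" where
  "eta \<alpha> = dt \<alpha> (psrc \<alpha>, [])"

lemma ev0_nf_null: "f \<in> alg.Nn 0 \<Longrightarrow> alg.ev0 nf f = 0"
  by (rule alg.ev0_null[of nf]) (simp_all add: nf_add nf_sc)

lemma ev0_nf_dt:
  assumes "\<alpha> \<in> P" "x \<in> P"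
  shows "alg.ev0 nf (alg.Dn 1 (dt \<alpha> x)) = nf (pb \<alpha> \<otimes>\<^bsub>Aalg\<^esub> pb x) - nf (pb x \<otimes>\<^bsub>Aalg\<^esub> pb \<alpha>)"
proof -
  have tau: "alg.ev0 nf (alg.tau 0 a []) = nf a" if "a \<in> carrier Aalg" for a
    using that by (intro alg.ev0_tau) (simp_all add: nf_add nf_sc)
  have "alg.ev0 nf (alg.Dn 1 (dt \<alpha> x)) = alg.ev0 nf (alg.tau 0 (pb \<alpha> \<otimes>\<^bsub>Aalg\<^esub> pb x) [] -
      alg.tau 0 (pb x \<otimes>\<^bsub>Aalg\<^esub> pb \<alpha>) [])"
    using ev0_nf_null[OF alg.Dn_tau_1[OF pb_in[OF assms(1)] pb_in[OF assms(2)]]]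
    by (simp add: dt_def alg.ev0_def lin_ext_diff)
  also have "\<dots> = nf (pb \<alpha> \<otimes>\<^bsub>Aalg\<^esub> pb x) - nf (pb x \<otimes>\<^bsub>Aalg\<^esub> pb \<alpha>)"
    using tau[OF alg.alg_closed[OF pb_in[OF assms(1)] pb_in[OF assms(2)]]]
      tau[OF alg.alg_closed[OF pb_in[OF assms(2)] pb_in[OF assms(1)]]]
    by (simp add: alg.ev0_def lin_ext_diff)
  finally show ?thesis .
qed

lemma lookup_nf_pb:
  assumes "\<gamma> \<in> P" shows "coef (nf (pb \<gamma>)) \<delta> = (if \<gamma> = \<delta> \<and> \<delta> \<in> B then 1 else 0)"
  using assms by (cases "\<gamma> \<in> B") (auto simp: nf_pb pb_zero nf_zero lookup_single when_def)

text \<open>With \<gamma> = c\<beta> the boundary of \<beta> dc is \<beta>c - c\<beta>, and \<beta>c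
  is the cycle whose rotation is \<gamma>. This is how rotation enters the condition on
  one-cycles.\<close>

lemma lookup_ev0_tg:
  assumes "\<gamma> \<in> NC"
  shows "coef (alg.ev0 nf (alg.Dn 1 (tg \<gamma>))) \<delta> =
    (if \<delta> \<in> NC \<and> \<delta> \<in> B then (if \<gamma> = rot \<delta> then 1 else 0) - (if \<gamma> = \<delta> then 1 else 0) else 0)"
proof -
  obtain q c where q: "\<gamma> = (head Q c, q @ [c])" "c \<in> arcs Q" "(head Q c, q) \<in> P"
    "ptgt Q (head Q c, q) = tail Q c" "(tail Q c, c # q) \<in> NC" "rot (tail Q c, c # q) = \<gamma>"
    using NC_cases[OF assms] .
  have ac: "arr c \<in> P" using q(2) by (simp add: arr_def)
  have mult: "pb (head Q c, q) \<otimes>\<^bsub>Aalg\<^esub> pb (arr c) = pb (tail Q c, c # q)"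
    "pb (arr c) \<otimes>\<^bsub>Aalg\<^esub> pb (head Q c, q) = pb \<gamma>"
    using q ac by (simp_all add: pb_mult) (simp_all add: arr_def pcomp_def)
  have "alg.ev0 nf (alg.Dn 1 (tg \<gamma>)) = nf (pb (tail Q c, c # q)) - nf (pb \<gamma>)"
    using ev0_nf_dt[OF q(3) ac] by (simp only: mult) (simp add: tg_def q(1))
  then have "coef (alg.ev0 nf (alg.Dn 1 (tg \<gamma>))) \<delta> =
      (if (tail Q c, c # q) = \<delta> \<and> \<delta> \<in> B then 1 else 0) - (if \<gamma> = \<delta> \<and> \<delta> \<in> B then 1 else 0)"
    using lookup_nf_pb[OF NC_path[OF q(5)]] lookup_nf_pb[OF NC_path[OF assms]]
    by (simp add: lookup_minus)
  moreover have "(tail Q c, c # q) = \<delta> \<longleftrightarrow> \<delta> \<in> NC \<and> \<gamma> = rot \<delta>"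
    using q(5,6) rot_inj[OF q(5), of \<delta>] by auto
  ultimately show ?thesis using assms by auto
qed

lemma lookup_ev0_Psi:
  assumes "supp \<kappa> \<subseteq> Edg"
  shows "coef (alg.ev0 nf (alg.Dn 1 (Psi \<kappa>))) \<delta> =
    (if \<delta> \<in> NC \<and> \<delta> \<in> B then coef \<kappa> (rot \<delta>) - coef \<kappa> \<delta> else 0)"
proof -
  have "alg.ev0 nf (alg.Dn 1 (Psi \<kappa>)) = lin_ext (\<lambda>\<gamma>. alg.ev0 nf (alg.Dn 1 (tg \<gamma>))) \<kappa>"
    by (simp add: alg.ev0_def alg.Dn_def Psi_def lin_ext_comp)
  then have "coef (alg.ev0 nf (alg.Dn 1 (Psi \<kappa>))) \<delta> =
      (\<Sum>\<gamma>\<in>supp \<kappa>. coef \<kappa> \<gamma> *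
        (if \<delta> \<in> NC \<and> \<delta> \<in> B then (if \<gamma> = rot \<delta> then 1 else 0) - (if \<gamma> = \<delta> then 1 else 0) else 0))"
    using assms Wc_sub(2) by (simp only: lookup_lin_ext lookup_ev0_tg subset_iff cong: sum.cong)
  also have "\<dots> = (if \<delta> \<in> NC \<and> \<delta> \<in> B then
      (\<Sum>\<gamma>\<in>supp \<kappa>. if \<gamma> = rot \<delta> then coef \<kappa> (rot \<delta>) else 0)
      - (\<Sum>\<gamma>\<in>supp \<kappa>. if \<gamma> = \<delta> then coef \<kappa> \<delta> else 0) else 0)"
    unfolding sum_subtractf[symmetric] by (auto intro!: sum.cong)
  also have "\<dots> = (if \<delta> \<in> NC \<and> \<delta> \<in> B then coef \<kappa> (rot \<delta>) - coef \<kappa> \<delta> else 0)"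
    by (simp add: sum.delta in_keys_iff)
  finally show ?thesis .
qed

lemma ev0_eta: "\<alpha> \<in> BN \<Longrightarrow> alg.ev0 nf (alg.Dn 1 (eta \<alpha>)) = sgl \<alpha> 1"
proof -
  assume a: "\<alpha> \<in> BN"
  then have P: "\<alpha> \<in> P" "\<alpha> \<in> B" using B_P by (auto simp: BN_def)
  then have v: "(psrc \<alpha>, []) \<in> P" using path_verts[of "psrc \<alpha>" "snd \<alpha>"] by simp
  have "pb \<alpha> \<otimes>\<^bsub>Aalg\<^esub> pb (psrc \<alpha>, []) = pb \<alpha>"
    "pb (psrc \<alpha>, []) \<otimes>\<^bsub>Aalg\<^esub> pb \<alpha> = \<zero>\<^bsub>Aalg\<^esub>"
    using a by (simp_all add: pb_mult[OF P(1) v] pb_mult[OF v P(1)] BN_def) (simp add: pcomp_def)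
  then show ?thesis using ev0_nf_dt[OF P(1) v] P(2) by (simp add: eta_def nf_pb nf_zero)
qed

text \<open>Modulo \<open>Nn 0\<close>, a chain of degree zero is \<open>tau 0 a []\<close> for a
  single element \<open>a\<close>, and \<open>ev0 nf\<close> returns the normal form of
  \<open>a\<close>.\<close>

lemma ev0_inj:
  assumes "supp f \<subseteq> alg.Fs 0" "alg.ev0 nf f = 0"
  shows "f \<in> alg.Nn 0"
proof -
  let ?S = "{f. \<exists>a\<in>carrier Aalg. f - alg.tau 0 a [] \<in> alg.Nn 0}"
  note sub = alg.tn.U_subspace[of 0]
  have tau0: "alg.tau 0 \<zero>\<^bsub>Aalg\<^esub> [] \<in> alg.Nn 0"
    using alg.tau_smult_left[of "\<zero>\<^bsub>Aalg\<^esub>" "[]" 0 0] cl_sc[of 0 0] by (simp add: cl_zero)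
  have S: "fv.subspace ?S"
  proof (rule fv.subspaceI)
    show "0 \<in> ?S"
      using fv.subspace_neg[OF sub tau0] by (intro CollectI bexI[of _ "\<zero>\<^bsub>Aalg\<^esub>"]) auto
  next
    fix f g assume "f \<in> ?S" "g \<in> ?S"
    then obtain a b where ab: "a \<in> carrier Aalg" "b \<in> carrier Aalg"
      "f - alg.tau 0 a [] \<in> alg.Nn 0" "g - alg.tau 0 b [] \<in> alg.Nn 0" by blast
    have "alg.tau 0 (a \<oplus>\<^bsub>Aalg\<^esub> b) [] - (alg.tau 0 a [] + alg.tau 0 b []) \<in> alg.Nn 0"
      using alg.tau_add_left[OF ab(1,2), of "[]" 0] by (simp add: diff_diff_eq)
    then have "(f + g) - alg.tau 0 (a \<oplus>\<^bsub>Aalg\<^esub> b) [] \<in> alg.Nn 0"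
      by (rule mod_trans[OF sub mod_add[OF sub ab(3,4)] mod_sym[OF sub]])
    then show "f + g \<in> ?S" using ab(1,2) by blast
  next
    fix c f assume "f \<in> ?S"
    then obtain a where a: "a \<in> carrier Aalg" "f - alg.tau 0 a [] \<in> alg.Nn 0" by blast
    have "alg.tau 0 (c \<odot>\<^bsub>Aalg\<^esub> a) [] - sc c (alg.tau 0 a []) \<in> alg.Nn 0"
      using alg.tau_smult_left[OF a(1), of "[]" 0] by simp
    then have "sc c f - alg.tau 0 (c \<odot>\<^bsub>Aalg\<^esub> a) [] \<in> alg.Nn 0"
      by (rule mod_trans[OF sub mod_sc[OF sub a(2)] mod_sym[OF sub]])
    then show "sc c f \<in> ?S" using alg.smult_in[OF a(1)] by blast
  qed
  have "f \<in> ?S"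
  proof (rule alg.in_subspace_tau[OF S _ assms(1)])
    show "alg.Nn 0 \<subseteq> ?S"
    proof
      fix f assume "f \<in> alg.Nn 0"
      then have "f - alg.tau 0 \<zero>\<^bsub>Aalg\<^esub> [] \<in> alg.Nn 0" by (rule fv.subspace_diff[OF sub _ tau0])
      then show "f \<in> ?S" by blast
    qed
    fix a and ys :: "(('v, 'e) qpath \<Rightarrow>\<^sub>0 'k) set list"
    assume "a \<in> carrier Aalg" "length ys = 0"
    then show "alg.tau 0 a ys \<in> ?S" using fv.subspace_0[OF sub] by (intro CollectI bexI[of _ a]) auto
  qed
  then obtain a where a: "a \<in> carrier Aalg" "f - alg.tau 0 a [] \<in> alg.Nn 0" by blast
  have "alg.ev0 nf (alg.tau 0 a []) = nf a"
    using a(1) by (intro alg.ev0_tau) (simp_all add: nf_add nf_sc)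
  then have "nf a = 0" using ev0_nf_null[OF a(2)] assms(2) by (simp add: alg.ev0_def lin_ext_diff)
  then have "a = \<zero>\<^bsub>Aalg\<^esub>" using cl_nf[OF a(1)] by (simp add: cl_zero)
  then show ?thesis using mod_in[OF sub a(2)] tau0 by simp
qed

lemma dt_keys: "\<lbrakk>\<alpha> \<in> P; x \<in> P\<rbrakk> \<Longrightarrow> supp (dt \<alpha> x) \<subseteq> alg.Fs 1"
  unfolding dt_def by (rule alg.tau_keys) (simp_all add: pb_in)

lemma tg_keys: "\<gamma> \<in> NC \<Longrightarrow> supp (tg \<gamma>) \<subseteq> alg.Fs 1"
proof -
  assume "\<gamma> \<in> NC"
  then obtain q c where q: "\<gamma> = (head Q c, q @ [c])" "c \<in> arcs Q" "(head Q c, q) \<in> P"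
    using NC_cases by metis
  have "arr c \<in> P" using q(2) by (simp add: arr_def)
  then show ?thesis using dt_keys[OF q(3)] by (simp add: tg_def q(1))
qed

lemma Psi_keys: "supp \<kappa> \<subseteq> Edg \<Longrightarrow> supp (Psi \<kappa>) \<subseteq> alg.Fs 1"
  unfolding Psi_def by (rule lin_ext_keys, rule tg_keys) (use Wc_sub in blast)

lemma Psi_seg_Z1:
  assumes "finite Edg" shows "Psi (seg m) \<in> alg.Z1"
proof -
  note k = Psi_keys[OF seg_keys[of m]]
  have "alg.ev0 nf (alg.Dn 1 (Psi (seg m))) = 0"
    using seg_cycle[OF assms, of _ m]
    by (intro poly_mapping_eqI) (simp add: lookup_ev0_Psi[OF seg_keys] B_iff del: One_nat_def)
  moreover have "supp (alg.Dn 1 (Psi (seg m))) \<subseteq> alg.Fs 0"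
    using alg.Dn_keys[of "Psi (seg m)" 0] k by simp
  ultimately have "alg.Dn 1 (Psi (seg m)) \<in> alg.Nn 0" using ev0_inj by blast
  then show ?thesis using k unfolding alg.Z1_def by blast
qed

text \<open>If \<alpha> dx does not close up, a vertex is inserted at an end of x that fails to fit
  \<alpha>. One of the two Leibniz terms then vanishes and the other is the differential of a
  vertex, so that everything open reduces to vertices.\<close>

lemma dt_span:
  assumes U: "fv.subspace U" "alg.B1 \<subseteq> U" "tg ` Edg \<subseteq> U" "eta ` BN \<subseteq> U"
    and f: "supp f \<subseteq> alg.Fs 1"
  shows "f \<in> U"
proof -
  have NU: "alg.Nn 1 \<subseteq> U" using alg.Nn_B1 U(2) by blast
  have modU: "f \<in> U" if "f - (g + h) \<in> alg.B1" "g \<in> U" "h \<in> U" for f g h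
    using mod_in[OF U(1) subsetD[OF U(2) that(1)] fv.subspace_add[OF U(1) that(2,3)]] .
  have z: "alg.tau 1 \<zero>\<^bsub>Aalg\<^esub> [x] \<in> U" "alg.tau 1 x [\<zero>\<^bsub>Aalg\<^esub>] \<in> U" if "x \<in> carrier Aalg" for x
    using tau_zero[OF that] NU by blast+
  have vert: "(psrc \<alpha>, []) \<in> P" "(ptgt Q \<alpha>, []) \<in> P" if "\<alpha> \<in> P" for \<alpha>
    using that path_verts[of "psrc \<alpha>" "snd \<alpha>"] ptgt_verts[of "psrc \<alpha>" "snd \<alpha>"] by simp_all
  have vv: "dt \<alpha> (e, []) \<in> U" if \<alpha>: "\<alpha> \<in> P" and e: "(e, []) \<in> P" for \<alpha> e
  proof -
    note ain = pb_in[OF \<alpha>] and ein = pb_in[OF e]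
    have ee: "pb (e, []) \<otimes>\<^bsub>Aalg\<^esub> pb (e, []) = pb (e, [])" using e by (simp add: pb_mult pcomp_def)
    consider "\<alpha> \<notin> B" | "ptgt Q \<alpha> = psrc \<alpha>" "e = psrc \<alpha>" | "\<alpha> \<in> BN" "e = psrc \<alpha>"
      | "ptgt Q \<alpha> = e" "psrc \<alpha> \<noteq> e" "\<alpha> \<in> BN" | "ptgt Q \<alpha> \<noteq> e" "psrc \<alpha> \<noteq> e"
      by (auto simp: BN_def)
    then show ?thesis
    proof cases
      case 1
      then show ?thesis using z(1)[OF ein] pb_zero[OF \<alpha>] by (simp add: dt_def)
    next
      case 2
      obtain q where q: "\<alpha> = (e, q)" using 2(2) by (cases \<alpha>) simp
      have t: "ptgt Q (e, q) = e" "(e, q) \<in> P" using 2(1) \<alpha> unfolding q by simp_all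
      have "dt \<alpha> (e, []) \<in> alg.B1" using leibniz_cycle[of e "[]" q] t e unfolding q by simp
      then show ?thesis using U(2) by blast
    next
      case 3
      then show ?thesis using U(4) by (auto simp: eta_def)
    next
      case 4
      \<comment> \<open>For s the source of \<alpha>, the product of s and e is zero while \<alpha>s
        = e\<alpha> = \<alpha>. Leibniz's rule for this product makes \<alpha> de the negative of
        \<open>eta \<alpha>\<close> modulo \<open>U\<close>.\<close>
      define s where "s = psrc \<alpha>"
      have s: "(s, []) \<in> P" using vert[OF \<alpha>] by (simp add: s_def)
      have m: "pb \<alpha> \<otimes>\<^bsub>Aalg\<^esub> pb (s, []) = pb \<alpha>" "pb (s, []) \<otimes>\<^bsub>Aalg\<^esub> pb (e, []) = \<zero>\<^bsub>Aalg\<^esub>"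
        "pb (e, []) \<otimes>\<^bsub>Aalg\<^esub> pb \<alpha> = pb \<alpha>"
        using \<alpha> e s 4 by (auto simp: pb_mult s_def pcomp_def)
      have "alg.tau 1 (pb \<alpha>) [\<zero>\<^bsub>Aalg\<^esub>] - (dt \<alpha> (e, []) + dt \<alpha> (s, [])) \<in> alg.B1"
        using dt_leibniz[OF ain pb_in[OF s] ein] by (simp only: m dt_def)
      then have "alg.tau 1 (pb \<alpha>) [\<zero>\<^bsub>Aalg\<^esub>] - (dt \<alpha> (e, []) + dt \<alpha> (s, [])) \<in> U"
        using U(2) by blast
      from fv.subspace_diff[OF U(1) z(2)[OF ain] this] have "dt \<alpha> (e, []) + dt \<alpha> (s, []) \<in> U"
        by (simp add: add.commute)
      moreover have "dt \<alpha> (s, []) \<in> U" using U(4) 4(3) by (auto simp: eta_def s_def)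
      ultimately have "dt \<alpha> (e, []) + dt \<alpha> (s, []) - dt \<alpha> (s, []) \<in> U"
        by (rule fv.subspace_diff[OF U(1)])
      then show ?thesis by simp
    next
      case 5
      \<comment> \<open>Both products of \<alpha> with e vanish, so writing e as ee turns \<alpha>
        de into two null terms.\<close>
      have m: "pb \<alpha> \<otimes>\<^bsub>Aalg\<^esub> pb (e, []) = \<zero>\<^bsub>Aalg\<^esub>" "pb (e, []) \<otimes>\<^bsub>Aalg\<^esub> pb \<alpha> = \<zero>\<^bsub>Aalg\<^esub>"
        using \<alpha> e 5 by (auto simp: pb_mult)
      show ?thesis unfolding dt_def
        by (rule modU[OF dt_leibniz[OF ain ein ein, unfolded ee m] z(1)[OF ein] z(1)[OF ein]])
    qed
  qed
  have prod: "alg.tau 1 (pb x \<otimes>\<^bsub>Aalg\<^esub> pb \<alpha>) [pb (e, [])] \<in> U"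
    if "\<alpha> \<in> P" "x \<in> P" "(e, []) \<in> P" for \<alpha> x e
    using vv[OF pcomp_path[OF that(2,1)] that(3)] z(1)[OF pb_in[OF that(3)]] that
    by (simp add: pb_mult dt_def)
  have "dt \<alpha> x \<in> U" if "\<alpha> \<in> B" "x \<in> B" for \<alpha> x
  proof -
    have P: "\<alpha> \<in> P" "x \<in> P" using that B_P by auto
    consider "ptgt Q x = psrc \<alpha>" "ptgt Q \<alpha> = psrc x" | "ptgt Q x \<noteq> psrc \<alpha>" | "ptgt Q \<alpha> \<noteq> psrc x" by blast
    then show ?thesis
    proof cases
      case 1
      obtain u p where x: "x = (u, p)" by force
      obtain q where a: "\<alpha> = (ptgt Q (u, p), q)" using 1 x by (cases \<alpha>) simp
      have Pp: "(u, p) \<in> P" "(ptgt Q (u, p), q) \<in> P" "ptgt Q (ptgt Q (u, p), q) = u" using P x a 1 by auto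
      have tgU: "tg ((rot ^^ Suc j) (u, p @ q)) \<in> U" if j: "j < length p" for j
      proof -
        have "(u, p @ q) \<in> NC" using Pp j by (auto simp: NC_iff)
        then have NC: "(rot ^^ Suc j) (u, p @ q) \<in> NC" by (rule rots_NC)
        then show ?thesis using tg_Nn[OF NC] NU U(3) by blast
      qed
      show ?thesis
        using mod_in[OF U(1) subsetD[OF U(2) leibniz_cycle[OF Pp]] fv.subspace_sum[OF U(1)]] tgU
        by (simp add: x a del: funpow.simps)
    next
      case 2
      let ?e = "(ptgt Q x, [])"
      have e: "?e \<in> P" using vert[OF P(2)] by simp
      have m: "pb ?e \<otimes>\<^bsub>Aalg\<^esub> pb x = pb x" "pb \<alpha> \<otimes>\<^bsub>Aalg\<^esub> pb ?e = \<zero>\<^bsub>Aalg\<^esub>"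
        using P e 2 by (auto simp: pb_mult pcomp_def)
      show ?thesis unfolding dt_def
        by (rule modU[OF dt_leibniz[OF pb_in[OF P(1)] pb_in[OF e] pb_in[OF P(2)], unfolded m]])
          (use z pb_in P prod e in blast)+
    next
      case 3
      let ?e = "(psrc x, [])"
      have e: "?e \<in> P" using vert[OF P(2)] by simp
      have m: "pb x \<otimes>\<^bsub>Aalg\<^esub> pb ?e = pb x" "pb ?e \<otimes>\<^bsub>Aalg\<^esub> pb \<alpha> = \<zero>\<^bsub>Aalg\<^esub>"
        using P e 3 by (auto simp: pb_mult pcomp_def)
      show ?thesis unfolding dt_def
        by (rule modU[OF dt_leibniz[OF pb_in[OF P(1)] pb_in[OF P(2)] pb_in[OF e], unfolded m]])
          (use z pb_in P prod e in blast)+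
    qed
  qed
  then have "alg.tau 1 a [x] \<in> U" if "a \<in> carrier Aalg" "x \<in> carrier Aalg" for a x
    using tau_in[OF U(1) NU _ that] by (simp add: dt_def)
  then show ?thesis
    by (intro alg.in_subspace_tau[OF U(1) NU f]) (auto simp: length_Suc_conv)
qed


text \<open>Because \<open>stop\<close> fixes each representative, every sum over a run contains its
  own representative and no other: the sums are dual to the coefficients at
  \<open>reps\<close>.\<close>

lemma lookup_segs:
  assumes "finite Edg" "m \<in> reps"
  shows "coef (lin_ext seg \<kappa>) m = coef \<kappa> m"
proof -
  have m: "m \<in> Edg" "stop m = m" using assms(2) stop_Edg stop_stop by (auto simp: reps_def)
  have "coef (lin_ext seg \<kappa>) m =
      (\<Sum>x\<in>supp \<kappa>. if x = m then coef \<kappa> m else 0)"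
    unfolding lookup_lin_ext by (rule sum.cong) (use m in \<open>auto simp: lookup_seg[OF assms(1)]\<close>)
  then show ?thesis by (simp add: sum.delta in_keys_iff)
qed

theorem HH1_monomial:
  assumes fin: "finite B" and char0: "\<And>n. n \<noteq> 0 \<Longrightarrow> (of_nat n :: 'k) \<noteq> 0"
  shows "vectorspace.fin_dim class_ring (HH 1 Aalg) \<and>
    vectorspace.dim class_ring (HH 1 Aalg) = card (reps - wit ` EC)"
proof (rule alg.HH1_basis[where g = "\<lambda>m. Psi (seg m)"])
  let ?M = "reps - wit ` EC"
  note finE = finite_Edg[OF fin]
  note B1 = alg.B1_subspace
  show "finite ?M" by (rule card_reps(1)[OF fin])
  show "Psi (seg m) \<in> alg.Z1" for m by (rule Psi_seg_Z1[OF finE])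
  show "\<exists>\<kappa>. supp \<kappa> \<subseteq> ?M \<and> f - lin_ext (\<lambda>m. Psi (seg m)) \<kappa> \<in> alg.B1"
    if f: "f \<in> alg.Z1" for f
  proof -
    have "f \<in> fv.span ((alg.B1 \<union> tg ` Edg) \<union> eta ` BN)"
      by (rule dt_span) (use f in \<open>auto simp: alg.Z1_def intro: fv.span_base\<close>)
    then obtain x y where xy: "x \<in> fv.span (alg.B1 \<union> tg ` Edg)" "y \<in> fv.span (eta ` BN)" "f = x + y"
      unfolding fv.span_Un by blast
    obtain b z where bz: "b \<in> fv.span alg.B1" "z \<in> fv.span (tg ` Edg)" "x = b + z"
      using xy(1) unfolding fv.span_Un by blast
    obtain \<kappa> where \<kappa>: "supp \<kappa> \<subseteq> Edg" "z = Psi \<kappa>"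
      using span_image_lin_ext[OF bz(2)] unfolding Psi_def by blast
    obtain \<mu> where \<mu>: "supp \<mu> \<subseteq> BN" "y = lin_ext eta \<mu>"
      using span_image_lin_ext[OF xy(2)] by blast
    have b: "b \<in> alg.B1" using bz(1) B1 by (simp add: fv.span_eq_iff[THEN iffD2])
    have ev: "alg.ev0 nf (alg.Dn 1 g) = 0" if "g \<in> alg.Z1" for g
      using that ev0_nf_null by (simp add: alg.Z1_def)
    have "alg.ev0 nf (alg.Dn 1 f) = alg.ev0 nf (alg.Dn 1 b) + alg.ev0 nf (alg.Dn 1 (Psi \<kappa>))
        + alg.ev0 nf (alg.Dn 1 y)"
      by (simp add: xy(3) bz(3) \<kappa>(2) alg.ev0_def alg.Dn_def lin_ext_add)
    moreover have "alg.ev0 nf (alg.Dn 1 y) = \<mu>"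
    proof -
      have "alg.ev0 nf (alg.Dn 1 y) = lin_ext (\<lambda>\<alpha>. alg.ev0 nf (alg.Dn 1 (eta \<alpha>))) \<mu>"
        by (simp add: \<mu>(2) alg.ev0_def alg.Dn_def lin_ext_comp)
      also have "\<dots> = lin_ext (\<lambda>\<alpha>. sgl \<alpha> 1) \<mu>"
        by (rule lin_ext_cong, rule ev0_eta) (use \<mu>(1) in blast)
      finally show ?thesis by (simp add: lin_ext_ident)
    qed
    \<comment> \<open>The two summands are supported on disjoint sets of paths, the first on cycles
      and \<mu> on paths that are not cycles. Each therefore vanishes by itself.\<close>
    ultimately have "alg.ev0 nf (alg.Dn 1 (Psi \<kappa>)) + \<mu> = 0"
      using ev[OF f] ev[OF subsetD[OF alg.B1_Z1 b]] by simp
    then have "coef (alg.ev0 nf (alg.Dn 1 (Psi \<kappa>)) + \<mu>) \<delta> = 0" for \<delta> by simp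
    note z0 = this
    have eq: "(if \<delta> \<in> NC \<and> \<delta> \<in> B then coef \<kappa> (rot \<delta>) - coef \<kappa> \<delta> else 0)
        + coef \<mu> \<delta> = 0" for \<delta>
      using z0[of \<delta>] unfolding lookup_add lookup_ev0_Psi[OF \<kappa>(1)] .
    have NC_BN: "coef \<mu> \<delta> = 0" if "\<delta> \<in> NC" for \<delta>
    proof -
      have "\<delta> \<notin> BN" using that by (cases \<delta>) (auto simp: NC_iff BN_def)
      then show ?thesis using \<mu>(1) by (auto simp: in_keys_iff)
    qed
    have "\<mu> = 0"
    proof (rule poly_mapping_eqI)
      fix \<delta> show "coef \<mu> \<delta> = coef 0 \<delta>"
        using eq[of \<delta>] NC_BN[of \<delta>] by (cases "\<delta> \<in> NC") simp_all
    qed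
    have cyc: "coef \<kappa> (rot \<delta>) = coef \<kappa> \<delta>" if "\<delta> \<in> NC" "\<not> bad (snd \<delta>)" for \<delta>
      using eq[of \<delta>] that NC_path by (simp add: B_iff NC_BN)
    let ?U = "fv.span (alg.B1 \<union> (\<lambda>m. Psi (seg m)) ` ?M)"
    have BU: "g \<in> ?U" if "g \<in> alg.B1" for g using that by (auto intro: fv.span_base)
    have MU: "Psi (seg m) \<in> ?U" if "m \<in> ?M" for m using that by (auto intro: fv.span_base)
    have seg_U: "Psi (seg m) \<in> ?U" if m: "m \<in> reps" for m
    proof (cases "m \<in> ?M")
      case False
      \<comment> \<open>For a witness, the relation of its circuit is solved for its run. Dividing
        by the multiplicity \<open>cnt g g\<close> is where characteristic zero is used.\<close>
      then obtain C where C: "C \<in> EC" "m = wit C" using m by blast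
      obtain g where g: "g \<in> C" "g \<in> NC" "Psi (osum g) \<in> alg.B1" using Psi_osum[OF C(1)] .
      have finW: "finite (Wc \<inter> C)" using finE Wc_sub by (auto intro: finite_subset)
      have mW: "m \<in> Wc \<inter> C" using wit_in[OF C(1)] C(2) by simp
      let ?c = "of_nat (cnt g g) :: 'k"
      have c: "?c \<noteq> 0" by (rule char0[OF cnt_cir(3)[OF g(2)]])
      have "Psi (osum g) = sc ?c (\<Sum>m\<in>Wc \<inter> C. Psi (seg m))"
        unfolding osum_seg[OF finE C(1) g(1)] by (simp only: Psi_def lin_ext_sc lin_ext_sum)
      then have "(\<Sum>m\<in>Wc \<inter> C. Psi (seg m)) = sc (inverse ?c) (Psi (osum g))"
        using c by simp
      then have "(\<Sum>m\<in>Wc \<inter> C. Psi (seg m)) \<in> ?U"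
        using BU[OF g(3)] fv.span_scale by metis
      moreover have "(\<Sum>m\<in>Wc \<inter> C - {m}. Psi (seg m)) \<in> ?U"
      proof (intro fv.span_sum MU)
        fix m' assume m': "m' \<in> Wc \<inter> C - {m}"
        \<comment> \<open>Efficient circuits with a common cycle coincide, so another member of W in
          C cannot be the witness of a different circuit.\<close>
        have "m' \<notin> wit ` EC"
        proof
          assume "m' \<in> wit ` EC"
          then obtain C' where C': "C' \<in> EC" "m' = wit C'" by blast
          then have "C' = C" using EC_cir[OF C'(1)] EC_cir[OF C(1)] wit_in[OF C'(1)] m' by blast
          then show False using C'(2) C(2) m' by simp
        qed
        then show "m' \<in> ?M" using m' by (simp add: reps_eq)
      qed
      ultimately have "(\<Sum>m\<in>Wc \<inter> C. Psi (seg m)) - (\<Sum>m\<in>Wc \<inter> C - {m}. Psi (seg m)) \<in> ?U"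
        by (rule fv.span_diff)
      then show ?thesis using sum.remove[OF finW mW, of "\<lambda>m. Psi (seg m)"] by simp
    qed (rule MU)
    have "\<kappa> = (\<Sum>m\<in>reps. sc (coef \<kappa> m) (seg m))"
      by (rule cycle_expand[OF finE \<kappa>(1)]) (rule cyc)
    from arg_cong[OF this, of Psi]
    have "Psi \<kappa> = (\<Sum>m\<in>reps. sc (coef \<kappa> m) (Psi (seg m)))"
      by (simp only: Psi_def lin_ext_sc lin_ext_sum)
    then have "Psi \<kappa> \<in> ?U" using seg_U by (simp add: fv.span_sum fv.span_scale)
    then have "f \<in> ?U"
      using fv.span_add[OF BU[OF b]] \<open>\<mu> = 0\<close> by (simp add: xy(3) bz(3) \<kappa>(2) \<mu>(2))
    then obtain b' x' where *: "b' \<in> fv.span alg.B1" "x' \<in> fv.span ((\<lambda>m. Psi (seg m)) ` ?M)" "f = b' + x'"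
      unfolding fv.span_Un by blast
    have "b' \<in> alg.B1" using *(1) B1 by (simp add: fv.span_eq_iff[THEN iffD2])
    moreover obtain \<kappa>' where "supp \<kappa>' \<subseteq> ?M" "x' = lin_ext (\<lambda>m. Psi (seg m)) \<kappa>'"
      using span_image_lin_ext[OF *(2)] .
    ultimately show ?thesis using *(3) by (intro exI[of _ \<kappa>']) simp
  qed
  show "\<kappa> = 0" if \<kappa>: "supp \<kappa> \<subseteq> ?M" "lin_ext (\<lambda>m. Psi (seg m)) \<kappa> \<in> alg.B1" for \<kappa>
  proof (rule poly_mapping_eqI)
    fix m
    have "lin_ext (\<lambda>m. Psi (seg m)) \<kappa> = Psi (lin_ext seg \<kappa>)" by (simp add: Psi_def lin_ext_comp)
    moreover have "supp (lin_ext seg \<kappa>) \<subseteq> Edg" by (rule lin_ext_keys, rule seg_keys)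
    \<comment> \<open>The retraction sends the chain back to its coefficient function and boundaries
      into \<open>osums\<close>.\<close>
    ultimately have o: "lin_ext seg \<kappa> \<in> osums" using ev1_B1[OF \<kappa>(2)] ev1_Psi by simp
    show "coef \<kappa> m = coef 0 m"
    proof (cases "m \<in> ?M")
      case True
      then have m: "m \<in> reps" by simp
      from True consider "m \<in> Wc" | C where "C \<in> SC" "m = (SOME \<delta>. \<delta> \<in> C)" by (auto simp: reps_eq)
      then show ?thesis
      proof cases
        case 1
        then have C: "cir m \<in> EC" by (auto simp: EC_iff)
        have w: "wit (cir m) \<in> Wc \<inter> cir m" by (rule wit_in[OF C])
        then have "wit (cir m) \<in> reps" by (simp add: reps_eq)
        have "coef \<kappa> m = coef (lin_ext seg \<kappa>) m"
          by (rule lookup_segs[OF finE m, symmetric])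
        also have "\<dots> = coef (lin_ext seg \<kappa>) (wit (cir m))"
          by (rule osums_lookup[OF o C _ w]) (simp add: 1 self_cir)
        also have "\<dots> = coef \<kappa> (wit (cir m))" by (rule lookup_segs[OF finE]) fact
        also have "\<dots> = 0" using \<kappa>(1) C by (auto simp: in_keys_iff)
        finally show ?thesis by simp
      next
        case 2
        obtain \<gamma> where \<gamma>: "\<gamma> \<in> NC" "C = cir \<gamma>" "\<forall>i. \<not> bad (rotate i (snd \<gamma>))"
          using 2(1) unfolding SC_iff by blast
        have "(SOME \<delta>. \<delta> \<in> C) \<in> C" unfolding \<gamma>(2) by (rule someI[of _ \<gamma>]) (rule self_cir)
        then obtain k where k: "m = (rot ^^ k) \<gamma>" using 2(2) \<gamma>(2) cir_NC[OF \<gamma>(1)] by auto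
        have "coef (lin_ext seg \<kappa>) m = 0"
          by (rule osums_strong[OF o]) (use \<gamma> rots_NC in \<open>simp_all add: k rotate_rotate\<close>)
        then show ?thesis using lookup_segs[OF finE m] by simp
      qed
    qed (use \<kappa>(1) in \<open>auto simp: in_keys_iff\<close>)
  qed
qed

end

theorem theorem2p18:
  fixes Q :: "('v, 'e) pre_digraph"
    and Z :: "('v, 'e) qpath set"
    and A :: "('k::field_char_0, (('v, 'e) qpath \<Rightarrow>\<^sub>0 'k) set) module"
  assumes "fin_digraph Q"
    and "connected Q"
    and "monomial_relations Q Z"
    and "A = monomial_algebra Q Z"
    and "vectorspace.fin_dim class_ring A"
  shows "vectorspace.fin_dim class_ring (HH 1 A) \<and>
    int (vectorspace.dim class_ring (HH 1 A)) =
      int (card (nontrivial_strong_circuits Q Z))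
      + (\<Sum>C\<in>efficient_circuits Q Z. int (card (W_cycles Q Z \<inter> C)))
      - int (card (efficient_circuits Q Z))"
proof -
  interpret fin_digraph Q by fact
  interpret monomial_quiver Q Z "TYPE('k)" by unfold_locales fact
  have fin: "finite (nonzero_paths Q Z)"
    using finite_B assms(4,5) by simp
  have "vectorspace.fin_dim class_ring (HH 1 A) \<and>
      vectorspace.dim class_ring (HH 1 A) = card (reps - wit ` EC)"
    unfolding assms(4) by (rule HH1_monomial[OF fin]) simp
  then show ?thesis
    using card_reps(2)[OF fin] by (simp add: SC_def EC_def W_cycles_eq)
qed

end
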